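(* Let $\{X_n:n\ge 0\}$ be a time-homogeneous Markov chain on $(S,\mathcal{B})$ satisfying conditions (A1), (A2), (A3) stated in the context. Then $\{X_n\}$ has a unique stationary probability measure $\pi$, and $\int V\,d\pi<\infty$. Moreover, let $\rho$ be defined, in terms of $\beta,\tilde\beta,\lambda,K$ (and, in the non-atomic case, the chosen admissible $\alpha_2$), by $$\rho=\begin{cases}1/R_1(\beta,\lambda^{-1},\lambda^{-1}K), & \text{if } C \text{ is an atom},\\ 1/R_1(\beta,\widetilde R,L(\widetilde R)), & \text{if } C \text{ is not an atom},\end{cases}$$ and, for $\rho<\gamma<1$, let $$M=\begin{cases}M_{\mathrm{at}}\big(\gamma,\,K_1(\gamma^{-1},\beta,\lambda^{-1},\lambda^{-1}K)\big), & \text{if } C \text{ is an atom},\\ M_{\mathrm{non}}\big(\gamma,\,K_1(\gamma^{-1},\beta,\widetilde R,L(\widetilde R))\big), & \text{if } C \text{ is not an atom},\end{cases}$$ with $R_1,K_1,L,\widetilde R,M_{\mathrm{at}},M_{\mathrm{non}}$ as in the context. Then $\rho<1$, and for every $\gamma$ with $\rho<\gamma<1$ we have $M<\infty$ and $$\sup_{|g|\le V}\left|(P^ng)(x)-\int g\,d\pi\right|\le M\,V(x)\,\gamma^n\qquad\text{for all }x\in S\text{ and all }n\ge 0,$$ where the supremum is over all measurable $g:S\to\mathbf{R}$ with $|g(y)|\le V(y)$ for all $y\in S$. In particular, $P^ng(x)$ and $\int g\,d\pi$ are both well defined for every measurable $g$ with $\|g\|_V:=\sup\{|g(x)|/V(x):x\in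 S\}<\infty$.
   Context: $P(x,A)$ ($x\in S$, $A\in\mathcal{B}$) is the transition probability of the chain, and $P$ also denotes the operator $Pg(x)=\int g(y)P(x,dy)$. Assumptions. (A1) Minorization: there exist $C\in\mathcal{B}$, $\tilde\beta>0$ and a probability measure $\nu$ on $(S,\mathcal{B})$ with $P(x,A)\ge\tilde\beta\,\nu(A)$ for all $x\in C$, $A\in\mathcal{B}$. (A2) Drift: there exist a measurable $V:S\to[1,\infty)$ and constants $0<\lambda<1$, $K<\infty$ with $PV(x)\le\lambda V(x)$ if $x\notin C$ and $PV(x)\le K$ if $x\in C$. (A3) Strong aperiodicity: there exists $\beta>0$ with $\tilde\beta\,\nu(C)\ge\beta$. $C$ is an atom if $P(x,\cdot)=P(y,\cdot)$ for all $x,y\in C$; in this case it is assumed that $\tilde\beta=1$ and $\nu=P(x,\cdot)$ for any $x\in C$. If $C$ is not an atom then $\tilde\beta<1$. For $\beta>0$, $R>1$, $1<L<\infty$, put $N=(L-1)/(R-1)$ and let $R_1(\beta,R,L)$ be the unique solution $r\in(1,R)$ of $$\frac{r-1}{r(\log (R/r))^2}=\frac{e^2\beta(R-1)}{8(L-1)}.$$ For $1<r<R_1(\beta,R,L)$ put $$K_1(r,\beta,R,L)=\frac{2\beta+2(\log N)(\log (R/r))^{-1}-8Ne^{-2}(r-1)r^{-1}(\log (R/r))^{-2}}{(r-1)\left[\beta-8Ne^{-2}(r-1)r^{-1}(\log (R/r))^{-2}\right]}.$$ Non-atomic case ($\tilde\beta<1$): put $\alpha_1=1+\big(\log\frac{K-\tilde\beta}{1-\tilde\beta}\big)/(\log\lambda^{-1})$.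 The number $\alpha_2$ is $1+\big(\log\frac{K}{\tilde\beta}\big)/(\log\lambda^{-1})$; alternatively, one may take $\alpha_2=1$ if $\nu(C)=1$, or, more generally, $\alpha_2=1+(\log\widetilde K)/(\log\lambda^{-1})$ if $\nu(C)+\int_{S\setminus C}V\,d\nu\le\widetilde K<\infty$. Put $R_0=\min(\lambda^{-1},(1-\tilde\beta)^{-1/\alpha_1})$ and, for $1<R\le R_0$, $L(R)=\dfrac{\tilde\beta R^{\alpha_2}}{1-(1-\tilde\beta)R^{\alpha_1}}$ (equal to $+\infty$ if the denominator vanishes, in which case $R_1(\beta,R,L(R))$ is read as $1$). $\widetilde R$ is a maximizer of $R\mapsto R_1(\beta,R,L(R))$ over $1<R\le R_0$. For a real number $\kappa$ define $$M_{\mathrm{at}}(\gamma,\kappa)=\frac{\max(\lambda,K-\lambda/\gamma)}{\gamma-\lambda}+\frac{K(K-\lambda/\gamma)}{\gamma(\gamma-\lambda)}\kappa+\frac{(K-\lambda/\gamma)\max(\lambda,K-\lambda)}{(\gamma-\lambda)(1-\lambda)}+\frac{\lambda(K-1)}{(\gamma-\lambda)(1-\lambda)}$$ and, with $D=1-(1-\tilde\beta)\gamma^{-\alpha_1}$, $$\begin{aligned}M_{\mathrm{non}}(\gamma,\kappa)={}&\frac{\max(\lambda,K-\lambda/\gamma)}{\gamma-\lambda}+\frac{K[K\gamma-\lambda-\tilde\beta(\gamma-\lambda)]}{\gamma^2(\gamma-\lambda)D}+\frac{\tilde\beta\gamma^{-\alpha_2-2}K(K\gamma-\lambda)}{(\gamma-\lambda)D^2}\kappa\\&+\frac{\gamma^{-\alpha_2-1}(K\gamma-\lambda)}{(\gamma-\lambda)D^2}\left(\frac{\tilde\beta\max(\lambda,K-\lambda)}{1-\lambda}+\frac{(1-\tilde\beta)(\gamma^{-\alpha_1}-1)}{\gamma^{-1}-1}\right)+\frac{\gamma^{-\alpha_2}\lambda(K-1)}{(1-\lambda)(\gamma-\lambda)D}\\&+\frac{K-\lambda-\tilde\beta(1-\lambda)}{(1-\lambda)(1-\gamma)D}\left((\gamma^{-\alpha_2}-1)+\frac{(1-\tilde\beta)(\gamma^{-\alpha_1}-1)}{\tilde\beta}\right).\end{aligned}$$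 *)

theory Defs
  imports "HOL-Probability.Probability"
begin

text \<open>
  A transition probability on the measurable space \<open>S\<close> is a measurable map
  \<open>P\<close> from \<open>S\<close> into \<open>prob_algebra S\<close>; \<open>markov_op P\<close> is the operator that it induces,
  and \<open>P\<^sup>n g\<close> is the \<open>n\<close>-th iterate \<open>(markov_op P ^^ n) g\<close>.
\<close>

definition markov_op :: "('a \<Rightarrow> 'a measure) \<Rightarrow> ('a \<Rightarrow> real) \<Rightarrow> 'a \<Rightarrow> real" where
  "markov_op P g x = (\<integral>y. g y \<partial>P x)"

definition stationary_prob :: "'a measure \<Rightarrow> ('a \<Rightarrow> 'a measure) \<Rightarrow> 'a measure \<Rightarrow> bool" where
  "stationary_prob S P \<pi> \<longleftrightarrow>
     sets \<pi> = sets S \<and> prob_space \<pi> \<and>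
     (\<forall>A\<in>sets S. emeasure \<pi> A = (\<integral>\<^sup>+x. emeasure (P x) A \<partial>\<pi>))"

definition minorization ::
  "'a measure \<Rightarrow> ('a \<Rightarrow> 'a measure) \<Rightarrow> 'a set \<Rightarrow> real \<Rightarrow> 'a measure \<Rightarrow> bool" where
  "minorization S P C \<beta>' \<nu> \<longleftrightarrow>
     C \<in> sets S \<and> 0 < \<beta>' \<and> sets \<nu> = sets S \<and> prob_space \<nu> \<and>
     (\<forall>x\<in>C. \<forall>A\<in>sets S. \<beta>' * measure \<nu> A \<le> measure (P x) A)"

text \<open>\<open>PV\<close> is written as a nonnegative integral, so that the bounds below include the
  integrability of \<open>V\<close> with respect to each \<open>P x\<close>.\<close>

definition drift ::
  "'a measure \<Rightarrow> ('a \<Rightarrow> 'a measure) \<Rightarrow> 'a set \<Rightarrow> ('a \<Rightarrow> real) \<Rightarrow> real \<Rightarrow> real \<Rightarrow> bool" where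
  "drift S P C V lam K \<longleftrightarrow>
     V \<in> borel_measurable S \<and> (\<forall>x\<in>space S. 1 \<le> V x) \<and> 0 < lam \<and> lam < 1 \<and>
     (\<forall>x\<in>space S - C. (\<integral>\<^sup>+y. ennreal (V y) \<partial>P x) \<le> ennreal (lam * V x)) \<and>
     (\<forall>x\<in>C. (\<integral>\<^sup>+y. ennreal (V y) \<partial>P x) \<le> ennreal K)"

definition strong_aperiodicity :: "'a set \<Rightarrow> real \<Rightarrow> 'a measure \<Rightarrow> real \<Rightarrow> bool" where
  "strong_aperiodicity C \<beta>' \<nu> \<beta> \<longleftrightarrow> 0 < \<beta> \<and> \<beta> \<le> \<beta>' * measure \<nu> C"

definition is_atom :: "('a \<Rightarrow> 'a measure) \<Rightarrow> 'a set \<Rightarrow> bool" where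
  "is_atom P C \<longleftrightarrow> (\<forall>x\<in>C. \<forall>y\<in>C. P x = P y)"

definition V_norm :: "'a measure \<Rightarrow> ('a \<Rightarrow> real) \<Rightarrow> ('a \<Rightarrow> real) \<Rightarrow> ereal" where
  "V_norm S V g = (SUP x\<in>space S. ereal (\<bar>g x\<bar> / V x))"

text \<open>The argument \<open>L\<close> ranges over \<open>ereal\<close> because it can be \<open>\<infinity>\<close> in the non-atomic case; there
  \<open>R1\<close> is \<open>1\<close> by convention.\<close>

definition R1 :: "real \<Rightarrow> real \<Rightarrow> ereal \<Rightarrow> real" where
  "R1 \<beta> R L =
     (if L = \<infinity> then 1
      else (THE r. 1 < r \<and> r < R \<and>
              (r - 1) / (r * (ln (R / r))\<^sup>2)
                = (exp 1)\<^sup>2 * \<beta> * (R - 1) / (8 * (real_of_ereal L - 1))))"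

text \<open>Division by zero is \<open>0\<close> in HOL. So that finiteness of the constants has content, \<open>K1\<close>,
  \<open>M_at\<close> and \<open>M_non\<close> are extended reals, equal to \<open>\<infinity>\<close> as soon as one of the denominators
  of the formula vanishes or, for \<open>K1\<close>, a logarithm is taken of a nonpositive number.\<close>

definition K1 :: "real \<Rightarrow> real \<Rightarrow> real \<Rightarrow> ereal \<Rightarrow> ereal" where
  "K1 r \<beta> R L =
     (let N = (real_of_ereal L - 1) / (R - 1);
          E = 8 * N * exp (- 2) * (r - 1) / (r * (ln (R / r))\<^sup>2)
      in if L = \<infinity> \<or> R = 1 \<or> N \<le> 0 \<or> r = 0 \<or> R / r \<le> 0 \<or> ln (R / r) = 0 \<or> (r - 1) * (\<beta> - E) = 0
         then \<infinity>
         else ereal ((2 * \<beta> + 2 * ln N / ln (R / r) - E) / ((r - 1) * (\<beta> - E))))"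

definition alpha1 :: "real \<Rightarrow> real \<Rightarrow> real \<Rightarrow> real" where
  "alpha1 \<beta>' lam K = 1 + ln ((K - \<beta>') / (1 - \<beta>')) / ln (1 / lam)"

definition admissible_alpha2 ::
  "'a measure \<Rightarrow> 'a set \<Rightarrow> 'a measure \<Rightarrow> ('a \<Rightarrow> real) \<Rightarrow> real \<Rightarrow> real \<Rightarrow> real \<Rightarrow> real \<Rightarrow> bool" where
  "admissible_alpha2 S C \<nu> V \<beta>' lam K \<alpha>2 \<longleftrightarrow>
     \<alpha>2 = 1 + ln (K / \<beta>') / ln (1 / lam) \<or>
     (measure \<nu> C = 1 \<and> \<alpha>2 = 1) \<or>
     (\<exists>K'::real. emeasure \<nu> C + (\<integral>\<^sup>+x\<in>space S - C. ennreal (V x) \<partial>\<nu>) \<le> ennreal K' \<and>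
                 \<alpha>2 = 1 + ln K' / ln (1 / lam))"

definition R0 :: "real \<Rightarrow> real \<Rightarrow> real \<Rightarrow> real" where
  "R0 \<beta>' lam K = min (1 / lam) ((1 - \<beta>') powr (- 1 / alpha1 \<beta>' lam K))"

definition L_non :: "real \<Rightarrow> real \<Rightarrow> real \<Rightarrow> real \<Rightarrow> real \<Rightarrow> ereal" where
  "L_non \<beta>' lam K \<alpha>2 R =
     (let d = 1 - (1 - \<beta>') * R powr alpha1 \<beta>' lam K
      in if d = 0 then \<infinity> else ereal (\<beta>' * R powr \<alpha>2 / d))"

definition is_R_tilde :: "real \<Rightarrow> real \<Rightarrow> real \<Rightarrow> real \<Rightarrow> real \<Rightarrow> real \<Rightarrow> bool" where
  "is_R_tilde \<beta> \<beta>' lam K \<alpha>2 Rt \<longleftrightarrow>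
     is_arg_max (\<lambda>R. R1 \<beta> R (L_non \<beta>' lam K \<alpha>2 R)) (\<lambda>R. 1 < R \<and> R \<le> R0 \<beta>' lam K) Rt"

definition M_at :: "real \<Rightarrow> real \<Rightarrow> real \<Rightarrow> ereal \<Rightarrow> ereal" where
  "M_at lam K \<gamma> \<kappa> =
     (if \<bar>\<kappa>\<bar> = \<infinity> \<or> \<gamma> = 0 \<or> \<gamma> - lam = 0 \<or> 1 - lam = 0 then \<infinity>
      else ereal
       (max lam (K - lam / \<gamma>) / (\<gamma> - lam)
        + K * (K - lam / \<gamma>) / (\<gamma> * (\<gamma> - lam)) * real_of_ereal \<kappa>
        + (K - lam / \<gamma>) * max lam (K - lam) / ((\<gamma> - lam) * (1 - lam))
        + lam * (K - 1) / ((\<gamma> - lam) * (1 - lam))))"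

definition M_non :: "real \<Rightarrow> real \<Rightarrow> real \<Rightarrow> real \<Rightarrow> real \<Rightarrow> ereal \<Rightarrow> ereal" where
  "M_non \<beta>' lam K \<alpha>2 \<gamma> \<kappa> =
     (let \<alpha>1 = alpha1 \<beta>' lam K;
          D = 1 - (1 - \<beta>') * \<gamma> powr (- \<alpha>1)
      in if \<bar>\<kappa>\<bar> = \<infinity> \<or> \<gamma> = 0 \<or> \<gamma> - lam = 0 \<or> 1 - lam = 0 \<or> 1 - \<gamma> = 0 \<or> \<beta>' = 0 \<or> D = 0 then \<infinity>
         else ereal
          (max lam (K - lam / \<gamma>) / (\<gamma> - lam)
           + K * (K * \<gamma> - lam - \<beta>' * (\<gamma> - lam)) / (\<gamma>\<^sup>2 * (\<gamma> - lam) * D)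
           + \<beta>' * \<gamma> powr (- \<alpha>2 - 2) * K * (K * \<gamma> - lam) / ((\<gamma> - lam) * D\<^sup>2) * real_of_ereal \<kappa>
           + \<gamma> powr (- \<alpha>2 - 1) * (K * \<gamma> - lam) / ((\<gamma> - lam) * D\<^sup>2)
               * (\<beta>' * max lam (K - lam) / (1 - lam)
                  + (1 - \<beta>') * (\<gamma> powr (- \<alpha>1) - 1) / (1 / \<gamma> - 1))
           + \<gamma> powr (- \<alpha>2) * lam * (K - 1) / ((1 - lam) * (\<gamma> - lam) * D)
           + (K - lam - \<beta>' * (1 - lam)) / ((1 - lam) * (1 - \<gamma>) * D)
               * ((\<gamma> powr (- \<alpha>2) - 1) + (1 - \<beta>') * (\<gamma> powr (- \<alpha>1) - 1) / \<beta>')))"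

end

theory Submission
  imports Defs "HOL-Complex_Analysis.Complex_Analysis"
begin

text \<open>
  The proof is Nummelin's regeneration argument, carried out on operators instead of paths. By the
  minorization, \<open>P = Q + s \<otimes> \<nu>\<close> with \<open>s = \<beta>' 1\<^sub>C\<close> and \<open>Q \<ge> 0\<close>: from \<open>C\<close> the chain regenerates, with law
  \<open>\<nu>\<close>, with probability \<open>\<beta>'\<close>, and \<open>Q\<close> describes the motion without regeneration. Expanding \<open>P\<^sup>n\<close> at the first and
  at the last regeneration gives
  \<open>P\<^sup>n g = Q\<^sup>n g + (\<Sum>i + j + k + 1 = n. Q\<^sup>i s \<cdot> u j \<cdot> \<nu> Q\<^sup>k g)\<close>,
  where \<open>u\<close> is the renewal sequence whose waiting time exceeds \<open>n\<close> with probability \<open>c n = \<nu> Q\<^sup>n 1\<close>. As an identity of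
  power series (\<open>fps_decomposition\<close>) it separates the limit
  \<open>ell g = (\<Sum>n. \<nu> Q\<^sup>n g) / (\<Sum>n. c n)\<close> from products of series that converge
  beyond the unit disc. Two estimates then give the rate.

  The first concerns the renewal sequence (\<open>renewal_rate\<close>). Since \<open>(1 - z) u(z) = 1 / c(z)\<close>, the deviation of \<open>u\<close> from
  its limit is controlled on the circle of radius \<open>r\<close> by a lower bound for \<open>\<bar>c(z)\<bar>\<close>. Strong
  aperiodicity gives one that is good away from the positive axis, and Jensen's inequality one that is
  good near it; together they give \<open>K1\<close>, valid up to the radius \<open>R1\<close>.

  The second concerns the excursions between regenerations. A nonnegative \<open>F\<close> with \<open>F \<ge> f + r Q F\<close> dominates
  \<open>\<Sum>n. r\<^sup>n Q\<^sup>n f\<close> (\<open>partial_sums_le_supersolution\<close>). The drift condition says that \<open>V\<close> is almost such a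
  function for \<open>r < 1 / lam\<close>, and by Jensen's inequality \<open>V powr t\<close> is one for \<open>r = lam powr (- t)\<close>. Affine combinations of the two
  bound the sums for \<open>f = s\<close>, \<open>f = 1\<close> and \<open>f = V\<close>, and also the sums with the weights
  \<open>(r\<^sup>n - 1) / (r - 1)\<close> that come from the difference between \<open>r\<close> and \<open>1\<close>. These bounds are the terms of \<open>M_at\<close> and \<open>M_non\<close>.

  Finally, the convergence \<open>P\<^sup>n g \<rightarrow> ell g\<close> is uniform over \<open>\<bar>g\<bar> \<le> V\<close>. Hence \<open>ell\<close> inherits countable additivity from
  \<open>P\<^sup>n\<close> and defines the stationary measure; it is the only one, because the integral of \<open>P\<^sup>n 1\<^sub>A\<close> with respect to
  a stationary measure is constant in \<open>n\<close>. The maximizer of \<open>R1\<close> exists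
  by compactness (\<open>R1_argmax\<close>).
\<close>

section \<open>Renewal sequences\<close>

lemma sq_le_exp: fixes y :: real shows "0 \<le> y \<Longrightarrow> y\<^sup>2 * exp (- 2 * y) \<le> exp (- 2)"
proof -
  assume y: "0 \<le> y"
  have "y \<le> exp (y - 1)" using exp_ge_add_one_self[of "y - 1"] by simp
  hence "y\<^sup>2 \<le> (exp (y - 1))\<^sup>2" using y by (intro power_mono) auto
  also have "\<dots> = exp (2 * y - 2)" by (simp add: power2_eq_square exp_add[symmetric])
  finally have "y\<^sup>2 * exp (- 2 * y) \<le> exp (2 * y - 2) * exp (- 2 * y)" by (intro mult_right_mono) auto
  also have "\<dots> = exp (- 2)" by (simp add: exp_add[symmetric])
  finally show ?thesis .
qed

text \<open>
  The quantity that is compared with \<open>\<beta>\<close> both in the definition of \<open>R1\<close> and in the denominator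
  of \<open>K1\<close>: twice the loss, per unit of \<open>\<bar>1 - w\<bar>\<^sup>2\<close>, in passing from the circle of radius \<open>1\<close> to the
  circle of radius \<open>r\<close> in the lower bound for the generating function of the waiting-time tails.
\<close>
definition renewal_err :: "real \<Rightarrow> real \<Rightarrow> real \<Rightarrow> real" where
  "renewal_err N R r = 8 * N * exp (- 2) * (r - 1) / (r * (ln (R / r))\<^sup>2)"

lemma renewal_err_mono:
  assumes "1 \<le> r" "r \<le> r'" "r' < R" "0 \<le> N"
  shows "renewal_err N R r \<le> renewal_err N R r'"
proof -
  have l: "0 < ln (R / r')" "ln (R / r') \<le> ln (R / r)"
    using assms by (auto simp: field_simps)
  have "(r - 1) / r \<le> (r' - 1) / r'" using assms by (simp add: field_simps)
  moreover have "1 / (ln (R / r))\<^sup>2 \<le> 1 / (ln (R / r'))\<^sup>2"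
    using l by (intro divide_left_mono power_mono mult_pos_pos) auto
  ultimately have "((r - 1) / r) * (1 / (ln (R / r))\<^sup>2) \<le> ((r' - 1) / r') * (1 / (ln (R / r'))\<^sup>2)"
    using assms by (intro mult_mono) auto
  hence "8 * N * exp (- 2) * (((r - 1) / r) * (1 / (ln (R / r))\<^sup>2)) \<le> 8 * N * exp (- 2) * (((r' - 1) / r') * (1 / (ln (R / r'))\<^sup>2))"
    using assms by (intro mult_left_mono) auto
  thus ?thesis by (simp add: renewal_err_def)
qed

text \<open>
  A renewal process is given by the tails \<open>c n\<close> of its waiting time (the probability that the waiting
  time exceeds \<open>n\<close>), so that the waiting time is \<open>n + 1\<close> with probability \<open>c n - c (n + 1)\<close>. Working with
  tails instead of the waiting-time distribution \<open>b\<close> removes the zero of \<open>1 - b(z)\<close> at \<open>z = 1\<close>,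
  because \<open>1 - b(z) = (1 - z) c(z)\<close>; the renewal sequence then satisfies \<open>(1 - z) u(z) = 1 / c(z)\<close>.
\<close>
locale renewal_tail =
  fixes c :: "nat \<Rightarrow> real" and R N \<beta> :: real
  assumes c_dec: "\<And>n. c (Suc n) \<le> c n" and c_nonneg: "\<And>n. 0 \<le> c n"
    and c0: "c 0 = 1" and c1: "\<beta> \<le> c 0 - c 1"
    and R: "1 < R" and summR: "summable (\<lambda>n. c n * R ^ n)"
    and sumR: "(\<Sum>n. c n * R ^ n) \<le> N" and \<beta>: "0 < \<beta>"
begin

lemma summ: assumes "0 \<le> r" "r \<le> R" shows "summable (\<lambda>n. c n * r ^ n)"
  by (rule summable_comparison_test'[OF summR, of 0])
     (use assms c_nonneg in \<open>auto simp: abs_mult intro!: mult_left_mono power_mono\<close>)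

lemma summ1: "summable c"
  using summ[of 1] R by simp

lemma c_to_0: "c \<longlonglongrightarrow> 0"
  using summ1 by (rule summable_LIMSEQ_zero)

lemma sum_ge_1: assumes "0 \<le> r" "r \<le> R" shows "1 \<le> (\<Sum>n. c n * r ^ n)"
proof -
  have "(\<Sum>n<1. c n * r ^ n) \<le> (\<Sum>n. c n * r ^ n)"
    using assms c_nonneg by (intro sum_le_suminf summ) auto
  thus ?thesis by (simp add: c0)
qed

lemma N_ge_1: "1 \<le> N"
  using sum_ge_1[of R] R sumR by simp

definition cz :: "complex \<Rightarrow> complex" where "cz z = (\<Sum>n. of_real (c n) * z ^ n)"

lemma summ_norm: "norm z \<le> R \<Longrightarrow> summable (\<lambda>n. norm (complex_of_real (c n) * z ^ n))"
  using summ[of "norm z"] c_nonneg by (simp add: norm_mult norm_power)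

lemma summ_z: "norm z \<le> R \<Longrightarrow> summable (\<lambda>n. complex_of_real (c n) * z ^ n)"
  by (rule summable_norm_cancel[OF summ_norm])

lemma cz_of_real: assumes "0 \<le> r" "r \<le> R" shows "cz (of_real r) = of_real (\<Sum>n. c n * r ^ n)"
proof -
  have "(\<lambda>n. complex_of_real (c n * r ^ n)) sums complex_of_real (\<Sum>n. c n * r ^ n)"
    using summ[OF assms] by (intro sums_of_real) auto
  hence "(\<lambda>n. complex_of_real (c n) * of_real r ^ n) sums complex_of_real (\<Sum>n. c n * r ^ n)"
    by (simp only: of_real_mult of_real_power)
  thus ?thesis unfolding cz_def by (rule sums_unique[symmetric])
qed

definition b :: "nat \<Rightarrow> real" where "b n = c n - c (Suc n)"

lemma b_nonneg: "0 \<le> b n" using c_dec by (simp add: b_def)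

lemma b_sums: "b sums 1"
  using telescope_sums'[OF c_to_0] by (simp add: b_def[abs_def] c0)

lemma one_minus_cz:
  assumes "norm z \<le> R"
  shows "(\<lambda>n. complex_of_real (b n) * z ^ Suc n) sums (1 - (1 - z) * cz z)"
proof -
  have s: "(\<lambda>n. complex_of_real (c n) * z ^ n) sums cz z"
    using summ_z[OF assms] by (simp add: cz_def summable_sums)
  have "(\<lambda>n. complex_of_real (c (Suc n)) * z ^ Suc n) sums (cz z - 1)"
    using s by (subst sums_Suc_iff) (simp add: c0)
  from sums_diff[OF sums_mult[OF s, of z] this]
  show ?thesis by (simp add: b_def algebra_simps)
qed

text \<open>
  On the unit circle \<open>(1 - w) c(w) = \<Sum>n. b n (1 - w\<^sup>n\<^sup>+\<^sup>1)\<close> has only terms with nonnegative real part, and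
  strong aperiodicity bounds the first one from below.
\<close>
lemma Re_one_minus_cz_ge:
  assumes w: "norm w = 1"
  shows "\<beta> * (norm (1 - w))\<^sup>2 / 2 \<le> Re ((1 - w) * cz w)"
proof -
  have re: "Re (1 - w ^ n) \<ge> 0" for n
    using complex_Re_le_cmod[of "w ^ n"] w by (simp add: norm_power)
  have "(\<lambda>n. complex_of_real (b n) - complex_of_real (b n) * w ^ Suc n) sums (1 - (1 - (1 - w) * cz w))"
    using sums_diff[OF sums_of_real[OF b_sums] one_minus_cz[of w]] w R by simp
  hence "(\<lambda>n. complex_of_real (b n) * (1 - w ^ Suc n)) sums ((1 - w) * cz w)"
    by (simp add: algebra_simps)
  from sums_Re[OF this] have s: "(\<lambda>n. b n * Re (1 - w ^ Suc n)) sums Re ((1 - w) * cz w)"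
    by simp
  have "(\<Sum>n<1. b n * Re (1 - w ^ Suc n)) \<le> (\<Sum>n. b n * Re (1 - w ^ Suc n))"
    using s by (intro sum_le_suminf) (auto intro!: mult_nonneg_nonneg b_nonneg re dest: sums_summable simp del: power_Suc minus_complex.sel)
  hence "b 0 * Re (1 - w) \<le> Re ((1 - w) * cz w)" using sums_unique[OF s] by simp
  moreover have "(norm (1 - w))\<^sup>2 / 2 = Re (1 - w)"
  proof -
    have "(Re w)\<^sup>2 + (Im w)\<^sup>2 = 1" using w cmod_power2[of w] by simp
    thus ?thesis unfolding cmod_power2 by (simp add: power2_diff)
  qed
  moreover have "\<beta> * Re (1 - w) \<le> b 0 * Re (1 - w)"
    using c1 re[of 1] by (intro mult_right_mono) (auto simp: b_def)
  moreover have "\<beta> * (norm (1 - w))\<^sup>2 / 2 = \<beta> * ((norm (1 - w))\<^sup>2 / 2)" by simp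
  ultimately show ?thesis by (metis order_trans)
qed

text \<open>
  The factor \<open>4 e\<^sup>-\<^sup>2 / ln(R/r)\<^sup>2\<close> is the maximum of \<open>x\<^sup>2 (r/R)\<^sup>x\<close> over \<open>x \<ge> 0\<close>.
\<close>
lemma second_moment: assumes "1 \<le> r" "r < R" shows "summable (\<lambda>n. real n ^ 2 * c n * r ^ n)"
  and "(\<Sum>n. real n ^ 2 * c n * r ^ n) \<le> 4 * exp (- 2) / (ln (R / r))\<^sup>2 * N"
proof -
  define l where "l = ln (R / r)"
  have l: "0 < l" using assms by (simp add: l_def field_simps)
  have Rr: "R / r = exp l" using assms by (simp add: l_def)
  have key: "real n ^ 2 * c n * r ^ n \<le> 4 * exp (- 2) / l\<^sup>2 * (c n * R ^ n)" for n
  proof -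
    have "(real n * l / 2)\<^sup>2 * exp (- 2 * (real n * l / 2)) \<le> exp (- 2)"
      using l by (intro sq_le_exp) auto
    moreover have "- 2 * (real n * l / 2) = - (real n * l)" by simp
    ultimately have "(real n * l / 2)\<^sup>2 * exp (- (real n * l)) \<le> exp (- 2)" by (simp only:)
    hence "4 / l\<^sup>2 * ((real n * l / 2)\<^sup>2 * exp (- (real n * l))) \<le> 4 / l\<^sup>2 * exp (- 2)"
      by (rule mult_left_mono) simp
    moreover have "4 / l\<^sup>2 * ((real n * l / 2)\<^sup>2 * X) = real n ^ 2 * X" for X
      using l by (simp add: power2_eq_square)
    ultimately have "real n ^ 2 * exp (- (real n * l)) \<le> 4 * exp (- 2) / l\<^sup>2" by simp
    moreover have "exp (- (real n * l)) = (r / R) ^ n"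
    proof -
      have "exp (- (real n * l)) = inverse (exp l ^ n)" by (simp add: exp_minus exp_of_nat_mult)
      thus ?thesis using Rr[symmetric] by (simp add: power_divide)
    qed
    ultimately have "real n ^ 2 * (r / R) ^ n * (c n * R ^ n) \<le> 4 * exp (- 2) / l\<^sup>2 * (c n * R ^ n)"
      using c_nonneg R by (intro mult_right_mono) auto
    thus ?thesis using R by (simp add: power_divide mult_ac)
  qed
  show s: "summable (\<lambda>n. real n ^ 2 * c n * r ^ n)"
    by (rule summable_comparison_test'[OF summable_mult[OF summR, of "4 * exp (- 2) / l\<^sup>2"], of 0])
       (use key assms c_nonneg in \<open>auto simp: abs_mult\<close>)
  have "(\<Sum>n. real n ^ 2 * c n * r ^ n) \<le> (\<Sum>n. 4 * exp (- 2) / l\<^sup>2 * (c n * R ^ n))"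
    using key by (intro suminf_le s summable_mult summR) auto
  also have "\<dots> \<le> 4 * exp (- 2) / l\<^sup>2 * N"
    using sumR l by (subst suminf_mult[OF summR]) (intro mult_left_mono, auto)
  finally show "(\<Sum>n. real n ^ 2 * c n * r ^ n) \<le> 4 * exp (- 2) / (ln (R / r))\<^sup>2 * N"
    by (simp add: l_def)
qed

lemma first_moment_summable: assumes "1 \<le> r" "r < R" shows "summable (\<lambda>n. real n * c n * r ^ n)"
proof (rule summable_comparison_test'[OF second_moment(1)[OF assms], of 0])
  fix n :: nat
  have "real n \<le> real n ^ 2" by (cases n) (auto simp: power2_eq_square)
  thus "norm (real n * c n * r ^ n) \<le> real n ^ 2 * c n * r ^ n"
    using assms c_nonneg by (auto simp: abs_mult intro!: mult_right_mono)
qed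

lemma norm_pow_le: fixes w :: complex shows "norm w = 1 \<Longrightarrow> norm (1 - w ^ n) \<le> real n * norm (1 - w)"
  using norm_power_diff[of 1 w n] by simp

text \<open>
  Perturbation from the unit circle: \<open>Re ((1 - w) (c(r w) - c(w)))\<close> is a sum of terms
  \<open>c n (r\<^sup>n - 1) Re ((1 - w) w\<^sup>n)\<close>. Writing \<open>w\<^sup>n = 1 - (1 - w\<^sup>n)\<close>, the part coming from \<open>1\<close> has
  nonnegative real part, and the rest is at most \<open>n \<bar>1 - w\<bar>\<^sup>2\<close>. Together with \<open>r\<^sup>n - 1 \<le> n (r - 1) r\<^sup>n / r\<close> the loss
  is quadratic in \<open>\<bar>1 - w\<bar>\<close>, like the bound on the unit circle that it is subtracted from.
\<close>
lemma cz_ge_away_from_1: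
  assumes r: "1 \<le> r" "r < R" and w: "norm w = 1" and E: "renewal_err N R r \<le> \<beta>"
  shows "(\<beta> - renewal_err N R r) * norm (1 - w) / 2 \<le> norm (cz (of_real r * w))"
proof (cases "w = 1")
  case True thus ?thesis by simp
next
  case False
  define t where "t = norm (1 - w)"
  have t: "0 < t" using False by (simp add: t_def)
  have nr: "norm (of_real r * w) \<le> R" using r w by (simp add: norm_mult)
  have sd: "(\<lambda>n. complex_of_real (c n * (r ^ n - 1)) * w ^ n) sums (cz (of_real r * w) - cz w)"
    using sums_diff[OF summable_sums[OF summ_z[OF nr]] summable_sums[OF summ_z[of w]]] w R
    by (simp add: cz_def power_mult_distrib algebra_simps)
  have term_ge: "- (t * (c n * (r ^ n - 1)) * (real n * t)) \<le> Re ((1 - w) * (complex_of_real (c n * (r ^ n - 1)) * w ^ n))" for n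
  proof -
    have p: "0 \<le> c n * (r ^ n - 1)" using r c_nonneg by simp
    have "norm ((1 - w) * (1 - w ^ n)) \<le> t * (real n * t)"
      unfolding norm_mult t_def using norm_pow_le[OF w, of n] by (intro mult_left_mono) auto
    hence "Re ((1 - w) * (1 - w ^ n)) \<le> t * (real n * t)" using complex_Re_le_cmod order_trans by blast
    moreover have "0 \<le> Re (1 - w)" using complex_Re_le_cmod[of w] w by simp
    moreover have "Re ((1 - w) * w ^ n) = Re (1 - w) - Re ((1 - w) * (1 - w ^ n))"
      by (simp add: algebra_simps)
    ultimately have "- (t * (real n * t)) \<le> Re ((1 - w) * w ^ n)" by linarith
    hence "c n * (r ^ n - 1) * (- (t * (real n * t))) \<le> c n * (r ^ n - 1) * Re ((1 - w) * w ^ n)"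
      using p by (rule mult_left_mono)
    moreover have "(1 - w) * (complex_of_real (c n * (r ^ n - 1)) * w ^ n) = complex_of_real (c n * (r ^ n - 1)) * ((1 - w) * w ^ n)"
      by (simp only: mult_ac)
    ultimately show ?thesis by (simp only: Re_complex_of_real Im_complex_of_real times_complex.sel) (simp add: algebra_simps)
  qed
  have power_diff_le: "c n * (r ^ n - 1) * real n \<le> (r - 1) / r * (real n ^ 2 * c n * r ^ n)" for n
  proof -
    have "r * (r ^ n - 1) \<le> real n * (r - 1) * r ^ n"
    proof (induction n)
      case (Suc n)
      have "1 \<le> r ^ n" using r by simp
      hence "r * (r - 1) * 1 \<le> r * (r - 1) * r ^ n" using r by (intro mult_left_mono) auto
      moreover have "r * (r * (r ^ n - 1)) \<le> r * (real n * (r - 1) * r ^ n)" 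
        using Suc r by (intro mult_left_mono) auto
      ultimately show ?case by (simp add: algebra_simps)
    qed simp
    hence "(r ^ n - 1) \<le> (r - 1) / r * (real n * r ^ n)" using r by (simp add: field_simps)
    hence "c n * real n * (r ^ n - 1) \<le> c n * real n * ((r - 1) / r * (real n * r ^ n))"
      using c_nonneg by (intro mult_left_mono) auto
    thus ?thesis by (simp add: power2_eq_square mult_ac)
  qed
  have "Re ((1 - w) * (cz (of_real r * w) - cz w)) \<ge> - (t * t * ((r - 1) / r * (\<Sum>n. real n ^ 2 * c n * r ^ n)))"
  proof (rule sums_le)
    show "(\<lambda>n. Re ((1 - w) * (complex_of_real (c n * (r ^ n - 1)) * w ^ n))) sums Re ((1 - w) * (cz (of_real r * w) - cz w))"
      by (intro sums_Re sums_mult sd)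
    show "(\<lambda>n. - (t * t * ((r - 1) / r * (real n ^ 2 * c n * r ^ n)))) sums - (t * t * ((r - 1) / r * (\<Sum>n. real n ^ 2 * c n * r ^ n)))"
      by (intro sums_minus sums_mult summable_sums second_moment(1) r)
    show "- (t * t * ((r - 1) / r * (real n ^ 2 * c n * r ^ n))) \<le> Re ((1 - w) * (complex_of_real (c n * (r ^ n - 1)) * w ^ n))" for n
    proof -
      have "t * t * (c n * (r ^ n - 1) * real n) \<le> t * t * ((r - 1) / r * (real n ^ 2 * c n * r ^ n))"
        using power_diff_le[of n] t by (intro mult_left_mono) auto
      thus ?thesis using term_ge[of n] by (simp add: mult_ac)
    qed
  qed
  moreover have "t * t * ((r - 1) / r * (\<Sum>n. real n ^ 2 * c n * r ^ n)) \<le> t * t * ((r - 1) / r * (4 * exp (- 2) / (ln (R / r))\<^sup>2 * N))"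
    using second_moment(2)[OF r] r t by (intro mult_left_mono) auto
  moreover have "t * t * ((r - 1) / r * (4 * exp (- 2) / (ln (R / r))\<^sup>2 * N)) = renewal_err N R r * t\<^sup>2 / 2"
    by (simp add: renewal_err_def power2_eq_square)
  moreover have "Re ((1 - w) * cz w) \<ge> \<beta> * t\<^sup>2 / 2" using Re_one_minus_cz_ge[OF w] by (simp add: t_def)
  moreover have "Re ((1 - w) * cz (of_real r * w)) = Re ((1 - w) * cz w) + Re ((1 - w) * (cz (of_real r * w) - cz w))"
    by (simp add: algebra_simps)
  moreover have "(\<beta> - renewal_err N R r) * t\<^sup>2 / 2 = \<beta> * t\<^sup>2 / 2 - renewal_err N R r * t\<^sup>2 / 2"
    by (simp add: algebra_simps diff_divide_distrib)
  ultimately have "(\<beta> - renewal_err N R r) * t\<^sup>2 / 2 \<le> Re ((1 - w) * cz (of_real r * w))"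
    by linarith
  also have "\<dots> \<le> t * norm (cz (of_real r * w))"
    unfolding t_def norm_mult[symmetric] by (rule complex_Re_le_cmod)
  finally have "t * ((\<beta> - renewal_err N R r) * t / 2) \<le> t * norm (cz (of_real r * w))"
    by (simp add: power2_eq_square mult_ac)
  thus ?thesis using t by (simp add: t_def)
qed

text \<open>
  Near the positive axis \<open>c(r w)\<close> is close to \<open>c(r) \<ge> 1\<close>. The relative error is at most \<open>\<bar>1 - w\<bar>\<close> times the
  mean of \<open>n\<close> under the weights \<open>c n r\<^sup>n\<close>, and by Jensen's inequality for \<open>(R/r)\<^sup>n\<close> this mean is
  at most \<open>ln (c(R) / c(r)) / ln (R/r)\<close>.
\<close>
lemma cz_ge_near_1:
  assumes r: "1 \<le> r" "r < R" and w: "norm w = 1"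
  shows "1 - norm (1 - w) * (ln N / ln (R / r)) \<le> norm (cz (of_real r * w))"
proof -
  define l where "l = ln (R / r)"
  have l: "0 < l" using r by (simp add: l_def field_simps)
  have Rr: "R = r * exp l" using r by (simp add: l_def)
  define cr where "cr = (\<Sum>n. c n * r ^ n)"
  define m where "m = (\<Sum>n. real n * c n * r ^ n) / cr"
  have cr: "1 \<le> cr" using sum_ge_1[of r] r by (simp add: cr_def)
  have m: "cr * m = (\<Sum>n. real n * c n * r ^ n)" using cr by (simp add: m_def)
  have s1: "(\<lambda>n. c n * r ^ n) sums cr" using summ[of r] r by (simp add: cr_def summable_sums)
  have s2: "(\<lambda>n. real n * c n * r ^ n) sums (cr * m)" unfolding m by (intro summable_sums first_moment_summable r)
  \<comment> \<open>Jensen: \<open>exp\<close> lies above its tangent at the mean \<open>m * l\<close>\<close>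
  have "cr * exp (m * l) \<le> (\<Sum>n. c n * R ^ n)"
  proof (rule sums_le)
    show "(\<lambda>n. c n * R ^ n) sums (\<Sum>n. c n * R ^ n)" using summR by (rule summable_sums)
    have "(\<lambda>n. exp (m * l) * ((1 - m * l) * (c n * r ^ n) + l * (real n * c n * r ^ n))) sums
       (exp (m * l) * ((1 - m * l) * cr + l * (cr * m)))"
      by (intro sums_mult sums_add s1 s2)
    thus "(\<lambda>n. exp (m * l) * ((1 - m * l) * (c n * r ^ n) + l * (real n * c n * r ^ n))) sums (cr * exp (m * l))"
      by (simp add: algebra_simps)
    show "exp (m * l) * ((1 - m * l) * (c n * r ^ n) + l * (real n * c n * r ^ n)) \<le> c n * R ^ n" for n
    proof -
      have "exp (m * l) * (1 + (real n - m) * l) \<le> exp (m * l) * exp ((real n - m) * l)"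
        by (intro mult_left_mono exp_ge_add_one_self) auto
      also have "\<dots> = exp l ^ n" by (simp add: exp_add[symmetric] exp_of_nat_mult[symmetric] algebra_simps)
      finally have "exp (m * l) * (1 + (real n - m) * l) * (c n * r ^ n) \<le> exp l ^ n * (c n * r ^ n)"
        using c_nonneg r by (intro mult_right_mono) auto
      thus ?thesis by (simp add: Rr power_mult_distrib algebra_simps)
    qed
  qed
  hence "cr * exp (m * l) \<le> N" using sumR by simp
  moreover have "1 * exp (m * l) \<le> cr * exp (m * l)" using cr by (intro mult_right_mono) auto
  ultimately have "exp (m * l) \<le> N" by linarith
  hence "m * l \<le> ln N" using N_ge_1 by (metis exp_gt_zero ln_exp ln_le_cancel_iff order_less_le_trans)
  hence mA: "m \<le> ln N / l" using l by (simp add: field_simps)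
  have nr: "norm (of_real r * w) \<le> R" using r w by (simp add: norm_mult)
  have "cz (of_real r) - cz (of_real r * w) = (\<Sum>n. complex_of_real (c n * r ^ n) * (1 - w ^ n))"
    using sums_diff[OF summable_sums[OF summ_z[of "of_real r"]] summable_sums[OF summ_z[OF nr]]] r
    by (simp add: cz_def sums_iff power_mult_distrib algebra_simps)
  also have "norm \<dots> \<le> (\<Sum>n. norm (1 - w) * (real n * c n * r ^ n))"
  proof (rule norm_suminf_le)
    show "summable (\<lambda>n. norm (1 - w) * (real n * c n * r ^ n))" by (intro summable_mult first_moment_summable r)
    show "norm (complex_of_real (c n * r ^ n) * (1 - w ^ n)) \<le> norm (1 - w) * (real n * c n * r ^ n)" for n
    proof -
      have "norm (complex_of_real (c n * r ^ n) * (1 - w ^ n)) = c n * r ^ n * norm (1 - w ^ n)"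
        using c_nonneg r by (simp add: norm_mult norm_power)
      also have "\<dots> \<le> c n * r ^ n * (real n * norm (1 - w))"
        using c_nonneg r norm_pow_le[OF w] by (intro mult_left_mono) auto
      finally show ?thesis by (simp add: mult_ac)
    qed
  qed
  also have "\<dots> = norm (1 - w) * (cr * m)" using first_moment_summable[OF r] by (simp add: m suminf_mult)
  finally have "norm (cz (of_real r)) - norm (cz (of_real r * w)) \<le> norm (1 - w) * (cr * m)"
    using norm_triangle_ineq2 order_trans by blast
  moreover have "norm (cz (of_real r)) = cr" using cz_of_real[of r] r cr by (simp add: cr_def)
  ultimately have A: "cr * (1 - norm (1 - w) * m) \<le> norm (cz (of_real r * w))" by (simp add: algebra_simps)
  have B: "1 - norm (1 - w) * (ln N / l) \<le> 1 - norm (1 - w) * m" using mult_left_mono[OF mA, of "norm (1 - w)"] by simp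
  show ?thesis unfolding l_def[symmetric]
  proof (cases "0 \<le> 1 - norm (1 - w) * m")
    case True
    hence "1 * (1 - norm (1 - w) * m) \<le> cr * (1 - norm (1 - w) * m)" using cr by (intro mult_right_mono) auto
    thus "1 - norm (1 - w) * (ln N / l) \<le> norm (cz (of_real r * w))" using A B unfolding mult_1 by (meson order_trans)
  next
    case False
    hence "1 - norm (1 - w) * (ln N / l) \<le> 0" using B by (meson linear order_trans)
    thus "1 - norm (1 - w) * (ln N / l) \<le> norm (cz (of_real r * w))" by (meson norm_ge_zero order_trans)
  qed
qed

text \<open>
  One of the two previous bounds decreases and the other increases in \<open>\<bar>1 - w\<bar>\<close>; the right combination of them
  eliminates \<open>\<bar>1 - w\<bar>\<close>.
\<close>
lemma cz_lower_bound:
  assumes z: "1 \<le> norm z" "norm z < R" and E: "renewal_err N R (norm z) < \<beta>"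
  shows "(\<beta> - renewal_err N R (norm z)) / (\<beta> + 2 * (ln N / ln (R / norm z))) \<le> norm (cz z)"
    and "cz z \<noteq> 0"
proof -
  define r where "r = norm z"
  define w where "w = z / of_real r"
  have w: "norm w = 1" and zw: "z = of_real r * w" using z by (auto simp: w_def r_def norm_divide)
  define B where "B = \<beta> - renewal_err N R r"
  define A where "A = ln N / ln (R / r)"
  have E0: "0 \<le> renewal_err N R r" using z N_ge_1 by (auto simp: renewal_err_def r_def)
  have B: "0 < B" "B \<le> \<beta>" using E E0 by (auto simp: B_def r_def)
  have "0 < norm z" using z by linarith
  hence "1 \<le> R / norm z" using z by simp
  hence A: "0 \<le> A" unfolding A_def r_def using N_ge_1 by (intro divide_nonneg_nonneg ln_ge_zero) auto
  define t where "t = norm (1 - w)"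
  define x where "x = norm (cz z)"
  have r: "1 \<le> r" "r < R" "renewal_err N R r \<le> \<beta>" using z E by (auto simp: r_def)
  have 1: "1 - t * A \<le> x" using cz_ge_near_1[OF r(1,2) w] by (simp add: t_def A_def x_def zw[symmetric])
  have 2: "B * t / 2 \<le> x" using cz_ge_away_from_1[OF r(1,2) w r(3)] by (simp add: t_def B_def x_def zw[symmetric])
  have "B * (1 - t * A) + 2 * A * (B * t / 2) \<le> B * x + 2 * A * x"
    using 1 2 A B by (intro add_mono mult_left_mono) auto
  hence "B \<le> (B + 2 * A) * x" by (simp add: algebra_simps)
  also have "\<dots> \<le> (\<beta> + 2 * A) * x" using B by (intro mult_right_mono) (auto simp: x_def)
  finally have "B / (\<beta> + 2 * A) \<le> x" using \<beta> A by (simp add: field_simps)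
  thus "(\<beta> - renewal_err N R (norm z)) / (\<beta> + 2 * (ln N / ln (R / norm z))) \<le> norm (cz z)"
    by (simp add: B_def A_def x_def r_def)
  moreover have "0 < B / (\<beta> + 2 * A)" using B A \<beta> by simp
  ultimately show "cz z \<noteq> 0" by (auto simp: B_def A_def r_def)
qed

text \<open>
  Outside the unit disc this is the lower bound, since \<open>renewal_err\<close> increases with the radius; inside,
  \<open>1 - (1 - z) c(z)\<close> is the generating function of the waiting time and is smaller than \<open>1\<close> in modulus.
\<close>
lemma cz_nonzero:
  assumes r: "1 \<le> r" "r < R" and E: "renewal_err N R r < \<beta>" and z: "norm z \<le> r"
  shows "cz z \<noteq> 0"
proof (cases "1 \<le> norm z")
  case True
  have "renewal_err N R (norm z) \<le> renewal_err N R r"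
    using True z r N_ge_1 by (intro renewal_err_mono) auto
  thus ?thesis using cz_lower_bound(2)[of z] True z r E by auto
next
  case False
  have "norm (1 - (1 - z) * cz z) \<le> norm z"
  proof -
    have s: "(\<lambda>n. complex_of_real (b n) * z ^ Suc n) sums (1 - (1 - z) * cz z)"
      using one_minus_cz[of z] False R by simp
    have "norm (\<Sum>n. complex_of_real (b n) * z ^ Suc n) \<le> (\<Sum>n. b n * norm z)"
    proof (rule norm_suminf_le)
      show "summable (\<lambda>n. b n * norm z)" using b_sums by (intro summable_mult2) (simp add: sums_iff)
      show "norm (complex_of_real (b n) * z ^ Suc n) \<le> b n * norm z" for n
      proof -
        have "norm z ^ n \<le> 1" using False by (intro power_le_one) auto
        hence "norm z * norm z ^ n \<le> norm z * 1" by (intro mult_left_mono) auto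
        thus ?thesis using b_nonneg by (simp add: norm_mult norm_power mult_left_mono)
      qed
    qed
    also have "\<dots> = norm z" using b_sums by (simp add: sums_iff suminf_mult2[symmetric])
    finally show ?thesis using s by (simp add: sums_iff)
  qed
  thus ?thesis using False by auto
qed

definition e :: "nat \<Rightarrow> real" where "e k = (\<Sum>n. c (n + Suc k))"

lemma e_nonneg: "0 \<le> e k"
  unfolding e_def by (rule suminf_nonneg[OF summable_ignore_initial_segment[OF summ1] c_nonneg])

lemma e_le: "e k * R ^ k \<le> N"
proof -
  have "(\<Sum>n. c (n + Suc k) * R ^ k) \<le> (\<Sum>n. c n * R ^ n)"
  proof -
    have s: "summable (\<lambda>n. c (n + Suc k) * R ^ (n + Suc k))" 
      using summable_ignore_initial_segment[OF summR, of "Suc k"] by simp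
    have "(\<Sum>n. c (n + Suc k) * R ^ k) \<le> (\<Sum>n. c (n + Suc k) * R ^ (n + Suc k))"
      using R c_nonneg
      by (intro suminf_le s summable_mult2 summable_ignore_initial_segment[OF summ1] mult_left_mono power_increasing) auto
    also have "\<dots> \<le> (\<Sum>n. c n * R ^ n)"
      using suminf_split_initial_segment[OF summR, of "Suc k"] R c_nonneg
      by (simp add: sum_nonneg del: sum.lessThan_Suc)
    finally show ?thesis .
  qed
  thus ?thesis using sumR suminf_mult2[OF summable_ignore_initial_segment[OF summ1, of "Suc k"], of "R ^ k"]
    by (simp add: e_def)
qed

lemma e_Suc: "e (Suc k) = e k - c (Suc k)"
  using suminf_split_head[OF summable_ignore_initial_segment[OF summ1, of "Suc k"]] by (simp add: e_def)

lemma e_0: "e 0 = (\<Sum>n. c n) - 1"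
  using suminf_split_head[OF summ1] by (simp add: e_def c0)

text \<open>
  The generating function of the tail sums is \<open>(c(1) - c(z)) / (1 - z)\<close>, written without the removable
  singularity at \<open>1\<close>.
\<close>
definition ez :: "complex \<Rightarrow> complex" where "ez z = (\<Sum>n. of_real (e n) * z ^ n)"

lemma summ_ez: assumes "norm z < R" shows "summable (\<lambda>n. complex_of_real (e n) * z ^ n)"
proof (rule summable_comparison_test')
  show "summable (\<lambda>n. N * (norm z / R) ^ n)" using assms R by (intro summable_mult summable_geometric) auto
  fix n :: nat
  have "e n * norm z ^ n = e n * R ^ n * (norm z / R) ^ n" using R by (simp add: power_divide)
  also have "\<dots> \<le> N * (norm z / R) ^ n" using e_le R by (intro mult_right_mono) auto
  finally show "norm (complex_of_real (e n) * z ^ n) \<le> N * (norm z / R) ^ n"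
    using e_nonneg by (simp add: norm_mult norm_power)
qed

lemma ez_eq: assumes "norm z < R" shows "(1 - z) * ez z = of_real (\<Sum>n. c n) - cz z"
proof -
  have s: "(\<lambda>n. complex_of_real (e n) * z ^ n) sums ez z"
    using summ_ez[OF assms] by (simp add: ez_def summable_sums)
  have "(\<lambda>n. complex_of_real (e (Suc n)) * z ^ Suc n) sums (ez z - of_real (e 0))"
    using s by (subst sums_Suc_iff) simp
  from sums_diff[OF this sums_mult[OF s, of z]]
  have 1: "(\<lambda>n. - complex_of_real (c (Suc n)) * z ^ Suc n) sums (ez z - of_real (e 0) - z * ez z)"
    by (simp add: e_Suc algebra_simps)
  have s': "(\<lambda>n. complex_of_real (c n) * z ^ n) sums cz z"
    using summ_z[of z] assms by (simp add: cz_def summable_sums)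
  have "(\<lambda>n. complex_of_real (c (Suc n)) * z ^ Suc n) sums (cz z - 1)"
    using s' by (subst sums_Suc_iff) (simp add: c0)
  from sums_unique2[OF 1] sums_minus[OF this] have "ez z - of_real (e 0) - z * ez z = - (cz z - 1)"
    by (metis (no_types, lifting) "1" minus_mult_left sums_cong sums_unique2)
  thus ?thesis by (simp add: e_0 algebra_simps)
qed

lemma fps_cz: "cz has_fps_expansion Abs_fps (\<lambda>n. complex_of_real (c n))"
  and fps_ez: "ez has_fps_expansion Abs_fps (\<lambda>n. complex_of_real (e n))"
  and holo_cz: "cz holomorphic_on ball 0 R" and holo_ez: "ez holomorphic_on ball 0 R"
proof -
  let ?C = "Abs_fps (\<lambda>n. complex_of_real (c n))" and ?E = "Abs_fps (\<lambda>n. complex_of_real (e n))"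
  have rad: "ereal R \<le> fps_conv_radius F" if "\<And>z. norm z < R \<Longrightarrow> summable (\<lambda>n. fps_nth F n * z ^ n)" for F :: "complex fps"
    unfolding fps_conv_radius_def
  proof (rule conv_radius_geI_ex)
    fix r assume "0 < r" "ereal r < ereal R"
    thus "\<exists>z. norm z = r \<and> summable (\<lambda>n. fps_nth F n * z ^ n)"
      using that[of "of_real r"] by (intro exI[of _ "of_real r"]) auto
  qed
  have C: "ereal R \<le> fps_conv_radius ?C" using summ_z by (intro rad) auto
  have E: "ereal R \<le> fps_conv_radius ?E" using summ_ez by (intro rad) auto
  have ec: "cz = eval_fps ?C" and ee: "ez = eval_fps ?E"
    by (auto simp: eval_fps_def cz_def ez_def)
  have R0: "0 < ereal R" using R by simp
  show "cz has_fps_expansion ?C" unfolding ec by (rule eval_fps_has_fps_expansion[OF less_le_trans[OF R0 C]])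
  show "ez has_fps_expansion ?E" unfolding ee by (rule eval_fps_has_fps_expansion[OF less_le_trans[OF R0 E]])
  have "ball 0 R \<subseteq> eball (0::complex) (fps_conv_radius F)" if "ereal R \<le> fps_conv_radius F" for F :: "complex fps"
    using that by (auto simp: eball_def) (meson less_ereal.simps(1) less_le_trans)
  thus "cz holomorphic_on ball 0 R" "ez holomorphic_on ball 0 R"
    unfolding ec ee using C E by (auto intro!: holomorphic_on_eval_fps)
qed

text \<open>
  The hypothesis on \<open>d\<close> says \<open>d(z) = e(z) / (c(z) c(1)) = (1 / c(z) - 1 / c(1)) / (1 - z)\<close>, so \<open>d n\<close> is the
  difference between the renewal sequence and its limit \<open>1 / c(1)\<close>. The function is holomorphic in the disc of
  radius \<open>r\<close> because \<open>c\<close> has no zero there, and on its boundary \<open>\<bar>1 - z\<bar> \<ge> r - 1\<close> and the lower bound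
  for \<open>\<bar>c\<bar>\<close> apply; Cauchy's inequality turns this into a bound on the coefficients.
\<close>
lemma renewal_rate:
  assumes r: "1 < r" "r < R" and E: "renewal_err N R r < \<beta>"
    and d: "Abs_fps d * Abs_fps c * fps_const (\<Sum>n. c n) = Abs_fps e"
  shows "\<bar>d n\<bar> * r ^ n \<le> (2 * \<beta> + 2 * (ln N / ln (R / r)) - renewal_err N R r) / ((r - 1) * (\<beta> - renewal_err N R r))"
proof -
  define u where "u = (\<Sum>n. c n)"
  have u: "1 \<le> u" using sum_ge_1[of 1] R by (simp add: u_def)
  let ?C = "Abs_fps (\<lambda>n. complex_of_real (c n))" and ?E = "Abs_fps (\<lambda>n. complex_of_real (e n))"
    and ?D = "Abs_fps (\<lambda>n. complex_of_real (d n))"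
  define f where "f = (\<lambda>z. ez z * inverse (cz z) * inverse (of_real u))"
  have C0: "fps_nth ?C 0 \<noteq> 0" by (simp add: c0)
  have "f has_fps_expansion ?E * inverse ?C * fps_const (inverse (of_real u))"
    unfolding f_def by (intro has_fps_expansion_mult has_fps_expansion_inverse fps_cz fps_ez has_fps_expansion_const C0)
  also have "?E * inverse ?C * fps_const (inverse (of_real u)) = ?D"
  proof -
    have "?D * ?C * fps_const (of_real u) = ?E"
    proof (rule fps_ext)
      fix n
      have "fps_nth (Abs_fps d * Abs_fps c * fps_const u) n = e n" using d by (simp add: u_def)
      hence "complex_of_real (fps_nth (Abs_fps d * Abs_fps c * fps_const u) n) = of_real (e n)" by simp
      thus "fps_nth (?D * ?C * fps_const (of_real u)) n = fps_nth ?E n"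
        by (simp add: fps_mult_right_const_nth) (simp add: fps_mult_nth)
    qed
    hence "?E * inverse ?C * fps_const (inverse (of_real u)) = ?D * (?C * inverse ?C) * (fps_const (of_real u) * fps_const (inverse (of_real u)))"
      by (metis (no_types, lifting) mult.assoc mult.commute)
    also have "?C * inverse ?C = 1" using C0 by (rule inverse_mult_eq_1')
    also have "fps_const (complex_of_real u) * fps_const (inverse (of_real u)) = 1"
      using u by (simp flip: fps_const_1_eq_1)
    finally show ?thesis by simp
  qed
  finally have fexp: "f has_fps_expansion ?D" .
  define B where "B = (2 * \<beta> + 2 * (ln N / ln (R / r)) - renewal_err N R r) / ((r - 1) * (\<beta> - renewal_err N R r))"
  have sub: "cball 0 r \<subseteq> ball (0::complex) R" using r by auto
  have hol: "f holomorphic_on ball 0 r" and con: "continuous_on (cball 0 r) f"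
  proof -
    have nz: "cz z \<noteq> 0" if "z \<in> cball 0 r" for z using that cz_nonzero[of r z] r E by auto
    have "cz holomorphic_on ball 0 r" "ez holomorphic_on ball 0 r"
      using holo_cz holo_ez sub by (meson ball_subset_cball holomorphic_on_subset order_trans)+
    thus "f holomorphic_on ball 0 r" unfolding f_def using nz u by (intro holomorphic_intros) auto
    have "continuous_on (cball 0 r) cz" "continuous_on (cball 0 r) ez"
      using holo_cz holo_ez sub by (meson holomorphic_on_imp_continuous_on continuous_on_subset)+
    thus "continuous_on (cball 0 r) f" unfolding f_def using nz u by (intro continuous_intros) auto
  qed
  have bd: "norm (f z) \<le> B" if "norm (0 - z) = r" for z
  proof -
    have nz: "norm z = r" using that by simp
    have c: "cz z \<noteq> 0" using cz_nonzero[of r z] r E nz by simp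
    have z1: "z \<noteq> 1" using nz r by auto
    have "f z = (1 / cz z - 1 / of_real u) / (1 - z)"
    proof -
      have "1 / cz z - 1 / of_real u = (of_real u - cz z) / (cz z * of_real u)"
        using c u by (simp add: field_simps)
      also have "of_real u - cz z = (1 - z) * ez z" using ez_eq[of z] nz r by (simp add: u_def)
      finally show ?thesis using z1 by (simp add: f_def divide_inverse)
    qed
    hence "norm (f z) = norm (1 / cz z - 1 / of_real u) / norm (1 - z)" by (simp add: norm_divide)
    also have "\<dots> \<le> (1 / norm (cz z) + 1 / u) / (r - 1)"
    proof (rule frac_le)
      show "norm (1 / cz z - 1 / complex_of_real u) \<le> 1 / norm (cz z) + 1 / u"
        using norm_triangle_ineq4[of "1 / cz z" "1 / complex_of_real u"] u by (simp add: norm_divide)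
      show "r - 1 \<le> norm (1 - z)" using norm_triangle_ineq3[of z 1] nz by (simp add: norm_minus_commute)
    qed (use r u in auto)
    also have "\<dots> \<le> ((\<beta> + 2 * (ln N / ln (R / r))) / (\<beta> - renewal_err N R r) + 1) / (r - 1)"
    proof (intro divide_right_mono add_mono)
      have "(\<beta> - renewal_err N R r) / (\<beta> + 2 * (ln N / ln (R / r))) \<le> norm (cz z)"
        using cz_lower_bound(1)[of z] nz r E by simp
      moreover have "0 < (\<beta> - renewal_err N R r)" using E by simp
      moreover have "0 < \<beta> + 2 * (ln N / ln (R / r))" using \<beta> N_ge_1 r by (simp add: field_simps add_pos_nonneg)
      ultimately show "1 / norm (cz z) \<le> (\<beta> + 2 * (ln N / ln (R / r))) / (\<beta> - renewal_err N R r)"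
        using c by (simp add: field_simps)
    qed (use r u in auto)
    also have "\<dots> = B"
    proof -
      have "\<beta> - renewal_err N R r \<noteq> 0" using E by simp
      thus ?thesis using r unfolding B_def by (simp add: divide_simps) (simp add: algebra_simps)
    qed
    finally show ?thesis .
  qed
  have "norm ((deriv ^^ n) f 0) \<le> fact n * B / r ^ n"
    by (rule Cauchy_inequality[OF hol con _ bd]) (use r in auto)
  moreover have "complex_of_real (d n) = (deriv ^^ n) f 0 / fact n"
    using fps_nth_fps_expansion[OF fexp, of n] by simp
  ultimately have "\<bar>d n\<bar> \<le> B / r ^ n"
    by (metis (no_types, lifting) norm_of_real norm_divide norm_fact divide_le_eq fact_gt_zero mult.commute times_divide_eq_right)
  thus ?thesis unfolding B_def[symmetric] using r by (simp add: pos_le_divide_eq)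
qed

end

section \<open>The radius \<open>R1\<close> and its maximizer\<close>

text \<open>
  The left-hand side of the equation that defines \<open>R1\<close>; it increases from \<open>0\<close> to infinity on \<open>(1, R)\<close>.
\<close>
definition rate_ratio :: "real \<Rightarrow> real \<Rightarrow> real" where
  "rate_ratio R r = (r - 1) / (r * (ln (R / r))\<^sup>2)"

lemma rate_ratio_less:
  assumes "1 \<le> r" "r < r'" "r' < R"
  shows "rate_ratio R r < rate_ratio R r'"
proof -
  have l: "0 < ln (R / r')" "ln (R / r') < ln (R / r)"
    using assms by (auto simp: field_simps)
  have "(r - 1) / r < (r' - 1) / r'" using assms by (simp add: field_simps)
  moreover have "1 / (ln (R / r))\<^sup>2 \<le> 1 / (ln (R / r'))\<^sup>2"
    using l by (intro divide_left_mono power_mono mult_pos_pos) auto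
  ultimately have "((r - 1) / r) * (1 / (ln (R / r))\<^sup>2) < ((r' - 1) / r') * (1 / (ln (R / r'))\<^sup>2)"
    using assms l by (intro mult_less_le_imp_less) auto
  thus ?thesis by (simp add: rate_ratio_def)
qed

lemma rate_ratio_ex1:
  assumes R: "1 < R" and \<kappa>: "0 < \<kappa>"
  shows "\<exists>!r. 1 < r \<and> r < R \<and> rate_ratio R r = \<kappa>"
proof -
  define F where "F = (\<lambda>x. (x - 1) - \<kappa> * x * (ln (R / x))\<^sup>2)"
  have "continuous_on {1..R} F"
    unfolding F_def using R by (intro continuous_intros) auto
  moreover have "F 1 \<le> 0" "0 \<le> F R" using R \<kappa> by (auto simp: F_def)
  ultimately obtain r where r: "1 \<le> r" "r \<le> R" "F r = 0"
    using IVT'[of F 1 0 R] R by auto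
  have "r \<noteq> 1" using r(3) R \<kappa> by (auto simp: F_def)
  moreover have "r \<noteq> R" using r(3) R by (auto simp: F_def)
  ultimately have r': "1 < r" "r < R" using r by auto
  have "0 < ln (R / r)" using r' by (simp add: field_simps)
  hence "rate_ratio R r = \<kappa>" using r(3) r' by (simp add: F_def rate_ratio_def field_simps)
  show ?thesis
  proof (rule ex1I)
    show "1 < r \<and> r < R \<and> rate_ratio R r = \<kappa>" using r' \<open>rate_ratio R r = \<kappa>\<close> by simp
    fix s assume "1 < s \<and> s < R \<and> rate_ratio R s = \<kappa>"
    thus "s = r" using rate_ratio_less[of r s R] rate_ratio_less[of s r R] r' \<open>rate_ratio R r = \<kappa>\<close>
      by (cases r s rule: linorder_cases) auto
  qed
qed

lemma R1_works:
  assumes R: "1 < R" and l: "1 < l" and \<beta>: "0 < \<beta>"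
  shows "1 < R1 \<beta> R (ereal l)" "R1 \<beta> R (ereal l) < R"
    and "rate_ratio R (R1 \<beta> R (ereal l)) = (exp 1)\<^sup>2 * \<beta> * (R - 1) / (8 * (l - 1))"
proof -
  have "0 < (exp 1)\<^sup>2 * \<beta> * (R - 1) / (8 * (l - 1))" using assms by simp
  from theI'[OF rate_ratio_ex1[OF R this]]
  show "1 < R1 \<beta> R (ereal l)" "R1 \<beta> R (ereal l) < R"
    "rate_ratio R (R1 \<beta> R (ereal l)) = (exp 1)\<^sup>2 * \<beta> * (R - 1) / (8 * (l - 1))"
    by (simp_all add: R1_def rate_ratio_def)
qed

text \<open>
  Up to the factor \<open>8 N e\<^sup>-\<^sup>2\<close>, \<open>renewal_err\<close> is the left-hand side of the equation for \<open>R1\<close>, and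
  the two agree with \<open>\<beta>\<close> exactly at \<open>r = R1\<close>.
\<close>
lemma renewal_err_less:
  assumes R: "1 < R" and l: "1 < l" and \<beta>: "0 < \<beta>" and r: "1 < r" "r < R1 \<beta> R (ereal l)"
  shows "renewal_err ((l - 1) / (R - 1)) R r < \<beta>"
proof -
  note W = R1_works[OF R l \<beta>]
  define N where "N = (l - 1) / (R - 1)"
  have N: "0 < N" using R l by (simp add: N_def)
  have "rate_ratio R r < (exp 1)\<^sup>2 * \<beta> * (R - 1) / (8 * (l - 1))"
    using rate_ratio_less[of r "R1 \<beta> R (ereal l)" R] W r by simp
  also have "\<dots> = (exp 1)\<^sup>2 * \<beta> / (8 * N)" using R l by (simp add: N_def)
  finally have "8 * N * exp (- 2) * rate_ratio R r < 8 * N * exp (- 2) * ((exp 1)\<^sup>2 * \<beta> / (8 * N))"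
    using N by (intro mult_strict_left_mono) auto
  also have "\<dots> = \<beta> * (exp (- 2) * (exp 1)\<^sup>2)" using N by simp
  also have "exp (- 2) * (exp 1)\<^sup>2 = (1::real)" by (simp add: power2_eq_square exp_add[symmetric])
  finally show ?thesis by (simp add: renewal_err_def rate_ratio_def N_def)
qed

text \<open>
  The function to be maximized is the upper boundary of a set of pairs \<open>(r, R)\<close> described by an inequality between
  continuous functions once all denominators are cleared. This set is compact, including the end point where
  \<open>L\<close> is infinite (there the inequality forces \<open>r = 1\<close>, in accordance with the convention for \<open>R1\<close>) and
  the point \<open>R = 1\<close>, so \<open>r\<close> attains its maximum on it. A maximizer has finite \<open>L\<close> because values above \<open>1\<close> occur.
\<close>
lemma R1_argmax:
  fixes \<beta> \<beta>' a1 a2 R0' :: real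
  assumes \<beta>: "0 < \<beta>" and \<beta>': "0 < \<beta>'" "\<beta>' < 1" and a: "0 < a1" "0 \<le> a2" and R0': "1 < R0'"
    and den_le: "\<forall>R\<in>{1..R0'}. (1 - \<beta>') * R powr a1 \<le> 1"
  defines "L \<equiv> \<lambda>R. (let d = 1 - (1 - \<beta>') * R powr a1 in if d = 0 then \<infinity> else ereal (\<beta>' * R powr a2 / d))"
  shows "\<exists>Rt. is_arg_max (\<lambda>R. R1 \<beta> R (L R)) (\<lambda>R. 1 < R \<and> R \<le> R0') Rt"
    and "is_arg_max (\<lambda>R. R1 \<beta> R (L R)) (\<lambda>R. 1 < R \<and> R \<le> R0') Rt \<Longrightarrow> (1 - \<beta>') * Rt powr a1 < 1"
    and "\<And>R. 1 < R \<Longrightarrow> (1 - \<beta>') * R powr a1 < 1 \<Longrightarrow> 1 < \<beta>' * R powr a2 / (1 - (1 - \<beta>') * R powr a1)"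
proof -
  define d where "d = (\<lambda>R. 1 - (1 - \<beta>') * R powr a1)"
  have den: "(1 - \<beta>') * R powr a1 \<le> 1" if "1 \<le> R" "R \<le> R0'" for R using den_le that by auto
  have d0: "0 \<le> d R" if "1 \<le> R" "R \<le> R0'" for R using den[OF that] by (simp add: d_def)
  have dlt: "d R < \<beta>' * R powr a2" if "1 < R" for R
  proof -
    have "1 < R powr a1" using that a by simp
    hence "(1 - \<beta>') * 1 < (1 - \<beta>') * R powr a1" using \<beta>' by (intro mult_strict_left_mono) auto
    moreover have "\<beta>' * 1 \<le> \<beta>' * R powr a2" using that a \<beta>' by (intro mult_left_mono) (auto intro: ge_one_powr_ge_zero)
    ultimately show ?thesis by (simp add: d_def)
  qed
  show L1: "1 < \<beta>' * R powr a2 / (1 - (1 - \<beta>') * R powr a1)" if "1 < R" "(1 - \<beta>') * R powr a1 < 1" for R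
    using dlt[OF that(1)] that by (simp add: d_def)
  have Lfin: "L R = ereal (\<beta>' * R powr a2 / d R)" "1 < \<beta>' * R powr a2 / d R" if "1 < R" "R \<le> R0'" "d R \<noteq> 0" for R
    using that dlt[OF that(1)] d0[of R] by (auto simp: L_def d_def Let_def)
  have Linf: "R1 \<beta> R (L R) = 1" if "d R = 0" for R using that by (simp add: L_def d_def R1_def)
  define f where "f = (\<lambda>R. R1 \<beta> R (L R))"
  have f: "1 < f R" "f R < R" "rate_ratio R (f R) = (exp 1)\<^sup>2 * \<beta> * (R - 1) / (8 * (\<beta>' * R powr a2 / d R - 1))"
    if "1 < R" "R \<le> R0'" "d R \<noteq> 0" for R
    using R1_works[OF that(1) Lfin(2)[OF that] \<beta>] Lfin(1)[OF that] by (auto simp: f_def)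
  define T where "T = {p \<in> {p \<in> {1..R0'} \<times> {1..R0'}. fst p \<le> snd p}.
     8 * (fst p - 1) * (\<beta>' * snd p powr a2 - d (snd p))
       \<le> (exp 1)\<^sup>2 * \<beta> * (snd p - 1) * fst p * (ln (snd p / fst p))\<^sup>2 * d (snd p)}"
  \<comment> \<open>on a slice, membership is \<open>r \<le> f R\<close>\<close>
  have T_le: "r \<le> f R" if "(r, R) \<in> T" "1 < R" for r R
  proof (cases "d R = 0")
    case True
    have "8 * (r - 1) * (\<beta>' * R powr a2) \<le> 0" using that True by (simp add: T_def)
    moreover have "0 < \<beta>' * R powr a2" using \<beta>' that by simp
    ultimately have "\<not> 0 < 8 * (r - 1)" using mult_pos_pos[of "8 * (r - 1)" "\<beta>' * R powr a2"] by linarith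
    hence "r - 1 \<le> 0" by simp
    thus ?thesis using True Linf by (simp add: f_def)
  next
    case False
    have R: "1 \<le> r" "r \<le> R" "R \<le> R0'" using that by (auto simp: T_def)
    have dp: "0 < d R" using d0[of R] False R that by simp
    have ie: "8 * (r - 1) * (\<beta>' * R powr a2 - d R) \<le> (exp 1)\<^sup>2 * \<beta> * (R - 1) * r * (ln (R / r))\<^sup>2 * d R"
      using that by (simp add: T_def)
    have rR: "r \<noteq> R"
    proof
      assume "r = R"
      hence "8 * (R - 1) * (\<beta>' * R powr a2 - d R) \<le> 0" using ie that(2) by simp
      moreover have "0 < 8 * (R - 1) * (\<beta>' * R powr a2 - d R)" using dlt[OF that(2)] that(2) by simp
      ultimately show False by linarith
    qed
    hence rR: "r < R" using R by simp
    show ?thesis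
    proof (rule ccontr)
      assume "\<not> r \<le> f R"
      hence "rate_ratio R (f R) < rate_ratio R r"
        using f[OF that(2) R(3) False] rR by (intro rate_ratio_less) auto
      hence lt: "(exp 1)\<^sup>2 * \<beta> * (R - 1) / (8 * (\<beta>' * R powr a2 / d R - 1)) < rate_ratio R r"
        using f(3)[OF that(2) R(3) False] by simp
      have e1: "8 * (\<beta>' * R powr a2 / d R - 1) = 8 * (\<beta>' * R powr a2 - d R) / d R" using dp by (simp add: field_simps)
      have "0 < ln (R / r)" using rR R by (simp add: field_simps)
      hence q: "0 < r * (ln (R / r))\<^sup>2" using R by simp
      have p: "0 < 8 * (\<beta>' * R powr a2 - d R)" using dlt[OF that(2)] by simp
      have "(exp 1)\<^sup>2 * \<beta> * (R - 1) * d R / (8 * (\<beta>' * R powr a2 - d R)) < (r - 1) / (r * (ln (R / r))\<^sup>2)"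
        using lt unfolding e1 rate_ratio_def by simp
      hence "(exp 1)\<^sup>2 * \<beta> * (R - 1) * d R * (r * (ln (R / r))\<^sup>2) < (r - 1) * (8 * (\<beta>' * R powr a2 - d R))"
        using p q by (simp add: divide_less_eq less_divide_eq)
      thus False using ie by (simp add: algebra_simps)
    qed
  qed
  have T_f: "(f R, R) \<in> T" if "1 < R" "R \<le> R0'" for R
  proof (cases "d R = 0")
    case True
    thus ?thesis using that Linf by (simp add: f_def T_def)
  next
    case False
    note F = f[OF that False]
    have dp: "0 < d R" using d0[of R] False that by simp
    have "0 < ln (R / f R)" using F by (simp add: field_simps)
    hence q: "0 < f R * (ln (R / f R))\<^sup>2" using F by simp
    have p: "0 < 8 * (\<beta>' * R powr a2 - d R)" using dlt[OF that(1)] by simp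
    have e1: "8 * (\<beta>' * R powr a2 / d R - 1) = 8 * (\<beta>' * R powr a2 - d R) / d R" using dp by (simp add: field_simps)
    have "(f R - 1) / (f R * (ln (R / f R))\<^sup>2) = (exp 1)\<^sup>2 * \<beta> * (R - 1) * d R / (8 * (\<beta>' * R powr a2 - d R))"
      using F(3) unfolding e1 rate_ratio_def by simp
    hence "(f R - 1) * (8 * (\<beta>' * R powr a2 - d R)) = (exp 1)\<^sup>2 * \<beta> * (R - 1) * d R * (f R * (ln (R / f R))\<^sup>2)"
      using p q by (subst (asm) frac_eq_eq) (simp_all only: less_imp_neq[symmetric] not_False_eq_True)
    thus ?thesis using F(1,2) that by (simp add: T_def algebra_simps)
  qed
  have closed0: "closed {p \<in> {1..R0'} \<times> {1..R0'}. fst p \<le> snd p}"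
    by (intro continuous_on_closed_Collect_le continuous_intros closed_Times)
  have "closed T" unfolding T_def
  proof (rule continuous_on_closed_Collect_le[OF _ _ closed0])
    let ?D = "{p \<in> {1..R0'} \<times> {1..R0'}. fst p \<le> snd p}"
    have nz: "\<And>p. p \<in> ?D \<Longrightarrow> 1 \<le> fst p" "\<And>p. p \<in> ?D \<Longrightarrow> 1 \<le> snd p" by auto
    have c1: "continuous_on ?D (\<lambda>p. snd p powr a)" for a
      using nz(2) by (intro continuous_intros) force
    have c2: "continuous_on ?D (\<lambda>p. d (snd p))" unfolding d_def by (intro continuous_intros c1)
    have "continuous_on ?D (\<lambda>p. snd p / fst p)" using nz(1) by (intro continuous_intros) force
    hence c3: "continuous_on ?D (\<lambda>p. ln (snd p / fst p))" using nz by (intro continuous_on_ln) force+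
    show "continuous_on ?D (\<lambda>p. 8 * (fst p - 1) * (\<beta>' * snd p powr a2 - d (snd p)))"
      by (intro continuous_intros c1 c2)
    show "continuous_on ?D (\<lambda>p. (exp 1)\<^sup>2 * \<beta> * (snd p - 1) * fst p * (ln (snd p / fst p))\<^sup>2 * d (snd p))"
      by (intro continuous_intros c3 c2)
  qed
  moreover have "T \<subseteq> {1..R0'} \<times> {1..R0'}" by (auto simp: T_def)
  moreover have "compact ({1..R0'} \<times> {1..R0'})" by (intro compact_Times) auto
  ultimately have "compact T" by (metis compact_Int_closed inf.absorb_iff2)
  \<comment> \<open>any \<open>R\<close> strictly between \<open>1\<close> and \<open>R0'\<close> has finite \<open>L\<close>, hence \<open>f R > 1\<close>\<close>
  have "\<exists>R. 1 < R \<and> R \<le> R0' \<and> d R \<noteq> 0"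
  proof -
    define R where "R = (1 + R0') / 2"
    have R: "1 < R" "R < R0'" using R0' by (auto simp: R_def)
    have "R powr a1 < R0' powr a1" using R a by (intro powr_less_mono2) auto
    hence "(1 - \<beta>') * R powr a1 < (1 - \<beta>') * R0' powr a1" using \<beta>' by simp
    also have "\<dots> \<le> 1" using den[of R0'] R0' by simp
    finally show ?thesis using R by (intro exI[of _ R]) (auto simp: d_def)
  qed
  then obtain R2 where R2: "1 < R2" "R2 \<le> R0'" "d R2 \<noteq> 0" by blast
  hence fR2: "1 < f R2" using f by blast
  have "T \<noteq> {}" using T_f R2 by blast
  with \<open>compact T\<close> obtain p where p: "p \<in> T" "\<And>q. q \<in> T \<Longrightarrow> fst q \<le> fst p"
    using continuous_attains_sup[of T fst, OF _ _ continuous_on_fst[OF continuous_on_id]] by blast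
  have "fst p \<ge> f R2" using p(2)[OF T_f[OF R2(1,2)]] by simp
  hence p1: "1 < fst p" using fR2 by simp
  have ps: "fst p \<le> snd p" "snd p \<le> R0'" using p(1) by (auto simp: T_def)
  have "fst p \<le> f (snd p)" using T_le[of "fst p" "snd p"] p(1) p1 ps by simp
  hence "f R \<le> f (snd p)" if "1 < R" "R \<le> R0'" for R using p(2)[OF T_f[OF that]] by simp
  hence "is_arg_max f (\<lambda>R. 1 < R \<and> R \<le> R0') (snd p)"
    unfolding is_arg_max_def using p1 ps by (auto simp: not_less) (meson linorder_not_less)
  thus "\<exists>Rt. is_arg_max (\<lambda>R. R1 \<beta> R (L R)) (\<lambda>R. 1 < R \<and> R \<le> R0') Rt" unfolding f_def by blast
  assume "is_arg_max (\<lambda>R. R1 \<beta> R (L R)) (\<lambda>R. 1 < R \<and> R \<le> R0') Rt"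
  hence m: "1 < Rt" "Rt \<le> R0'" "f R2 \<le> f Rt" using R2 unfolding is_arg_max_def f_def by (auto simp: not_less)
  have "d Rt \<noteq> 0" using Linf[of Rt] m fR2 by (auto simp: f_def)
  thus "(1 - \<beta>') * Rt powr a1 < 1" using d0[of Rt] m by (simp add: d_def)
qed

section \<open>The regenerative decomposition of a chain with drift\<close>

locale drift_chain =
  fixes S :: "'a measure" and P :: "'a \<Rightarrow> 'a measure" and C :: "'a set"
    and \<nu> :: "'a measure" and V :: "'a \<Rightarrow> real" and \<beta> \<beta>' lam K :: real
  assumes kernel: "P \<in> measurable S (prob_algebra S)"
    and A1: "minorization S P C \<beta>' \<nu>"
    and A2: "drift S P C V lam K"
    and A3: "strong_aperiodicity C \<beta>' \<nu> \<beta>"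
begin

lemma P_prob: "x \<in> space S \<Longrightarrow> prob_space (P x)"
  and sets_P: "x \<in> space S \<Longrightarrow> sets (P x) = sets S"
  and space_P: "x \<in> space S \<Longrightarrow> space (P x) = space S"
proof -
  assume x: "x \<in> space S"
  hence "P x \<in> space (prob_algebra S)" using kernel by (rule measurable_space[rotated])
  thus "prob_space (P x)" "sets (P x) = sets S" by (auto simp: space_prob_algebra)
  thus "space (P x) = space S" by (auto dest: sets_eq_imp_space_eq)
qed

lemma C_sets: "C \<in> sets S" and \<beta>'_pos: "0 < \<beta>'" and sets_\<nu>: "sets \<nu> = sets S" and \<nu>_prob: "prob_space \<nu>"
  using A1 by (auto simp: minorization_def)

lemma space_\<nu>: "space \<nu> = space S" using sets_\<nu> by (rule sets_eq_imp_space_eq)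

lemma C_sub: "x \<in> C \<Longrightarrow> x \<in> space S" using C_sets sets.sets_into_space by blast

lemma \<beta>_pos: "0 < \<beta>" and \<beta>_le: "\<beta> \<le> \<beta>' * measure \<nu> C"
  using A3 by (auto simp: strong_aperiodicity_def)

lemma V_meas: "V \<in> borel_measurable S" and V_ge: "x \<in> space S \<Longrightarrow> 1 \<le> V x"
  and lam: "0 < lam" "lam < 1"
  using A2 by (auto simp: drift_def)

lemma C_nonempty: obtains a where "a \<in> C"
proof -
  have "C \<noteq> {}" using \<beta>_pos \<beta>_le by auto
  thus ?thesis using that by auto
qed

lemma \<beta>'_le_1: "\<beta>' \<le> 1"
proof -
  obtain a where a: "a \<in> C" by (rule C_nonempty)
  have "\<beta>' * measure \<nu> (space S) \<le> measure (P a) (space S)"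
    using A1 a by (auto simp: minorization_def)
  moreover have "measure \<nu> (space S) = 1" using prob_space.prob_space[OF \<nu>_prob] by (simp add: space_\<nu>)
  moreover have "measure (P a) (space S) \<le> 1" using prob_space.prob_le_1[OF P_prob] C_sub[OF a] by blast
  ultimately show ?thesis by simp
qed

lemma meas_P: "x \<in> space S \<Longrightarrow> f \<in> borel_measurable (P x) \<longleftrightarrow> f \<in> borel_measurable S"
  by (simp only: measurable_cong_sets[OF sets_P refl])

lemma meas_\<nu>: "f \<in> borel_measurable \<nu> \<longleftrightarrow> f \<in> borel_measurable S"
  by (simp only: measurable_cong_sets[OF sets_\<nu> refl])

text \<open>
  The minorization of sets extends to integrals; this makes the operator \<open>Q\<close> below positive.
\<close>
lemma minorization_nn_integral:
  assumes x: "x \<in> C" and f: "f \<in> borel_measurable S"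
  shows "ennreal \<beta>' * (\<integral>\<^sup>+y. f y \<partial>\<nu>) \<le> (\<integral>\<^sup>+y. f y \<partial>P x)"
proof -
  interpret Px: prob_space "P x" using P_prob C_sub[OF x] by blast
  interpret N: prob_space \<nu> by (rule \<nu>_prob)
  have "scale_measure (ennreal \<beta>') \<nu> \<le> P x"
  proof (rule less_eq_measure.intros(3))
    show "space (scale_measure (ennreal \<beta>') \<nu>) = space (P x)" using space_P C_sub[OF x] space_\<nu> by (simp add: space_scale_measure)
    show *: "sets (scale_measure (ennreal \<beta>') \<nu>) = sets (P x)" using sets_P C_sub[OF x] sets_\<nu> by simp
    show "emeasure (scale_measure (ennreal \<beta>') \<nu>) \<le> emeasure (P x)"
    proof (rule le_funI)
      fix A
      show "emeasure (scale_measure (ennreal \<beta>') \<nu>) A \<le> emeasure (P x) A"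
      proof (cases "A \<in> sets S")
        case True
        thus ?thesis
          using A1 x \<beta>'_pos by (auto simp: minorization_def N.emeasure_eq_measure Px.emeasure_eq_measure ennreal_mult[symmetric] ennreal_leI)
      next
        case False
        thus ?thesis using sets_\<nu> by (simp add: emeasure_notin_sets)
      qed
    qed
  qed
  from nn_integral_mono_measure[OF _ this, of f]
  show ?thesis using sets_P C_sub[OF x] sets_\<nu> f by (simp add: nn_integral_scale_measure meas_\<nu>)
qed

text \<open>
  The functions dominated by a multiple of \<open>V\<close>. They are integrable for every \<open>P x\<close>, for \<open>\<nu>\<close> and for the stationary
  measure, and \<open>P\<close> maps them to themselves, so that all operators below are linear on them.
\<close>
definition Vb :: "('a \<Rightarrow> real) set" where
  "Vb = {f \<in> borel_measurable S. \<exists>c. \<forall>x\<in>space S. \<bar>f x\<bar> \<le> c * V x}"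

lemma VbI: "f \<in> borel_measurable S \<Longrightarrow> (\<And>x. x \<in> space S \<Longrightarrow> \<bar>f x\<bar> \<le> c * V x) \<Longrightarrow> f \<in> Vb"
  by (auto simp: Vb_def)

lemma Vb_ex: assumes "f \<in> Vb" shows "\<exists>c\<ge>0. \<forall>x\<in>space S. \<bar>f x\<bar> \<le> c * V x"
proof -
  obtain c where c: "\<And>x. x \<in> space S \<Longrightarrow> \<bar>f x\<bar> \<le> c * V x" using assms by (auto simp: Vb_def)
  obtain a where "a \<in> C" by (rule C_nonempty)
  hence "a \<in> space S" by (rule C_sub)
  hence "0 \<le> c * V a" "1 \<le> V a" using c[of a] V_ge[of a] by auto
  hence "0 \<le> c" by (simp add: zero_le_mult_iff)
  thus ?thesis using c by blast
qed

lemma Vb_meas: "f \<in> Vb \<Longrightarrow> f \<in> borel_measurable S" by (simp add: Vb_def)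

lemma Vb_bounded: "f \<in> borel_measurable S \<Longrightarrow> (\<And>x. x \<in> space S \<Longrightarrow> \<bar>f x\<bar> \<le> c) \<Longrightarrow> f \<in> Vb"
proof (rule VbI)
  fix x assume f: "\<And>x. x \<in> space S \<Longrightarrow> \<bar>f x\<bar> \<le> c" and x: "x \<in> space S"
  have "0 \<le> c" using f[OF x] by simp
  hence "c * 1 \<le> c * V x" using V_ge[OF x] by (intro mult_left_mono) auto
  thus "\<bar>f x\<bar> \<le> c * V x" using f[OF x] by simp
qed

lemma Vb_const: "(\<lambda>x. c) \<in> Vb" by (rule Vb_bounded[where c = "\<bar>c\<bar>"]) auto

lemma Vb_V: "V \<in> Vb" by (rule VbI[where c = 1]) (use V_meas V_ge in \<open>auto simp: order_trans[OF zero_le_one]\<close>)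

lemma Vb_cmult: "f \<in> Vb \<Longrightarrow> (\<lambda>x. a * f x) \<in> Vb"
proof -
  assume f: "f \<in> Vb"
  obtain c where c: "0 \<le> c" "\<And>x. x \<in> space S \<Longrightarrow> \<bar>f x\<bar> \<le> c * V x" using Vb_ex[OF f] by blast
  show ?thesis
  proof (rule VbI[where c = "\<bar>a\<bar> * c"])
    show "(\<lambda>x. a * f x) \<in> borel_measurable S" using Vb_meas[OF f] by simp
    show "\<bar>a * f x\<bar> \<le> \<bar>a\<bar> * c * V x" if "x \<in> space S" for x
      using mult_left_mono[OF c(2)[OF that], of "\<bar>a\<bar>"] by (simp add: abs_mult mult.assoc)
  qed
qed

lemma Vb_add: "f \<in> Vb \<Longrightarrow> g \<in> Vb \<Longrightarrow> (\<lambda>x. f x + g x) \<in> Vb"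
proof -
  assume f: "f \<in> Vb" and g: "g \<in> Vb"
  obtain c where c: "0 \<le> c" "\<And>x. x \<in> space S \<Longrightarrow> \<bar>f x\<bar> \<le> c * V x" using Vb_ex[OF f] by blast
  obtain d where d: "0 \<le> d" "\<And>x. x \<in> space S \<Longrightarrow> \<bar>g x\<bar> \<le> d * V x" using Vb_ex[OF g] by blast
  show ?thesis
  proof (rule VbI[where c = "c + d"])
    show "(\<lambda>x. f x + g x) \<in> borel_measurable S" using Vb_meas[OF f] Vb_meas[OF g] by simp
    show "\<bar>f x + g x\<bar> \<le> (c + d) * V x" if "x \<in> space S" for x
      using c(2)[OF that] d(2)[OF that] abs_triangle_ineq[of "f x" "g x"] by (simp add: distrib_right)
  qed
qed

lemma Vb_diff: "f \<in> Vb \<Longrightarrow> g \<in> Vb \<Longrightarrow> (\<lambda>x. f x - g x) \<in> Vb"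
  using Vb_add[of f "\<lambda>x. (-1) * g x"] Vb_cmult[of g "-1"] by simp

lemma Vb_sum: "(\<And>i. i \<in> I \<Longrightarrow> f i \<in> Vb) \<Longrightarrow> (\<lambda>x. \<Sum>i\<in>I. f i x) \<in> Vb"
  by (induction I rule: infinite_finite_induct) (auto intro: Vb_add Vb_const)

lemma Vb_cmult2: "f \<in> Vb \<Longrightarrow> (\<lambda>x. f x * a) \<in> Vb"
  using Vb_cmult[of f a] by (simp add: mult.commute)

lemma Vb_ind: "A \<in> sets S \<Longrightarrow> indicator A \<in> Vb"
  by (rule Vb_bounded[where c = 1]) (auto simp: indicator_def)

lemma Vb_dom: "f \<in> borel_measurable S \<Longrightarrow> (\<And>x. x \<in> space S \<Longrightarrow> \<bar>f x\<bar> \<le> g x) \<Longrightarrow> g \<in> Vb \<Longrightarrow> f \<in> Vb"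
proof -
  assume f: "f \<in> borel_measurable S" "\<And>x. x \<in> space S \<Longrightarrow> \<bar>f x\<bar> \<le> g x" and g: "g \<in> Vb"
  obtain d where d: "0 \<le> d" "\<And>x. x \<in> space S \<Longrightarrow> \<bar>g x\<bar> \<le> d * V x" using Vb_ex[OF g] by blast 
  show ?thesis by (rule VbI[where c = d]) (use f d in force)+
qed

lemmas Vb_intros = Vb_const Vb_V Vb_cmult Vb_cmult2 Vb_add Vb_diff Vb_sum Vb_ind

lemma int_V: "x \<in> space S \<Longrightarrow> integrable (P x) V"
  and PV_out: "x \<in> space S - C \<Longrightarrow> (\<integral>y. V y \<partial>P x) \<le> lam * V x"
  and PV_in: "x \<in> C \<Longrightarrow> (\<integral>y. V y \<partial>P x) \<le> K"
proof -
  have nn: "0 \<le> V y" if "y \<in> space S" for y using V_ge[OF that] by simp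
  have int: "integrable (P x) V" if "x \<in> space S" for x
  proof (rule integrableI_nonneg)
    show "V \<in> borel_measurable (P x)" using V_meas by (simp only: meas_P[OF that])
    show "AE y in P x. 0 \<le> V y" using nn by (intro AE_I2) (auto simp: space_P[OF that])
    have "(\<integral>\<^sup>+y. ennreal (V y) \<partial>P x) \<le> ennreal (max (lam * V x) K)"
    proof (cases "x \<in> C")
      case True
      hence "(\<integral>\<^sup>+y. ennreal (V y) \<partial>P x) \<le> ennreal K" using A2 by (simp add: drift_def)
      also have "\<dots> \<le> ennreal (max (lam * V x) K)" by (intro ennreal_leI) simp
      finally show ?thesis .
    next
      case False
      hence "(\<integral>\<^sup>+y. ennreal (V y) \<partial>P x) \<le> ennreal (lam * V x)" using A2 that by (simp add: drift_def)
      also have "\<dots> \<le> ennreal (max (lam * V x) K)" by (intro ennreal_leI) simp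
      finally show ?thesis .
    qed
    thus "(\<integral>\<^sup>+y. ennreal (V y) \<partial>P x) < \<infinity>" by (simp add: le_less_trans)
  qed
  thus "x \<in> space S \<Longrightarrow> integrable (P x) V" .
  have eq: "(\<integral>\<^sup>+y. ennreal (V y) \<partial>P x) = ennreal (\<integral>y. V y \<partial>P x)" if "x \<in> space S" for x
    using nn by (intro nn_integral_eq_integral int that AE_I2) (auto simp: space_P[OF that])
  show "(\<integral>y. V y \<partial>P x) \<le> lam * V x" if "x \<in> space S - C"
  proof -
    have "ennreal (\<integral>y. V y \<partial>P x) \<le> ennreal (lam * V x)"
      using A2 that eq[of x, symmetric] by (simp add: drift_def)
    moreover have "0 \<le> lam * V x" using lam nn that by simp
    ultimately show ?thesis by simp
  qed
  show "(\<integral>y. V y \<partial>P x) \<le> K" if "x \<in> C"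
  proof -
    have xs: "x \<in> space S" using C_sub that by blast
    interpret Px: prob_space "P x" by (rule P_prob[OF xs])
    have "ennreal (\<integral>y. V y \<partial>P x) \<le> ennreal K"
      using A2 that eq[of x] C_sub by (auto simp: drift_def)
    moreover have "1 \<le> (\<integral>y. V y \<partial>P x)"
      by (intro Px.integral_ge_const int xs AE_I2) (auto simp: space_P[OF xs] V_ge)
    hence "0 < (\<integral>y. V y \<partial>P x)" by simp
    ultimately show ?thesis by (auto simp: ennreal_le_iff2)
  qed
qed

lemma int_\<nu>V: "integrable \<nu> V"
proof -
  obtain a where a: "a \<in> C" by (rule C_nonempty)
  have as: "a \<in> space S" using a by (rule C_sub)
  have "ennreal \<beta>' * (\<integral>\<^sup>+y. ennreal (V y) \<partial>\<nu>) \<le> (\<integral>\<^sup>+y. ennreal (V y) \<partial>P a)"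
    using V_meas by (intro minorization_nn_integral a) auto
  also have "\<dots> = (\<integral>\<^sup>+y. ennreal (norm (V y)) \<partial>P a)"
    by (rule nn_integral_cong) (use V_ge in \<open>force simp: space_P[OF as]\<close>)
  also have "\<dots> < \<infinity>" using int_V[OF as] by (simp add: integrable_iff_bounded)
  finally have "(\<integral>\<^sup>+y. ennreal (V y) \<partial>\<nu>) < \<infinity>"
    using \<beta>'_pos by (auto simp: ennreal_mult_less_top ennreal_eq_0_iff)
  thus ?thesis
    using V_ge by (intro integrableI_nonneg AE_I2) (auto simp: meas_\<nu> V_meas space_\<nu> order_trans[OF zero_le_one])
qed

lemma Vb_int: assumes "f \<in> Vb" "sets M = sets S" "integrable M V" shows "integrable M f"
proof -
  obtain c where c: "0 \<le> c" "\<And>x. x \<in> space S \<Longrightarrow> \<bar>f x\<bar> \<le> c * V x" using Vb_ex[OF assms(1)] by blast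
  have sp: "space M = space S" using assms(2) by (rule sets_eq_imp_space_eq)
  show ?thesis
  proof (rule Bochner_Integration.integrable_bound)
    show "integrable M (\<lambda>x. c * V x)" using assms(3) by simp
    show "f \<in> borel_measurable M" using Vb_meas[OF assms(1)] assms(2) by (simp cong: measurable_cong_sets)
    show "AE x in M. norm (f x) \<le> norm (c * V x)"
      using c by (intro AE_I2) (force simp: sp intro: order_trans[OF _ abs_ge_self])
  qed
qed

lemma int_P: "f \<in> Vb \<Longrightarrow> x \<in> space S \<Longrightarrow> integrable (P x) f"
  by (rule Vb_int) (auto simp: sets_P int_V)

lemma int_\<nu>: "f \<in> Vb \<Longrightarrow> integrable \<nu> f"
  by (rule Vb_int) (auto simp: sets_\<nu> int_\<nu>V)

text \<open>
  The decomposition of the kernel at a regeneration: from a point of \<open>C\<close> the chain regenerates with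
  probability \<open>\<beta>'\<close> and then has law \<open>\<nu>\<close>; \<open>Q\<close> collects the transitions without regeneration. If \<open>C\<close> is an
  atom, then \<open>\<beta>' = 1\<close> and \<open>Q\<close> vanishes on \<open>C\<close>: regenerations are the visits to \<open>C\<close>.
\<close>
definition nu :: "('a \<Rightarrow> real) \<Rightarrow> real" where "nu f = (\<integral>y. f y \<partial>\<nu>)"
definition s :: "'a \<Rightarrow> real" where "s x = \<beta>' * indicator C x"
definition Q :: "('a \<Rightarrow> real) \<Rightarrow> 'a \<Rightarrow> real" where "Q f x = markov_op P f x - s x * nu f"

lemma P_eq: "markov_op P f x = Q f x + s x * nu f" by (simp add: Q_def)

lemma Vb_s: "s \<in> Vb" unfolding s_def[abs_def] by (intro Vb_intros C_sets)

lemma K_ge_1: "1 \<le> K"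
proof -
  obtain a where a: "a \<in> C" by (rule C_nonempty)
  have as: "a \<in> space S" using a by (rule C_sub)
  interpret Px: prob_space "P a" by (rule P_prob[OF as])
  have "1 \<le> (\<integral>y. V y \<partial>P a)"
    by (intro Px.integral_ge_const int_V as AE_I2) (auto simp: space_P[OF as] V_ge)
  thus ?thesis using PV_in[OF a] by simp
qed

lemma PV_le: "x \<in> space S \<Longrightarrow> (\<integral>y. V y \<partial>P x) \<le> K * V x"
proof (cases "x \<in> C")
  case True
  assume "x \<in> space S"
  hence "K * 1 \<le> K * V x" using K_ge_1 V_ge by (intro mult_left_mono) auto
  thus ?thesis using PV_in[OF True] by simp
next
  case False
  assume x: "x \<in> space S"
  have "lam * V x \<le> K * V x" using lam K_ge_1 V_ge[OF x] by (intro mult_right_mono) auto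
  thus ?thesis using PV_out[of x] False x by simp
qed

lemma Vb_P: assumes "f \<in> Vb" shows "markov_op P f \<in> Vb"
proof -
  obtain c where c: "0 \<le> c" "\<And>x. x \<in> space S \<Longrightarrow> \<bar>f x\<bar> \<le> c * V x" using Vb_ex[OF assms(1)] by blast
  show ?thesis
  proof (rule VbI[where c = "c * K"])
    show "markov_op P f \<in> borel_measurable S"
      unfolding markov_op_def[abs_def]
      by (rule measurable_compose[OF measurable_prob_algebraD[OF kernel] integral_measurable_subprob_algebra]) (rule Vb_meas[OF assms])
    fix x assume x: "x \<in> space S"
    have "\<bar>markov_op P f x\<bar> \<le> (\<integral>y. \<bar>f y\<bar> \<partial>P x)" unfolding markov_op_def by (rule integral_abs_bound)
    also have "\<dots> \<le> (\<integral>y. c * V y \<partial>P x)"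
      using c int_P[OF assms x] int_V[OF x] by (intro integral_mono) (auto simp: space_P[OF x])
    also have "\<dots> = c * (\<integral>y. V y \<partial>P x)" by simp
    also have "\<dots> \<le> c * (K * V x)" using PV_le[OF x] c by (intro mult_left_mono) auto
    finally show "\<bar>markov_op P f x\<bar> \<le> c * K * V x" by (simp add: mult.assoc)
  qed
qed

lemma Vb_Q: "f \<in> Vb \<Longrightarrow> Q f \<in> Vb"
  unfolding Q_def[abs_def] by (intro Vb_diff Vb_P Vb_cmult2 Vb_s)

lemma Vb_Qn: "f \<in> Vb \<Longrightarrow> (Q ^^ n) f \<in> Vb" by (induction n) (auto intro: Vb_Q)

abbreviation Pn :: "nat \<Rightarrow> ('a \<Rightarrow> real) \<Rightarrow> 'a \<Rightarrow> real" where
  "Pn n \<equiv> markov_op P ^^ n"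

lemma Vb_Pn: "f \<in> Vb \<Longrightarrow> Pn n f \<in> Vb" by (induction n) (auto intro: Vb_P)

lemma nu_add: "f \<in> Vb \<Longrightarrow> g \<in> Vb \<Longrightarrow> nu (\<lambda>x. f x + g x) = nu f + nu g"
  by (simp add: nu_def int_\<nu>)
lemma nu_diff: "f \<in> Vb \<Longrightarrow> g \<in> Vb \<Longrightarrow> nu (\<lambda>x. f x - g x) = nu f - nu g"
  by (simp add: nu_def int_\<nu>)
lemma nu_cmult: "nu (\<lambda>x. a * f x) = a * nu f" by (simp add: nu_def)
lemma nu_sum: "(\<And>i. i \<in> I \<Longrightarrow> f i \<in> Vb) \<Longrightarrow> nu (\<lambda>x. \<Sum>i\<in>I. f i x) = (\<Sum>i\<in>I. nu (f i))"
  by (simp add: nu_def int_\<nu>)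
lemma nu_const: "nu (\<lambda>x. a) = a" using prob_space.prob_space[OF \<nu>_prob] by (simp add: nu_def)
lemma nu_cong: "(\<And>x. x \<in> space S \<Longrightarrow> f x = g x) \<Longrightarrow> nu f = nu g"
  unfolding nu_def by (rule Bochner_Integration.integral_cong) (auto simp: space_\<nu>)
lemma nu_mono: "f \<in> Vb \<Longrightarrow> g \<in> Vb \<Longrightarrow> (\<And>x. x \<in> space S \<Longrightarrow> f x \<le> g x) \<Longrightarrow> nu f \<le> nu g"
  unfolding nu_def by (rule integral_mono) (auto simp: space_\<nu> int_\<nu>)
lemma nu_s: "nu s = \<beta>' * measure \<nu> C"
  using C_sets by (simp add: nu_def s_def[abs_def] sets_\<nu> sets.Int_space_eq1[of C \<nu>] Int_absorb2 sets.sets_into_space)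

lemma P_add: "x \<in> space S \<Longrightarrow> f \<in> Vb \<Longrightarrow> g \<in> Vb \<Longrightarrow> markov_op P (\<lambda>x. f x + g x) x = markov_op P f x + markov_op P g x"
  by (simp add: markov_op_def int_P)
lemma P_diff: "x \<in> space S \<Longrightarrow> f \<in> Vb \<Longrightarrow> g \<in> Vb \<Longrightarrow> markov_op P (\<lambda>x. f x - g x) x = markov_op P f x - markov_op P g x"
  by (simp add: markov_op_def int_P)
lemma P_cmult: "markov_op P (\<lambda>x. a * f x) x = a * markov_op P f x"
  by (simp add: markov_op_def)
lemma P_sum: "x \<in> space S \<Longrightarrow> (\<And>i. i \<in> I \<Longrightarrow> f i \<in> Vb) \<Longrightarrow> markov_op P (\<lambda>x. \<Sum>i\<in>I. f i x) x = (\<Sum>i\<in>I. markov_op P (f i) x)"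
  by (simp add: markov_op_def int_P)
lemma P_const: "x \<in> space S \<Longrightarrow> markov_op P (\<lambda>x. a) x = a"
  using prob_space.prob_space[OF P_prob] by (simp add: markov_op_def)
lemma P_cong: "x \<in> space S \<Longrightarrow> (\<And>y. y \<in> space S \<Longrightarrow> f y = g y) \<Longrightarrow> markov_op P f x = markov_op P g x"
  unfolding markov_op_def by (rule Bochner_Integration.integral_cong) (auto simp: space_P)
lemma P_mono: "x \<in> space S \<Longrightarrow> f \<in> Vb \<Longrightarrow> g \<in> Vb \<Longrightarrow> (\<And>x. x \<in> space S \<Longrightarrow> f x \<le> g x) \<Longrightarrow> markov_op P f x \<le> markov_op P g x"
  unfolding markov_op_def by (rule integral_mono) (auto simp: space_P int_P)

lemma Q_add: "x \<in> space S \<Longrightarrow> f \<in> Vb \<Longrightarrow> g \<in> Vb \<Longrightarrow> Q (\<lambda>x. f x + g x) x = Q f x + Q g x"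
  by (simp add: Q_def P_add nu_add algebra_simps)
lemma Q_diff: "x \<in> space S \<Longrightarrow> f \<in> Vb \<Longrightarrow> g \<in> Vb \<Longrightarrow> Q (\<lambda>x. f x - g x) x = Q f x - Q g x"
  by (simp add: Q_def P_diff nu_diff algebra_simps)
lemma Q_cmult: "Q (\<lambda>x. a * f x) x = a * Q f x"
  by (simp add: Q_def P_cmult nu_cmult algebra_simps)
lemma Q_sum: "x \<in> space S \<Longrightarrow> (\<And>i. i \<in> I \<Longrightarrow> f i \<in> Vb) \<Longrightarrow> Q (\<lambda>x. \<Sum>i\<in>I. f i x) x = (\<Sum>i\<in>I. Q (f i) x)"
  by (simp add: Q_def P_sum nu_sum sum_subtractf sum_distrib_left)
lemma Q_const: "x \<in> space S \<Longrightarrow> Q (\<lambda>x. a) x = a * (1 - s x)"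
  by (simp add: Q_def P_const nu_const algebra_simps)
lemma Q_cong: "x \<in> space S \<Longrightarrow> (\<And>y. y \<in> space S \<Longrightarrow> f y = g y) \<Longrightarrow> Q f x = Q g x"
  using P_cong[of x f g] nu_cong[of f g] by (simp add: Q_def)

lemma Q_out: "x \<notin> C \<Longrightarrow> Q f x = markov_op P f x" by (simp add: Q_def s_def)
lemma Q_in: "x \<in> C \<Longrightarrow> Q f x = markov_op P f x - \<beta>' * nu f" by (simp add: Q_def s_def)

lemma Q_nonneg:
  assumes x: "x \<in> space S" and f: "f \<in> Vb" "\<And>y. y \<in> space S \<Longrightarrow> 0 \<le> f y"
  shows "0 \<le> Q f x"
proof (cases "x \<in> C")
  case True
  have "ennreal \<beta>' * (\<integral>\<^sup>+y. ennreal (f y) \<partial>\<nu>) \<le> (\<integral>\<^sup>+y. ennreal (f y) \<partial>P x)"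
    using Vb_meas[OF f(1)] by (intro minorization_nn_integral True) auto
  moreover have "(\<integral>\<^sup>+y. ennreal (f y) \<partial>\<nu>) = ennreal (\<integral>y. f y \<partial>\<nu>)"
    using f by (intro nn_integral_eq_integral int_\<nu> AE_I2) (auto simp: space_\<nu>)
  moreover have "(\<integral>\<^sup>+y. ennreal (f y) \<partial>P x) = ennreal (\<integral>y. f y \<partial>P x)"
    using f x by (intro nn_integral_eq_integral int_P AE_I2) (auto simp: space_P)
  ultimately have "ennreal (\<beta>' * nu f) \<le> ennreal (markov_op P f x)"
    using \<beta>'_pos by (simp add: nu_def markov_op_def ennreal_mult')
  moreover have "0 \<le> markov_op P f x"
    unfolding markov_op_def using f x by (intro Bochner_Integration.integral_nonneg) (auto simp: space_P)
  ultimately show ?thesis using True by (simp add: Q_in)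
next
  case False
  thus ?thesis
    unfolding Q_out[OF False] markov_op_def using f x by (intro Bochner_Integration.integral_nonneg) (auto simp: space_P)
qed

lemma Q_mono:
  assumes x: "x \<in> space S" and "f \<in> Vb" "g \<in> Vb" "\<And>y. y \<in> space S \<Longrightarrow> f y \<le> g y"
  shows "Q f x \<le> Q g x"
  using Q_nonneg[OF x Vb_diff[OF assms(3,2)]] Q_diff[OF x assms(3,2)] assms(4) by simp

lemma Qn_nonneg: "f \<in> Vb \<Longrightarrow> (\<And>y. y \<in> space S \<Longrightarrow> 0 \<le> f y) \<Longrightarrow> x \<in> space S \<Longrightarrow> 0 \<le> (Q ^^ n) f x"
  by (induction n arbitrary: x) (auto intro!: Q_nonneg Vb_Qn)

lemma Qn_abs:
  assumes f: "f \<in> Vb" "g \<in> Vb" "\<And>y. y \<in> space S \<Longrightarrow> \<bar>f y\<bar> \<le> g y" and x: "x \<in> space S"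
  shows "\<bar>(Q ^^ n) f x\<bar> \<le> (Q ^^ n) g x"
  using x
proof (induction n arbitrary: x)
  case 0 thus ?case using f by simp
next
  case (Suc n)
  have "Q ((Q ^^ n) f) x \<le> Q ((Q ^^ n) g) x"
    using Suc.IH by (intro Q_mono Suc.prems Vb_Qn f) (auto simp: abs_le_iff)
  moreover have "Q (\<lambda>y. (-1) * (Q ^^ n) f y) x \<le> Q ((Q ^^ n) g) x"
    using Suc.IH by (intro Q_mono Suc.prems Vb_Qn Vb_cmult f) (auto simp: abs_le_iff)
  ultimately show ?case unfolding Q_cmult by simp
qed

text \<open>
  From \<open>Q 1 = 1 - s\<close>: the probability of regenerating at time \<open>n\<close> is the difference of two survival probabilities.
\<close>
lemma Qn_s_telescope:
  assumes x: "x \<in> space S"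
  shows "(Q ^^ n) s x = (Q ^^ n) (\<lambda>_. 1) x - (Q ^^ Suc n) (\<lambda>_. 1) x"
  using x
proof (induction n arbitrary: x)
  case 0 thus ?case by (simp add: Q_const)
next
  case (Suc n)
  have "(Q ^^ Suc n) s x = Q (\<lambda>x. (Q ^^ n) (\<lambda>_. 1) x - (Q ^^ Suc n) (\<lambda>_. 1) x) x"
    using Suc by (simp add: Q_cong[OF Suc.prems Suc.IH])
  also have "\<dots> = (Q ^^ Suc n) (\<lambda>_. 1) x - (Q ^^ Suc (Suc n)) (\<lambda>_. 1) x"
    by (subst Q_diff) (auto intro!: Suc.prems Vb_Q Vb_Qn Vb_const)
  finally show ?case .
qed

text \<open>
  The comparison principle behind all excursion bounds: a nonnegative \<open>F\<close> with \<open>F \<ge> f + r Q F\<close> dominates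
  \<open>\<Sum>n. r\<^sup>n Q\<^sup>n f\<close>. In probabilistic terms the sum is the expected discounted cost of an excursion,
  and \<open>F\<close> bounds it by a supermartingale argument, here an induction on the number of terms.
\<close>
lemma partial_sums_le_supersolution:
  assumes F: "F \<in> Vb" "f \<in> Vb" and r: "0 \<le> r" and F0: "\<And>x. x \<in> space S \<Longrightarrow> 0 \<le> F x"
    and step: "\<And>x. x \<in> space S \<Longrightarrow> f x + r * Q F x \<le> F x" and x: "x \<in> space S"
  shows "(\<Sum>n<N. r ^ n * (Q ^^ n) f x) \<le> F x"
  using x
proof (induction N arbitrary: x)
  case 0 thus ?case using F0 by simp
next
  case (Suc N)
  have m: "\<And>n. (\<lambda>x. r ^ n * (Q ^^ n) f x) \<in> Vb" by (intro Vb_cmult Vb_Qn F)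
  have "(\<Sum>n<Suc N. r ^ n * (Q ^^ n) f x) = f x + r * (\<Sum>n<N. r ^ n * Q ((Q ^^ n) f) x)"
    unfolding sum.lessThan_Suc_shift by (simp add: sum_distrib_left mult_ac)
  also have "(\<Sum>n<N. r ^ n * Q ((Q ^^ n) f) x) = Q (\<lambda>x. \<Sum>n<N. r ^ n * (Q ^^ n) f x) x"
    using m Suc.prems by (simp add: Q_sum Q_cmult)
  also have "f x + r * \<dots> \<le> f x + r * Q F x"
    using Suc.IH r by (intro add_left_mono mult_left_mono Q_mono Vb_sum m F Suc.prems) auto
  also have "\<dots> \<le> F x" using step[OF Suc.prems] .
  finally show ?case .
qed

definition p_seq :: "('a \<Rightarrow> real) \<Rightarrow> nat \<Rightarrow> real" where "p_seq g n = nu (Pn n g)"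

text \<open>
  Decomposition at the first regeneration (time \<open>i\<close>), after which the chain restarts from \<open>\<nu>\<close>.
\<close>
lemma Pn_decomp:
  assumes g: "g \<in> Vb" and x: "x \<in> space S"
  shows "Pn n g x = (Q ^^ n) g x + (\<Sum>i<n. (Q ^^ i) s x * p_seq g (n - 1 - i))"
  using x
proof (induction n arbitrary: x)
  case 0 thus ?case by simp
next
  case (Suc n)
  have "Pn (Suc n) g x = Q (Pn n g) x + s x * p_seq g n"
    by (simp add: P_eq p_seq_def)
  also have "Q (Pn n g) x = Q (\<lambda>x. (Q ^^ n) g x + (\<Sum>i<n. (Q ^^ i) s x * p_seq g (n - 1 - i))) x"
    by (intro Q_cong Suc)
  also have "\<dots> = Q ((Q ^^ n) g) x + Q (\<lambda>x. (\<Sum>i<n. (Q ^^ i) s x * p_seq g (n - 1 - i))) x"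
    by (intro Q_add Suc.prems Vb_Qn g Vb_sum Vb_cmult2 Vb_s)
  also have "Q (\<lambda>x. (\<Sum>i<n. (Q ^^ i) s x * p_seq g (n - 1 - i))) x = (\<Sum>i<n. Q (\<lambda>x. p_seq g (n - 1 - i) * (Q ^^ i) s x) x)"
    by (subst Q_sum) (auto intro!: Suc.prems Vb_cmult Vb_cmult2 Vb_Qn Vb_s simp: mult.commute)
  also have "\<dots> = (\<Sum>i<n. (Q ^^ Suc i) s x * p_seq g (n - 1 - i))"
    by (simp add: Q_cmult mult.commute)
  finally show ?case unfolding sum.lessThan_Suc_shift by simp
qed

text \<open>
  The renewal equation: the same decomposition for the chain that starts from \<open>\<nu>\<close>.
\<close>
lemma p_decomp:
  assumes g: "g \<in> Vb"
  shows "p_seq g n = nu ((Q ^^ n) g) + (\<Sum>i<n. nu ((Q ^^ i) s) * p_seq g (n - 1 - i))"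
proof -
  have "p_seq g n = nu (\<lambda>x. (Q ^^ n) g x + (\<Sum>i<n. p_seq g (n - 1 - i) * (Q ^^ i) s x))"
    unfolding p_seq_def[of g n] by (rule nu_cong) (simp add: Pn_decomp[OF g] mult.commute)
  also have "\<dots> = nu ((Q ^^ n) g) + (\<Sum>i<n. p_seq g (n - 1 - i) * nu ((Q ^^ i) s))"
    by (subst nu_add, (intro Vb_Qn g Vb_sum Vb_cmult Vb_s)+, subst nu_sum)
       (auto intro!: Vb_cmult Vb_Qn Vb_s simp: nu_cmult)
  finally show ?thesis by (simp add: mult.commute)
qed

end

section \<open>Power series\<close>

lemma fps_mult_bound:
  fixes a b :: "real fps"
  assumes a: "\<And>N. (\<Sum>i<N. \<bar>fps_nth a i\<bar> * r ^ i) \<le> A" and b: "\<And>i. \<bar>fps_nth b i\<bar> * r ^ i \<le> B" and r: "0 \<le> r"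
  shows "\<bar>fps_nth (a * b) m\<bar> * r ^ m \<le> A * B"
proof -
  have B: "0 \<le> B" using b[of 0] by (simp add: order_trans[OF abs_ge_zero])
  have "\<bar>fps_nth (a * b) m\<bar> * r ^ m \<le> (\<Sum>i\<le>m. \<bar>fps_nth a i * fps_nth b (m - i)\<bar>) * r ^ m"
    unfolding fps_mult_nth atLeast0AtMost using r by (intro mult_right_mono sum_abs) auto
  also have "\<dots> = (\<Sum>i\<le>m. (\<bar>fps_nth a i\<bar> * r ^ i) * (\<bar>fps_nth b (m - i)\<bar> * r ^ (m - i)))"
    unfolding sum_distrib_right
  proof (rule sum.cong[OF refl])
    fix i assume "i \<in> {..m}"
    hence "r ^ m = r ^ i * r ^ (m - i)" by (simp flip: power_add)
    thus "\<bar>fps_nth a i * fps_nth b (m - i)\<bar> * r ^ m = \<bar>fps_nth a i\<bar> * r ^ i * (\<bar>fps_nth b (m - i)\<bar> * r ^ (m - i))"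
      by (simp add: abs_mult)
  qed
  also have "\<dots> \<le> (\<Sum>i\<le>m. (\<bar>fps_nth a i\<bar> * r ^ i) * B)"
    using r by (intro sum_mono mult_left_mono b) auto
  also have "\<dots> = (\<Sum>i<Suc m. \<bar>fps_nth a i\<bar> * r ^ i) * B"
    by (simp add: sum_distrib_right lessThan_Suc_atMost)
  also have "\<dots> \<le> A * B" using a B by (intro mult_right_mono)
  finally show ?thesis .
qed

text \<open>
  The algebra that isolates the limit. With \<open>U = 1 / ((1 - X) c)\<close> the renewal series, the equations for \<open>A\<close> and \<open>p\<close> say
  \<open>A = q + X S U v\<close>. Each of \<open>S\<close>, \<open>v\<close> and \<open>c\<close> equals its value at \<open>1\<close> minus \<open>1 - X\<close> times the series of its tails
  (the value of \<open>S\<close> at \<open>1\<close> is \<open>1\<close>), and \<open>d\<close> is the deviation of \<open>U\<close> from its limit \<open>1 / u\<close>. The pole at \<open>1\<close> is thereby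
  split off as \<open>(v1 / u) X / (1 - X)\<close>; what remains is built from \<open>q\<close>, \<open>S\<close>, \<open>v\<close>, the tails and \<open>d\<close>, which for
  the chain all converge beyond the unit disc.
\<close>
lemma fps_decomposition:
  fixes A q S' v c p v' e d J S :: "real fps" and v1 u :: real
  assumes S: "S = 1 - (1 - fps_X) * S'"
    and A: "A = q + fps_X * S * p" and p: "(1 - fps_X) * c * p = v"
    and v: "v = fps_const v1 - (1 - fps_X) * v'" and c: "c = fps_const u - (1 - fps_X) * e"
    and u: "u \<noteq> 0" and d: "d * c * fps_const u = e" and J: "J * (1 - fps_X) = 1" and c0: "c \<noteq> 0"
  shows "A - fps_const (v1 / u) * (fps_X * J) = q + fps_X * (S * (v * d)) - fps_const (1 / u) * (fps_X * (S' * v + v'))"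
proof -
  define k where "k = fps_const (1 / u)"
  define U where "U = fps_const u"
  define w where "w = fps_const v1"
  define Y where "Y = 1 - (fps_X :: real fps)"
  have kU: "k * U = 1" using u by (simp add: k_def U_def fps_const_mult_apply_left flip: fps_const_1_eq_1)
  have kw: "fps_const (v1 / u) = w * k" by (simp add: k_def w_def)
  have Y0: "Y \<noteq> 0"
  proof
    assume "Y = 0"
    hence "fps_nth Y 0 = 0" by simp
    thus False by (simp add: Y_def)
  qed
  note E = S A p v c d J
  note E' = E[folded Y_def U_def w_def]
  have k': "Y * d * c = k * (U - c)"
  proof -
    have "k * (U - c) = k * (Y * e)" using E'(5) by simp
    also have "\<dots> = k * (Y * (d * c * U))" using E'(6) by simp
    also have "\<dots> = (k * U) * (Y * d * c)" by (simp only: mult_ac)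
    finally show ?thesis using kU by simp
  qed
  have Xp: "fps_X * S * p * (Y * c) = fps_X * S * v" using E'(3) by (metis mult.assoc mult.commute)
  have L: "(A - w * k * (fps_X * J)) * (Y * c) = q * (Y * c) + fps_X * S * v - w * k * fps_X * c"
  proof -
    have "(A - w * k * (fps_X * J)) * (Y * c) = q * (Y * c) + fps_X * S * p * (Y * c) - w * k * fps_X * c * (J * Y)"
      unfolding E'(2) by (simp add: algebra_simps)
    thus ?thesis using Xp E'(7) by simp
  qed
  have R: "(q + fps_X * (S * (v * d)) - k * (fps_X * (S' * v + v'))) * (Y * c)
     = q * (Y * c) + fps_X * S * v * (Y * d * c) - k * fps_X * c * ((Y * S') * v + Y * v')"
    by (simp add: algebra_simps)
  have YS: "Y * S' = 1 - S" and Yv: "Y * v' = w - v" using E'(1,4) by simp_all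
  have "(q + fps_X * (S * (v * d)) - k * (fps_X * (S' * v + v'))) * (Y * c)
      = q * (Y * c) + fps_X * S * v * (k * (U - c)) - k * fps_X * c * ((1 - S) * v + (w - v))"
    unfolding R k' YS Yv ..
  also have "\<dots> = q * (Y * c) + fps_X * S * v * (k * U) - w * k * fps_X * c"
    by (simp add: algebra_simps)
  finally have "(A - w * k * (fps_X * J)) * (Y * c) = (q + fps_X * (S * (v * d)) - k * (fps_X * (S' * v + v'))) * (Y * c)"
    using L kU by simp
  thus ?thesis unfolding kw k_def[symmetric] using Y0 c0 by simp
qed

text \<open>
  The concave function \<open>y powr t\<close> lies below its tangent at \<open>M\<close>. Integrating the tangent is Jensen's inequality for
  any positive functional, even if its mass is not \<open>1\<close>.
\<close>
lemma powr_tangent: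
  fixes y M t :: real
  assumes "0 < y" "0 < M" "0 \<le> t" "t \<le> 1"
  shows "y powr t \<le> (1 - t) * M powr t + t * M powr (t - 1) * y"
proof -
  have "y powr t * M powr (1 - t) \<le> t * y + (1 - t) * M"
    using assms by (intro Youngs_inequality_0) auto
  hence "y powr t * M powr (1 - t) * M powr (t - 1) \<le> (t * y + (1 - t) * M) * M powr (t - 1)"
    by (intro mult_right_mono) auto
  moreover have "M powr (1 - t) * M powr (t - 1) = 1" using assms by (simp flip: powr_add)
  moreover have e: "M * M powr (t - 1) = M powr t" using assms by (simp add: powr_mult_base)
  moreover have "(t * y + (1 - t) * M) * M powr (t - 1) = t * M powr (t - 1) * y + (1 - t) * (M * M powr (t - 1))"
    by (simp add: algebra_simps)
  ultimately show ?thesis by (simp only: mult.assoc mult_1_right)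
qed

section \<open>Supersolutions from the drift condition\<close>

context drift_chain
begin

text \<open>
  \<open>V\<close> can be unbounded on \<open>C\<close>, but the bounds for what follows a visit to \<open>C\<close> must not depend on the point visited.
\<close>
definition V0 :: "'a \<Rightarrow> real" where "V0 x = (if x \<in> C then 1 else V x)"

text \<open>
  By Jensen's inequality \<open>W t\<close> satisfies the drift condition outside \<open>C\<close> with the factor \<open>lam powr t\<close>, hence bounds the
  generating function at \<open>r = lam powr (- t)\<close> of the hitting time of \<open>C\<close>. This interpolation is the source of the
  exponents \<open>\<alpha>1\<close> and \<open>\<alpha>2\<close>.
\<close>
definition W :: "real \<Rightarrow> 'a \<Rightarrow> real" where "W t x = V0 x powr t"

lemma V0_meas: "V0 \<in> borel_measurable S"
  unfolding V0_def[abs_def] using C_sets V_meas by simp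

lemma V0_bounds: "x \<in> space S \<Longrightarrow> 1 \<le> V0 x" "x \<in> space S \<Longrightarrow> V0 x \<le> V x"
  using V_ge by (auto simp: V0_def)

lemma Vb_V0: "V0 \<in> Vb"
  by (rule Vb_dom[OF V0_meas _ Vb_V]) (use V0_bounds in force)

lemma W_bounds: assumes "x \<in> space S" "0 \<le> t" "t \<le> 1" shows "1 \<le> W t x" "W t x \<le> V0 x" "W t x \<le> V x"
proof -
  show "1 \<le> W t x" unfolding W_def using assms V0_bounds(1) by (intro ge_one_powr_ge_zero) auto
  have "V0 x powr t \<le> V0 x powr 1" using assms V0_bounds(1) by (intro powr_mono) auto
  thus "W t x \<le> V0 x" unfolding W_def using V0_bounds(1)[OF assms(1)] by simp
  thus "W t x \<le> V x" using V0_bounds(2)[OF assms(1)] by simp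
qed

lemma W_in: "x \<in> C \<Longrightarrow> W t x = 1" by (simp add: W_def V0_def)
lemma W_0: "x \<in> space S \<Longrightarrow> W 0 x = 1" using V0_bounds(1)[of x] by (simp add: W_def)

lemma Vb_W: "0 \<le> t \<Longrightarrow> t \<le> 1 \<Longrightarrow> W t \<in> Vb"
proof (rule Vb_dom[OF _ _ Vb_V])
  show "W t \<in> borel_measurable S" unfolding W_def[abs_def] using V0_meas by simp
  show "\<And>x. 0 \<le> t \<Longrightarrow> t \<le> 1 \<Longrightarrow> x \<in> space S \<Longrightarrow> \<bar>W t x\<bar> \<le> V x" using W_bounds by force
qed

lemma W_tangent: "x \<in> space S \<Longrightarrow> 0 < M \<Longrightarrow> 0 \<le> t \<Longrightarrow> t \<le> 1 \<Longrightarrow>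
    W t x \<le> (1 - t) * M powr t + t * M powr (t - 1) * V0 x"
  unfolding W_def using V0_bounds(1)[of x] by (intro powr_tangent) auto

lemma tangent_at: fixes M t :: real assumes "0 < M" shows "(1 - t) * M powr t + t * M powr (t - 1) * M = M powr t"
proof -
  have "M powr (t - 1) * M = M powr t" using assms by (simp add: powr_mult_base mult.commute)
  thus ?thesis by (simp add: algebra_simps)
qed

lemma nu_W:
  assumes M: "0 < M" "nu V0 \<le> M" and t: "0 \<le> t" "t \<le> 1"
  shows "nu (W t) \<le> M powr t"
proof -
  have "nu (W t) \<le> nu (\<lambda>x. (1 - t) * M powr t + t * M powr (t - 1) * V0 x)"
    using t M by (intro nu_mono Vb_W Vb_intros Vb_V0 W_tangent) auto
  also have "\<dots> = (1 - t) * M powr t + t * M powr (t - 1) * nu V0"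
    by (simp add: nu_add[OF Vb_const Vb_cmult[OF Vb_V0]] nu_const nu_cmult)
  also have "\<dots> \<le> (1 - t) * M powr t + t * M powr (t - 1) * M"
    using M t by (intro add_left_mono mult_left_mono) auto
  finally show ?thesis using tangent_at[OF M(1)] by simp
qed

lemma P_W:
  assumes x: "x \<in> space S" and M: "0 < M" "markov_op P V0 x \<le> M" and t: "0 \<le> t" "t \<le> 1"
  shows "markov_op P (W t) x \<le> M powr t"
proof -
  have "markov_op P (W t) x \<le> markov_op P (\<lambda>x. (1 - t) * M powr t + t * M powr (t - 1) * V0 x) x"
    using t M by (intro P_mono x Vb_W Vb_intros Vb_V0 W_tangent) auto
  also have "\<dots> = (1 - t) * M powr t + t * M powr (t - 1) * markov_op P V0 x"
    by (simp add: P_add[OF x Vb_const Vb_cmult[OF Vb_V0]] P_const[OF x] P_cmult)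
  also have "\<dots> \<le> (1 - t) * M powr t + t * M powr (t - 1) * M"
    using M t by (intro add_left_mono mult_left_mono) auto
  finally show ?thesis using tangent_at[OF M(1)] by simp
qed

lemma Q_W:
  assumes x: "x \<in> C" and M: "0 < M" "Q V0 x \<le> (1 - \<beta>') * M" and t: "0 \<le> t" "t \<le> 1"
  shows "Q (W t) x \<le> (1 - \<beta>') * M powr t"
proof -
  have xs: "x \<in> space S" using x by (rule C_sub)
  have sx: "s x = \<beta>'" using x by (simp add: s_def)
  have "Q (W t) x \<le> Q (\<lambda>x. (1 - t) * M powr t + t * M powr (t - 1) * V0 x) x"
    using t M by (intro Q_mono xs Vb_W Vb_intros Vb_V0 W_tangent) auto
  also have "\<dots> = (1 - t) * M powr t * (1 - \<beta>') + t * M powr (t - 1) * Q V0 x"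
    by (simp add: Q_add[OF xs Vb_const Vb_cmult[OF Vb_V0]] Q_const[OF xs] Q_cmult sx)
  also have "\<dots> \<le> (1 - t) * M powr t * (1 - \<beta>') + t * M powr (t - 1) * ((1 - \<beta>') * M)"
    using M t by (intro add_left_mono mult_left_mono) auto
  also have "\<dots> = (1 - \<beta>') * ((1 - t) * M powr t + t * M powr (t - 1) * M)" by (simp add: algebra_simps)
  finally show ?thesis using tangent_at[OF M(1)] by simp
qed

lemma PW_out:
  assumes x: "x \<in> space S" "x \<notin> C" and t: "0 \<le> t" "t \<le> 1"
  shows "lam powr (- t) * markov_op P (W t) x \<le> W t x"
proof -
  have V: "0 < V x" using V_ge[OF x(1)] by simp
  have "markov_op P V0 x \<le> markov_op P V x" by (intro P_mono x Vb_V0 Vb_V V0_bounds)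
  also have "\<dots> \<le> lam * V x" using PV_out x by (simp add: markov_op_def)
  finally have "markov_op P (W t) x \<le> (lam * V x) powr t" using lam V by (intro P_W x t) auto
  hence "lam powr (- t) * markov_op P (W t) x \<le> lam powr (- t) * (lam * V x) powr t"
    by (intro mult_left_mono) auto
  also have "\<dots> = (lam powr (- t) * lam powr t) * V x powr t" using lam V by (simp add: powr_mult)
  also have "lam powr (- t) * lam powr t = 1" using lam by (simp flip: powr_add)
  finally have "lam powr (- t) * markov_op P (W t) x \<le> V x powr t" by simp
  moreover have "W t x = V x powr t" using x by (simp add: W_def V0_def)
  ultimately show ?thesis by simp
qed

lemma V_out_ge: assumes x: "x \<in> space S" "x \<notin> C" shows "1 / lam \<le> V x"
proof -
  have "markov_op P (\<lambda>_. 1) x \<le> markov_op P V x" by (intro P_mono x Vb_const Vb_V V_ge)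
  hence "1 \<le> markov_op P V x" by (simp only: P_const[OF x(1)])
  hence "1 \<le> lam * V x" using PV_out[of x] x by (simp add: markov_op_def)
  thus ?thesis using lam by (simp add: field_simps)
qed

text \<open>
  Outside \<open>C\<close> the drift condition and \<open>V \<ge> 1\<close> force \<open>V \<ge> 1 / lam\<close>, so \<open>V = (1 / lam) powr m\<close> with \<open>m \<ge> 1\<close> and
  \<open>W t = r powr m\<close>; convexity of \<open>y powr m\<close> between \<open>1\<close> and \<open>1 / lam\<close> gives the bound.
\<close>
lemma W_minus_1_le:
  assumes x: "x \<in> space S" and t: "0 < t" "t \<le> 1"
  shows "(W t x - 1) / (lam powr (- t) - 1) \<le> lam * V x / (1 - lam)"
proof (cases "x \<in> C")
  case True
  thus ?thesis using lam V_ge[OF x] by (simp add: W_in)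
next
  case False
  define m where "m = ln (V x) / ln (1 / lam)"
  define r where "r = lam powr (- t)"
  have V: "1 / lam \<le> V x" "0 < V x" using V_out_ge[OF x False] V_ge[OF x] by auto
  have ll: "0 < ln (1 / lam)" using lam by simp
  have m1: "1 \<le> m" using V lam ll unfolding m_def by (simp add: ln_le_cancel_iff)
  have Vm: "V x = (1 / lam) powr m" using V ll lam by (simp add: m_def powr_def)
  have r1: "1 < r" "r \<le> 1 / lam"
  proof -
    have "lam powr 0 < lam powr (- t)" using lam t by (intro powr_less_mono') auto
    thus "1 < r" using lam by (simp add: r_def)
    have "lam powr (- t) \<le> lam powr (- 1)" using lam t by (intro powr_mono') auto
    thus "r \<le> 1 / lam" using lam by (simp add: r_def powr_minus_divide)
  qed
  have Wm: "W t x = r powr m"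
    using False lam by (simp add: W_def V0_def Vm r_def powr_powr powr_divide powr_minus_divide mult.commute)
  \<comment> \<open>\<open>r = (1 - p) * 1 + p * (1 / lam)\<close>\<close>
  define p where "p = (r - 1) / (1 / lam - 1)"
  have L: "0 < 1 / lam - 1" using lam by simp
  have p: "0 \<le> p" "p \<le> 1" using r1 L by (auto simp: p_def field_simps)
  have "convex_on {0<..} (\<lambda>y::real. y powr m)" using m1 by (intro powr_convex) 
  from convex_onD[OF this, of p 1 "1 / lam"] p lam
  have "((1 - p) * 1 + p * (1 / lam)) powr m \<le> (1 - p) * 1 powr m + p * (1 / lam) powr m" by simp
  moreover have "(1 - p) * 1 + p * (1 / lam) = r"
  proof -
    have "(1 - p) * 1 + p * (1 / lam) = 1 + p * (1 / lam - 1)" by (simp add: algebra_simps)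
    also have "p * (1 / lam - 1) = r - 1" 
    proof -
      have "(r - 1) / h * h = r - 1" if "0 < h" for h :: real using that by simp
      from this[OF L] show ?thesis by (simp only: p_def)
    qed
    finally show ?thesis by simp
  qed
  ultimately have "W t x \<le> 1 + p * (V x - 1)" by (simp add: Wm Vm[symmetric] algebra_simps)
  also have "p * (V x - 1) \<le> p * V x" using p by (simp add: mult_left_mono)
  finally have "W t x - 1 \<le> p * V x" by simp
  hence "(W t x - 1) / (r - 1) \<le> p * V x / (r - 1)" using r1 by (intro divide_right_mono) auto
  also have "\<dots> = V x / (1 / lam - 1)" using r1 by (simp add: p_def)
  also have "\<dots> = lam * V x / (1 - lam)" using lam by (simp add: field_simps)
  finally show ?thesis by (simp add: r_def)
qed

lemma Vb_C_excess: "(\<lambda>x. indicator C x * (V x - 1)) \<in> Vb"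
proof (rule Vb_dom[OF _ _ Vb_V])
  show "(\<lambda>x. indicator C x * (V x - 1)) \<in> borel_measurable S" using C_sets V_meas by simp
  show "\<And>x. x \<in> space S \<Longrightarrow> \<bar>indicator C x * (V x - 1)\<bar> \<le> V x" using V_ge by (force simp: indicator_def)
qed

end

text \<open>
  A discount rate \<open>r = lam powr (- t)\<close> together with bounds for one step: \<open>\<eta>\<close> bounds the generating function of the return
  time to \<open>C\<close> without regeneration, and \<open>\<zeta>\<close> that of the hitting time of \<open>C\<close> after a regeneration. The number of
  visits to \<open>C\<close> before the next regeneration is then controlled by the geometric series \<open>1 / D\<close>.
\<close>
locale weight = drift_chain +
  fixes t r \<eta> \<zeta> :: real
  assumes t: "0 \<le> t" "t \<le> 1" and r: "r = lam powr (- t)"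
    and \<eta>: "\<And>x. x \<in> C \<Longrightarrow> r * Q (W t) x \<le> \<eta>" and \<eta>1: "\<eta> < 1"
    and \<zeta>: "r * nu (W t) \<le> \<zeta>"
begin

definition D where "D = 1 - \<eta>"

lemma D_pos: "0 < D" using \<eta>1 by (simp add: D_def)

lemma r_ge_1: "1 \<le> r"
proof -
  have "lam powr 0 \<le> lam powr (- t)" using lam t by (intro powr_mono') auto
  thus ?thesis using lam by (simp add: r)
qed

lemma W_ge: "x \<in> space S \<Longrightarrow> 1 \<le> W t x" using W_bounds t by blast

lemma W_Vb: "W t \<in> Vb" using Vb_W t by blast

lemma rPW: "x \<in> space S \<Longrightarrow> x \<notin> C \<Longrightarrow> r * markov_op P (W t) x \<le> W t x"
  unfolding r using PW_out t by blast

text \<open>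
  On \<open>C\<close>, \<open>\<eta> \<ge> r Q (W t) \<ge> Q 1 = 1 - \<beta>'\<close>.
\<close>
lemma D_le: "D \<le> \<beta>'"
proof -
  obtain a where a: "a \<in> C" by (rule C_nonempty)
  have as: "a \<in> space S" using a by (rule C_sub)
  have "1 - \<beta>' = Q (\<lambda>_. 1) a" using Q_const[OF as, of 1] a by (simp add: s_def)
  also have "\<dots> \<le> Q (W t) a" by (intro Q_mono as Vb_const W_Vb W_ge)
  finally have "1 - \<beta>' \<le> Q (W t) a" .
  moreover have "1 * Q (W t) a \<le> r * Q (W t) a"
    using r_ge_1 calculation \<beta>'_le_1 by (intro mult_right_mono) auto
  ultimately show ?thesis using \<eta>[OF a] by (simp add: D_def)
qed

lemma \<zeta>_ge: "1 \<le> \<zeta>"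
proof -
  have "nu (\<lambda>_. 1) \<le> nu (W t)" by (intro nu_mono Vb_const W_Vb W_ge)
  hence "1 \<le> nu (W t)" by (simp add: nu_const)
  hence "1 * 1 \<le> r * nu (W t)" using r_ge_1 by (intro mult_mono) auto
  thus ?thesis using \<zeta> by simp
qed

lemma s_sum: assumes x: "x \<in> space S" shows "(\<Sum>n<N. r ^ n * (Q ^^ n) s x) \<le> \<beta>' / D * W t x"
proof (rule partial_sums_le_supersolution[OF _ Vb_s _ _ _ x])
  show "(\<lambda>x. \<beta>' / D * W t x) \<in> Vb" by (intro Vb_cmult W_Vb)
  show "0 \<le> r" using r_ge_1 by simp
  show "0 \<le> \<beta>' / D * W t y" if "y \<in> space S" for y using W_ge[OF that] \<beta>'_pos D_pos by simp
  show "s y + r * Q (\<lambda>x. \<beta>' / D * W t x) y \<le> \<beta>' / D * W t y" if y: "y \<in> space S" for y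
  proof (cases "y \<in> C")
    case True
    have "\<beta>' / D * (r * Q (W t) y) \<le> \<beta>' / D * \<eta>" using \<eta>[OF True] \<beta>'_pos D_pos by (intro mult_left_mono) auto
    moreover have "\<beta>' + \<beta>' / D * \<eta> = \<beta>' / D" using D_pos unfolding D_def by (simp add: field_simps)
    ultimately show ?thesis using True by (simp only: Q_cmult W_in s_def) (simp add: mult_ac)
  next
    case False
    have "\<beta>' / D * (r * markov_op P (W t) y) \<le> \<beta>' / D * W t y"
      using rPW[OF y False] \<beta>'_pos D_pos by (intro mult_left_mono) auto
    thus ?thesis using False by (simp only: Q_cmult Q_out[OF False] s_def) (simp add: mult_ac)
  qed
qed

text \<open>
  A supersolution for the constant \<open>1\<close>. It comes from \<open>\<beta>' / D W\<close>, the supersolution for \<open>s\<close>, through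
  the identity \<open>(r - 1) \<Sum>n. r\<^sup>n Q\<^sup>n 1 = r \<Sum>n. r\<^sup>n Q\<^sup>n s - 1\<close>, which is \<open>s = 1 - Q 1\<close> summed by parts.
\<close>
definition one_majorant where "one_majorant x = (r * \<beta>' / D * W t x - 1) / (r - 1)"

lemma Vb_one_majorant: "one_majorant \<in> Vb"
  unfolding one_majorant_def[abs_def] divide_inverse by (intro Vb_intros W_Vb)

lemma one_majorant_nonneg: "1 < r \<Longrightarrow> x \<in> space S \<Longrightarrow> 0 \<le> one_majorant x"
proof -
  assume r: "1 < r" and x: "x \<in> space S"
  have "1 \<le> \<beta>' / D" using D_le D_pos by simp
  hence "1 * 1 * 1 \<le> r * (\<beta>' / D) * W t x" using W_ge[OF x] r by (intro mult_mono mult_nonneg_nonneg) auto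
  thus ?thesis using r by (simp add: one_majorant_def)
qed

lemma one_majorant_step: assumes r1: "1 < r" and y: "y \<in> space S" shows "1 + r * Q one_majorant y \<le> one_majorant y"
proof -
  define k where "k = r * \<beta>' / D"
  have k: "0 \<le> k" using r1 \<beta>'_pos D_pos by (simp add: k_def)
  have kD: "k * \<eta> + r * \<beta>' = k" using D_pos unfolding k_def D_def by (simp add: field_simps)
  have eq: "Q one_majorant y = (k * Q (W t) y - (1 - s y)) / (r - 1)"
  proof -
    have "Q one_majorant y = Q (\<lambda>x. inverse (r - 1) * (k * W t x - 1)) y"
      by (rule Q_cong[OF y]) (simp add: one_majorant_def k_def divide_inverse mult_ac)
    also have "\<dots> = inverse (r - 1) * (k * Q (W t) y - (1 - s y))"
      unfolding Q_cmult by (subst Q_diff) (auto intro!: y Vb_intros W_Vb simp: Q_cmult Q_const[OF y])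
    finally show ?thesis by (simp add: divide_inverse mult.commute)
  qed
  have "(r - 1) + r * (k * Q (W t) y - (1 - s y)) \<le> k * W t y - 1"
  proof (cases "y \<in> C")
    case True
    have "k * (r * Q (W t) y) \<le> k * \<eta>" using \<eta>[OF True] k by (intro mult_left_mono)
    moreover have "s y = \<beta>'" using True by (simp add: s_def)
    ultimately show ?thesis using kD by (simp add: W_in[OF True] algebra_simps)
  next
    case False
    have "k * (r * Q (W t) y) \<le> k * W t y" using rPW[OF y False] k False by (intro mult_left_mono) (simp_all add: Q_out)
    moreover have "s y = 0" using False by (simp add: s_def)
    ultimately show ?thesis by (simp add: algebra_simps)
  qed
  hence "((r - 1) + r * (k * Q (W t) y - (1 - s y))) / (r - 1) \<le> (k * W t y - 1) / (r - 1)"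
    using r1 by (intro divide_right_mono) auto
  thus ?thesis using r1 unfolding eq by (simp add: add_divide_distrib one_majorant_def k_def)
qed

lemma one_sum: assumes r1: "1 < r" and x: "x \<in> space S" shows "(\<Sum>n<N. r ^ n * (Q ^^ n) (\<lambda>_. 1) x) \<le> one_majorant x"
  using r1 by (intro partial_sums_le_supersolution[OF Vb_one_majorant Vb_const] one_majorant_nonneg one_majorant_step x) auto

lemma nu_one_majorant: assumes r1: "1 < r" shows "nu one_majorant \<le> (\<beta>' * \<zeta> / D - 1) / (r - 1)"
proof -
  define k where "k = r * \<beta>' / D"
  have "nu one_majorant = nu (\<lambda>x. inverse (r - 1) * (k * W t x - 1))"
    by (rule nu_cong) (simp add: one_majorant_def k_def divide_inverse mult_ac)
  also have "\<dots> = inverse (r - 1) * (k * nu (W t) - 1)"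
    unfolding nu_cmult[of "inverse (r - 1)"] by (simp add: nu_diff[OF Vb_cmult[OF W_Vb] Vb_const] nu_cmult nu_const)
  also have "k * nu (W t) = \<beta>' / D * (r * nu (W t))" by (simp add: k_def)
  also have "inverse (r - 1) * (\<beta>' / D * (r * nu (W t)) - 1) \<le> inverse (r - 1) * (\<beta>' / D * \<zeta> - 1)"
    using \<zeta> r1 \<beta>'_pos D_pos by (intro mult_left_mono diff_right_mono) auto
  finally show ?thesis by (simp add: divide_inverse mult_ac)
qed

end

context drift_chain
begin

lemma nu_sum_le:
  assumes "\<And>x. x \<in> space S \<Longrightarrow> (\<Sum>n<N. k n * (Q ^^ n) f x) \<le> F x" "f \<in> Vb" "F \<in> Vb"
  shows "(\<Sum>n<N. k n * nu ((Q ^^ n) f)) \<le> nu F"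
proof -
  have "(\<Sum>n<N. k n * nu ((Q ^^ n) f)) = nu (\<lambda>x. \<Sum>n<N. k n * (Q ^^ n) f x)"
    by (subst nu_sum) (auto intro!: Vb_cmult Vb_Qn assms simp: nu_cmult)
  also have "\<dots> \<le> nu F" by (intro nu_mono assms Vb_sum Vb_cmult Vb_Qn)
  finally show ?thesis .
qed

text \<open>
  The probability that no regeneration occurs in the \<open>n\<close> steps after a regeneration.
\<close>
definition survival :: "nat \<Rightarrow> real" where "survival n = nu ((Q ^^ n) (\<lambda>_. 1))"

lemma survival_0: "survival 0 = 1" by (simp add: survival_def nu_const)

lemma survival_nonneg: "0 \<le> survival n"
proof -
  have "nu (\<lambda>_. 0) \<le> nu ((Q ^^ n) (\<lambda>_. 1))"
    by (intro nu_mono Vb_const Vb_Qn Qn_nonneg) auto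
  thus ?thesis by (simp add: survival_def nu_const)
qed

lemma nu_Qn_s: "nu ((Q ^^ n) s) = survival n - survival (Suc n)"
proof -
  have "nu ((Q ^^ n) s) = nu (\<lambda>x. (Q ^^ n) (\<lambda>_. 1) x - (Q ^^ Suc n) (\<lambda>_. 1) x)"
    by (rule nu_cong) (rule Qn_s_telescope)
  also have "\<dots> = survival n - survival (Suc n)" unfolding survival_def by (intro nu_diff Vb_Qn Vb_const)
  finally show ?thesis .
qed

lemma s_nonneg: "0 \<le> s x" using \<beta>'_pos by (simp add: s_def)

lemma survival_dec: "survival (Suc n) \<le> survival n"
proof -
  have "nu (\<lambda>_. 0) \<le> nu ((Q ^^ n) s)"
    by (intro nu_mono Vb_const Vb_Qn Vb_s Qn_nonneg s_nonneg) auto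
  thus ?thesis by (simp add: nu_Qn_s nu_const)
qed

lemma renewal_tail_survival:
  assumes R: "1 < R" and le: "\<And>N. (\<Sum>n<N. survival n * R ^ n) \<le> B"
  shows "renewal_tail survival R B \<beta>"
proof
  show "\<beta> \<le> survival 0 - survival 1" using nu_Qn_s[of 0] nu_s \<beta>_le by simp
  have nn: "0 \<le> survival n * R ^ n" for n using survival_nonneg R by simp
  show sm: "summable (\<lambda>n. survival n * R ^ n)"
    by (rule bounded_imp_summable[where B = B]) (use nn le[of "Suc _"] in \<open>auto simp flip: lessThan_Suc_atMost simp del: sum.lessThan_Suc\<close>)
  show "(\<Sum>n. survival n * R ^ n) \<le> B" by (rule suminf_le_const[OF sm le])
qed (use survival_dec survival_nonneg survival_0 R \<beta>_pos in auto)

end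

text \<open>
  Rates \<open>r\<close> below \<open>1 / lam\<close>, for which \<open>V\<close> itself may be summed along an excursion; \<open>kap\<close> bounds the
  part of the mean of \<open>V\<close> after a step from \<open>C\<close> that comes from steps without regeneration.
\<close>
locale excursion = weight +
  fixes kap :: real
  assumes rl: "r * lam < 1" and kap: "\<And>x. x \<in> C \<Longrightarrow> Q V x \<le> kap"
begin

text \<open>
  \<open>th\<close> is the geometric series of the drift factor \<open>r lam\<close>. \<open>cc\<close> bounds the discounted sum of \<open>V\<close> from
  the time after a visit to \<open>C\<close> up to the next regeneration: the contribution of one return to \<open>C\<close>, divided by \<open>D\<close> to account for further returns.
\<close>
definition th where "th = 1 / (1 - r * lam)"
definition cc where "cc = r * th * (kap - r * lam * (1 - \<beta>')) / D"

lemma th_ge: "1 \<le> th" and th_eq: "th * (1 - r * lam) = 1" and th_eq2: "th - 1 = r * lam * th"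
proof -
  have "0 < r * lam" using r_ge_1 lam by simp
  thus "1 \<le> th" using rl by (simp add: th_def)
  show "th * (1 - r * lam) = 1" using rl by (simp add: th_def)
  thus "th - 1 = r * lam * th" by (simp add: algebra_simps)
qed

lemma kap_ge: "1 - \<beta>' \<le> kap"
proof -
  obtain a where a: "a \<in> C" by (rule C_nonempty)
  have as: "a \<in> space S" using a by (rule C_sub)
  have "1 - \<beta>' = Q (\<lambda>_. 1) a" using Q_const[OF as, of 1] a by (simp add: s_def)
  also have "\<dots> \<le> Q V a" by (intro Q_mono as Vb_const Vb_V V_ge)
  finally show ?thesis using kap[OF a] by simp
qed

lemma cc_nonneg: "0 \<le> cc"
proof -
  have "r * lam * (1 - \<beta>') \<le> 1 * (1 - \<beta>')" using rl \<beta>'_le_1 by (intro mult_right_mono) auto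
  hence "0 \<le> kap - r * lam * (1 - \<beta>')" using kap_ge by simp
  thus ?thesis using r_ge_1 th_ge D_pos by (simp add: cc_def)
qed

lemma cc_eq: "r * (th * kap - (th - 1) * (1 - \<beta>')) + cc * \<eta> = cc"
proof -
  have "cc * D = r * th * (kap - r * lam * (1 - \<beta>'))" using D_pos by (simp add: cc_def)
  moreover have "r * ((th - 1) * (1 - \<beta>')) = r * (r * lam * th * (1 - \<beta>'))" by (simp only: th_eq2)
  ultimately show ?thesis by (simp add: D_def algebra_simps)
qed

text \<open>
  The general form of the supersolutions: an affine combination of \<open>V\<close> and \<open>W t\<close>, lowered on \<open>C\<close>, where \<open>V\<close> need
  not be bounded. The constant \<open>d\<close> recovers the term \<open>r lam\<close> in the numerators of the final constants: it
  stands for the value, at least \<open>1\<close>, of \<open>V\<close> when \<open>C\<close> is reached.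
\<close>
definition majorant where "majorant a b d e x = a * V x + b * W t x - d - e * (indicator C x * (V x - 1))"

lemma majorant_in: "x \<in> C \<Longrightarrow> majorant a b d e x = a * V x + b - d - e * (V x - 1)" by (simp add: majorant_def W_in)
lemma majorant_out: "x \<notin> C \<Longrightarrow> majorant a b d e x = a * V x + b * W t x - d" by (simp add: majorant_def)

lemma Vb_majorant: "majorant a b d e \<in> Vb" unfolding majorant_def[abs_def] by (intro Vb_intros W_Vb Vb_C_excess)

lemma majorant_le: "0 \<le> e \<Longrightarrow> x \<in> space S \<Longrightarrow> majorant a b d e x \<le> a * V x + b * W t x - d"
  using V_ge by (auto simp: majorant_def indicator_def)

lemma affine_eqs:
  shows "x \<in> space S \<Longrightarrow> Q (\<lambda>x. a * V x + b * W t x - d) x = a * Q V x + b * Q (W t) x - d * (1 - s x)"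
    and "nu (\<lambda>x. a * V x + b * W t x - d) = a * nu V + b * nu (W t) - d"
  using Q_diff[of x "\<lambda>x. a * V x + b * W t x" "\<lambda>_. d"] Q_add[of x "\<lambda>x. a * V x" "\<lambda>x. b * W t x"]
    nu_diff[of "\<lambda>x. a * V x + b * W t x" "\<lambda>_. d"] nu_add[of "\<lambda>x. a * V x" "\<lambda>x. b * W t x"]
  by (simp_all add: Vb_add Vb_cmult Vb_V W_Vb Vb_const Q_cmult nu_cmult Q_const nu_const)

lemma Q_majorant_out:
  assumes ab: "0 \<le> a" "0 \<le> b" "0 \<le> e" and x: "x \<in> space S" "x \<notin> C"
  shows "r * Q (majorant a b d e) x \<le> r * lam * a * V x + b * W t x - r * d"
proof -
  have "Q (majorant a b d e) x \<le> Q (\<lambda>x. a * V x + b * W t x - d) x"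
    by (intro Q_mono x Vb_majorant majorant_le ab) (intro Vb_intros W_Vb)
  also have "\<dots> = a * Q V x + b * Q (W t) x - d" using affine_eqs(1)[OF x(1)] x by (simp add: s_def)
  finally have "r * Q (majorant a b d e) x \<le> r * (a * Q V x + b * Q (W t) x - d)"
    using r_ge_1 by (intro mult_left_mono) auto
  also have "\<dots> = r * a * Q V x + b * (r * Q (W t) x) - r * d" by (simp add: algebra_simps)
  also have "\<dots> \<le> r * a * (lam * V x) + b * W t x - r * d"
    using PV_out[of x] rPW[OF x] x ab r_ge_1
    by (intro diff_right_mono add_mono mult_left_mono) (auto simp: Q_out markov_op_def)
  finally show ?thesis by (simp add: mult_ac)
qed

lemma Q_majorant_in:
  assumes ab: "0 \<le> a" "0 \<le> b" "0 \<le> e" and x: "x \<in> C"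
  shows "r * Q (majorant a b d e) x \<le> r * (a * kap - d * (1 - \<beta>')) + b * \<eta>"
proof -
  have xs: "x \<in> space S" using x by (rule C_sub)
  have "Q (majorant a b d e) x \<le> Q (\<lambda>x. a * V x + b * W t x - d) x"
    by (intro Q_mono xs Vb_majorant majorant_le ab) (intro Vb_intros W_Vb)
  also have "\<dots> = a * Q V x + b * Q (W t) x - d * (1 - \<beta>')" using affine_eqs(1)[OF xs] x by (simp add: s_def)
  finally have "r * Q (majorant a b d e) x \<le> r * (a * Q V x + b * Q (W t) x - d * (1 - \<beta>'))"
    using r_ge_1 by (intro mult_left_mono) auto
  also have "\<dots> = r * (a * Q V x - d * (1 - \<beta>')) + b * (r * Q (W t) x)" by (simp add: algebra_simps)
  also have "\<dots> \<le> r * (a * kap - d * (1 - \<beta>')) + b * \<eta>"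
    using kap[OF x] \<eta>[OF x] ab r_ge_1
    by (intro add_mono diff_right_mono mult_left_mono) auto
  finally show ?thesis .
qed

lemma nu_majorant:
  assumes ab: "0 \<le> a" "0 \<le> b" "0 \<le> e"
  shows "r * nu (majorant a b d e) \<le> r * (a * nu V - d) + b * \<zeta>"
proof -
  have "nu (majorant a b d e) \<le> nu (\<lambda>x. a * V x + b * W t x - d)"
    by (intro nu_mono Vb_majorant majorant_le ab) (intro Vb_intros W_Vb)
  hence "r * nu (majorant a b d e) \<le> r * (a * nu V + b * nu (W t) - d)"
    using affine_eqs(2) r_ge_1 by (intro mult_left_mono) auto
  also have "\<dots> = r * (a * nu V - d) + b * (r * nu (W t))" by (simp add: algebra_simps)
  also have "\<dots> \<le> r * (a * nu V - d) + b * \<zeta>" using \<zeta> ab by (intro add_left_mono mult_left_mono)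
  finally show ?thesis .
qed

text \<open>
  On \<open>C\<close> this is \<open>V + cc\<close> (\<open>e = th - 1\<close> removes the surplus of \<open>V\<close>), and outside \<open>C\<close> it is
  \<open>V + (th - 1) (V - 1) + cc W\<close>: the sum up to the first visit to \<open>C\<close>, and what follows it.
\<close>
definition V_majorant where "V_majorant = majorant th cc (th - 1) (th - 1)"

lemma Vb_V_majorant: "V_majorant \<in> Vb" unfolding V_majorant_def by (rule Vb_majorant)

lemma V_majorant_in: "x \<in> C \<Longrightarrow> V_majorant x = V x + cc" by (simp add: V_majorant_def majorant_in algebra_simps)
lemma V_majorant_out: "x \<notin> C \<Longrightarrow> V_majorant x = th * V x + cc * W t x - (th - 1)" by (simp add: V_majorant_def majorant_out)

lemma V_majorant_ge: assumes x: "x \<in> space S" shows "V x \<le> V_majorant x"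
proof (cases "x \<in> C")
  case True thus ?thesis using cc_nonneg by (simp add: V_majorant_in)
next
  case False
  have "(th - 1) * 1 \<le> (th - 1) * V x" using th_ge V_ge[OF x] by (intro mult_left_mono) auto
  moreover have "0 \<le> cc * W t x" using cc_nonneg W_ge[OF x] by simp
  ultimately show ?thesis using False by (simp add: V_majorant_out algebra_simps)
qed

lemma V_majorant_step: assumes x: "x \<in> space S" shows "V x + r * Q V_majorant x \<le> V_majorant x"
proof (cases "x \<in> C")
  case True
  have "r * Q V_majorant x \<le> r * (th * kap - (th - 1) * (1 - \<beta>')) + cc * \<eta>"
    unfolding V_majorant_def using th_ge cc_nonneg by (intro Q_majorant_in True) auto
  thus ?thesis using cc_eq True by (simp add: V_majorant_in)
next
  case False
  have "r * Q V_majorant x \<le> r * lam * th * V x + cc * W t x - r * (th - 1)"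
    unfolding V_majorant_def using th_ge cc_nonneg by (intro Q_majorant_out x False) auto
  moreover have "1 * (th - 1) \<le> r * (th - 1)" using r_ge_1 th_ge by (intro mult_right_mono) auto
  moreover have "V x + r * lam * th * V x = th * V x"
  proof -
    have "V x + r * lam * th * V x = (1 + r * lam * th) * V x" by (simp add: algebra_simps)
    also have "1 + r * lam * th = th" using th_eq2 by simp
    finally show ?thesis .
  qed
  ultimately show ?thesis using False by (simp add: V_majorant_out)
qed

lemma V_sum: assumes x: "x \<in> space S" shows "(\<Sum>n<N. r ^ n * (Q ^^ n) V x) \<le> V_majorant x"
proof (rule partial_sums_le_supersolution[OF Vb_V_majorant Vb_V _ _ V_majorant_step x])
  show "0 \<le> V_majorant y" if "y \<in> space S" for y using V_majorant_ge[OF that] V_ge[OF that] by simp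
qed (use r_ge_1 in auto)

text \<open>
  A bound for \<open>\<Sum>n. r\<^sup>n\<^sup>+\<^sup>1 \<nu> Q\<^sup>n V\<close>, the discounted sum of \<open>V\<close> between two regenerations.
\<close>
definition V_bound where "V_bound = r * th * (nu V - r * lam) + cc * \<zeta>"

lemma nu_V_majorant: "r * nu V_majorant \<le> V_bound"
proof -
  have "r * nu V_majorant \<le> r * (th * nu V - (th - 1)) + cc * \<zeta>"
    unfolding V_majorant_def using th_ge cc_nonneg by (intro nu_majorant) auto
  also have "r * (th * nu V - (th - 1)) = r * th * (nu V - r * lam)" unfolding th_eq2 by (simp add: algebra_simps)
  finally show ?thesis by (simp add: V_bound_def)
qed

end

text \<open>
  The weights \<open>(r\<^sup>n - 1) / (r - 1)\<close> on \<open>V\<close> measure how fast the discounted sums move away from the undiscounted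
  ones. Since \<open>(r\<^sup>n\<^sup>+\<^sup>1 - 1) / (r - 1) = r (r\<^sup>n - 1) / (r - 1) + 1\<close>, their sum \<open>Z\<close> solves
  \<open>Z = r Q Z + (\<Sum>n. Q\<^sup>n\<^sup>+\<^sup>1 V)\<close>, so it is bounded by a supersolution whose source is the undiscounted
  majorant, the case \<open>r = 1\<close>, \<open>t = 0\<close> of the construction (prefix \<open>one\<close>).
\<close>
locale excursion1 = excursion +
  assumes r1: "1 < r"
begin

sublocale one: excursion S P C \<nu> V \<beta> \<beta>' lam K 0 1 "1 - \<beta>'" 1 kap
proof
  show "1 = lam powr (- 0)" using lam by simp
  have W1: "Q (W 0) x = 1 - s x" if "x \<in> space S" for x
    using Q_const[OF that, of 1] Q_cong[OF that, of "W 0" "\<lambda>_. 1"] W_0 by simp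
  show "1 * Q (W 0) x \<le> 1 - \<beta>'" if "x \<in> C" for x using W1[OF C_sub[OF that]] that by (simp add: s_def)
  show "1 - \<beta>' < 1" using \<beta>'_pos by simp
  have "nu (W 0) = nu (\<lambda>_. 1)" by (rule nu_cong) (rule W_0)
  thus "1 * nu (W 0) \<le> 1" by (simp add: nu_const)
qed (use lam kap in auto)

lemma one_D: "one.D = \<beta>'" by (simp add: one.D_def)

text \<open>
  Coefficients of the supersolution whose source is \<open>(one.th - 1) (V - 1)\<close> outside \<open>C\<close> and \<open>0\<close> on \<open>C\<close>: \<open>aa\<close> solves
  \<open>aa (1 - r lam) = one.th - 1\<close>, and \<open>cc'\<close> plays the role of \<open>cc\<close>.
\<close>
definition aa where "aa = (one.th - 1) * th"
definition cc' where "cc' = r * aa * (kap - (1 - \<beta>')) / D"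

lemma aa_nonneg: "0 \<le> aa" using one.th_ge th_ge by (simp add: aa_def)
lemma cc'_nonneg: "0 \<le> cc'" using aa_nonneg r1 kap_ge D_pos by (simp add: cc'_def)

text \<open>
  The source \<open>one.V_majorant - V\<close> is the sum of the source of the first part and the constant \<open>one.cc\<close>, for which a
  multiple of \<open>one_majorant\<close> is used.
\<close>
definition kV_majorant where "kV_majorant x = majorant aa cc' aa aa x + one.cc * one_majorant x"

lemma Vb_kV_majorant: "kV_majorant \<in> Vb" unfolding kV_majorant_def[abs_def] by (intro Vb_add Vb_cmult Vb_majorant Vb_one_majorant)

lemma kV_majorant_nonneg: assumes x: "x \<in> space S" shows "0 \<le> kV_majorant x"
proof -
  have "0 \<le> aa * (V x - 1)" "0 \<le> cc' * W t x" using aa_nonneg cc'_nonneg V_ge[OF x] W_ge[OF x] by auto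
  hence "0 \<le> majorant aa cc' aa aa x"
    using cc'_nonneg by (cases "x \<in> C") (simp_all add: majorant_in majorant_out algebra_simps)
  moreover have "0 \<le> one.cc * one_majorant x" using one.cc_nonneg one_majorant_nonneg[OF r1 x] by simp
  ultimately show ?thesis by (simp add: kV_majorant_def)
qed

lemma kV_majorant_step: assumes x: "x \<in> space S" shows "(one.V_majorant x - V x) + r * Q kV_majorant x \<le> kV_majorant x"
proof -
  have Q: "r * Q kV_majorant x = r * Q (majorant aa cc' aa aa) x + one.cc * (r * Q one_majorant x)"
  proof -
    have "Q kV_majorant x = Q (majorant aa cc' aa aa) x + Q (\<lambda>x. one.cc * one_majorant x) x"
      unfolding kV_majorant_def[abs_def] by (rule Q_add[OF x Vb_majorant Vb_cmult[OF Vb_one_majorant]])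
    also have "Q (\<lambda>x. one.cc * one_majorant x) x = one.cc * Q one_majorant x" by (rule Q_cmult)
    finally show ?thesis by (simp add: distrib_left)
  qed
  have "one.cc * (1 + r * Q one_majorant x) \<le> one.cc * one_majorant x"
    using one.cc_nonneg one_majorant_step[OF r1 x] by (intro mult_left_mono)
  moreover have "(one.V_majorant x - V x - one.cc) + r * Q (majorant aa cc' aa aa) x \<le> majorant aa cc' aa aa x"
  proof (cases "x \<in> C")
    case True
    have "r * Q (majorant aa cc' aa aa) x \<le> r * (aa * kap - aa * (1 - \<beta>')) + cc' * \<eta>"
      using aa_nonneg cc'_nonneg by (intro Q_majorant_in True)
    moreover have "cc' * D = r * aa * (kap - (1 - \<beta>'))" using D_pos by (simp add: cc'_def)
    ultimately show ?thesis using True by (simp add: one.V_majorant_in majorant_in D_def algebra_simps)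
  next
    case False
    have "r * Q (majorant aa cc' aa aa) x \<le> r * lam * aa * V x + cc' * W t x - r * aa"
      using aa_nonneg cc'_nonneg by (intro Q_majorant_out x False)
    moreover have "1 * aa \<le> r * aa" using r1 aa_nonneg by (intro mult_right_mono) auto
    moreover have "aa - r * lam * aa = one.th - 1"
    proof -
      have "aa - r * lam * aa = (one.th - 1) * (th * (1 - r * lam))" by (simp add: aa_def algebra_simps)
      thus ?thesis using th_eq by simp
    qed
    hence "(aa - r * lam * aa) * V x = (one.th - 1) * V x" by simp
    moreover have "one.V_majorant x = one.th * V x + one.cc - (one.th - 1)" using False x by (simp add: one.V_majorant_out W_0)
    moreover have "0 \<le> one.th - 1" using one.th_ge by simp
    ultimately show ?thesis using False by (simp add: majorant_out algebra_simps)
  qed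
  ultimately show ?thesis unfolding Q by (simp add: kV_majorant_def algebra_simps)
qed

definition geom_sum :: "nat \<Rightarrow> real" where "geom_sum n = (r ^ n - 1) / (r - 1)"

lemma geom_sum_0: "geom_sum 0 = 0" by (simp add: geom_sum_def)
lemma geom_sum_Suc: "geom_sum (Suc n) = r * geom_sum n + 1" using r1 by (simp add: geom_sum_def field_simps)
lemma geom_sum_nonneg: "0 \<le> geom_sum n" using r1 by (simp add: geom_sum_def)

lemma kV_sum: "x \<in> space S \<Longrightarrow> (\<Sum>n<N. geom_sum n * (Q ^^ n) V x) \<le> kV_majorant x"
proof (induction N arbitrary: x)
  case 0 thus ?case using kV_majorant_nonneg by simp
next
  case (Suc N)
  note x = Suc.prems
  have m: "\<And>n. (\<lambda>x. geom_sum n * (Q ^^ n) V x) \<in> Vb" by (intro Vb_cmult Vb_Qn Vb_V)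
  have "(\<Sum>n<Suc N. geom_sum n * (Q ^^ n) V x) = (\<Sum>n<N. (Q ^^ Suc n) V x) + r * (\<Sum>n<N. geom_sum n * (Q ^^ Suc n) V x)"
    unfolding sum.lessThan_Suc_shift by (simp add: geom_sum_0 geom_sum_Suc sum_distrib_left sum.distrib algebra_simps)
  also have "(\<Sum>n<N. geom_sum n * (Q ^^ Suc n) V x) = Q (\<lambda>x. \<Sum>n<N. geom_sum n * (Q ^^ n) V x) x"
    using m x by (simp add: Q_sum Q_cmult)
  also have "\<dots> \<le> Q kV_majorant x" using Suc.IH by (intro Q_mono x Vb_sum m Vb_kV_majorant)
  also have "(\<Sum>n<N. (Q ^^ Suc n) V x) \<le> one.V_majorant x - V x"
    using one.V_sum[OF x, of "Suc N"] unfolding sum.lessThan_Suc_shift by simp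
  finally have "(\<Sum>n<Suc N. geom_sum n * (Q ^^ n) V x) \<le> (one.V_majorant x - V x) + r * Q kV_majorant x" using r1 by simp
  thus ?case using kV_majorant_step[OF x] by simp
qed

definition kV_bound where "kV_bound = r * aa * (nu V - 1) + cc' * \<zeta> + one.cc * (r * (\<beta>' * \<zeta> / D - 1) / (r - 1))"

lemma nu_kV_majorant: "r * nu kV_majorant \<le> kV_bound"
proof -
  have "r * nu kV_majorant = r * nu (majorant aa cc' aa aa) + one.cc * (r * nu one_majorant)"
  proof -
    have "nu kV_majorant = nu (majorant aa cc' aa aa) + nu (\<lambda>x. one.cc * one_majorant x)"
      unfolding kV_majorant_def[abs_def] by (rule nu_add[OF Vb_majorant Vb_cmult[OF Vb_one_majorant]])
    also have "nu (\<lambda>x. one.cc * one_majorant x) = one.cc * nu one_majorant" by (rule nu_cmult)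
    finally show ?thesis by (simp add: distrib_left)
  qed
  also have "r * nu (majorant aa cc' aa aa) \<le> r * (aa * nu V - aa) + cc' * \<zeta>"
    using aa_nonneg cc'_nonneg by (intro nu_majorant)
  also have "r * (aa * nu V - aa) = r * aa * (nu V - 1)" by (simp add: algebra_simps)
  also have "one.cc * (r * nu one_majorant) \<le> one.cc * (r * ((\<beta>' * \<zeta> / D - 1) / (r - 1)))"
    using one.cc_nonneg nu_one_majorant[OF r1] r1 by (intro mult_left_mono) auto
  finally show ?thesis by (simp add: kV_bound_def)
qed

end

section \<open>From excursions to the rate of convergence\<close>

lemma fps_one_minus_X_nth: "fps_nth ((1 - fps_X) * f) n = fps_nth f n - (if n = 0 then 0 else fps_nth f (n - 1))"
  for f :: "real fps" by (simp add: left_diff_distrib fps_X_mult_nth)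

lemma fps_tail:
  fixes v :: "nat \<Rightarrow> real"
  assumes "summable v"
  shows "Abs_fps v = fps_const (suminf v) - (1 - fps_X) * Abs_fps (\<lambda>k. \<Sum>n. v (n + Suc k))"
proof (rule fps_ext)
  fix n
  show "fps_nth (Abs_fps v) n = fps_nth (fps_const (suminf v) - (1 - fps_X) * Abs_fps (\<lambda>k. \<Sum>n. v (n + Suc k))) n"
  proof (cases n)
    case 0
    thus ?thesis using suminf_split_head[OF assms] by (simp add: fps_one_minus_X_nth)
  next
    case (Suc m)
    have "(\<Sum>k. v (Suc k + Suc m)) = (\<Sum>k. v (k + Suc m)) - v (0 + Suc m)"
      by (rule suminf_split_head[of "\<lambda>k. v (k + Suc m)"]) (rule summable_ignore_initial_segment[OF assms])
    thus ?thesis using Suc by (simp add: fps_one_minus_X_nth)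
  qed
qed

context drift_chain
begin

text \<open>
  The limit of \<open>P\<^sup>n g\<close>: the expected sum of \<open>g\<close> over one regeneration cycle divided by the expected length of the cycle.
\<close>
definition ell :: "('a \<Rightarrow> real) \<Rightarrow> real" where "ell g = (\<Sum>n. nu ((Q ^^ n) g)) / (\<Sum>n. survival n)"

text \<open>
  The conclusion of the theorem for a single rate \<open>\<gamma>\<close>, with the limit in place of the stationary integral.
\<close>
definition geo_bound :: "real \<Rightarrow> real \<Rightarrow> bool" where
  "geo_bound m \<gamma> \<longleftrightarrow> (\<forall>g x n. g \<in> borel_measurable S \<longrightarrow> (\<forall>y\<in>space S. \<bar>g y\<bar> \<le> V y) \<longrightarrow> x \<in> space S \<longrightarrow>
     \<bar>Pn n g x - ell g\<bar> \<le> m * V x * \<gamma> ^ n)"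

text \<open>
  The renewal sequence minus its limit.
\<close>
definition deviation_fps :: "real fps" where
  "deviation_fps = Abs_fps (\<lambda>k. \<Sum>n. survival (n + Suc k)) * inverse (Abs_fps survival) * fps_const (1 / (\<Sum>n. survival n))"

lemma Pn_fps:
  assumes g: "g \<in> Vb" and x: "x \<in> space S"
  shows "Abs_fps (\<lambda>n. Pn n g x) = Abs_fps (\<lambda>n. (Q ^^ n) g x) + fps_X * Abs_fps (\<lambda>n. (Q ^^ n) s x) * Abs_fps (p_seq g)"
proof (rule fps_ext)
  fix n
  have "(\<Sum>i<n. (Q ^^ i) s x * p_seq g (n - 1 - i)) = fps_nth (fps_X * (Abs_fps (\<lambda>n. (Q ^^ n) s x) * Abs_fps (p_seq g))) n"
  proof (cases n)
    case (Suc m)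
    thus ?thesis unfolding fps_X_mult_nth by (simp add: fps_mult_nth atLeast0AtMost lessThan_Suc_atMost)
  qed simp
  thus "fps_nth (Abs_fps (\<lambda>n. Pn n g x)) n = fps_nth (Abs_fps (\<lambda>n. (Q ^^ n) g x) + fps_X * Abs_fps (\<lambda>n. (Q ^^ n) s x) * Abs_fps (p_seq g)) n"
    using Pn_decomp[OF g x, of n] by (simp add: mult.assoc)
qed

lemma S_fps: assumes x: "x \<in> space S"
  shows "Abs_fps (\<lambda>n. (Q ^^ n) s x) = 1 - (1 - fps_X) * Abs_fps (\<lambda>n. (Q ^^ Suc n) (\<lambda>_. 1) x)"
proof (rule fps_ext)
  fix n
  show "fps_nth (Abs_fps (\<lambda>n. (Q ^^ n) s x)) n = fps_nth (1 - (1 - fps_X) * Abs_fps (\<lambda>n. (Q ^^ Suc n) (\<lambda>_. 1) x)) n"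
    using Qn_s_telescope[OF x, of n] by (cases n) (simp_all add: fps_one_minus_X_nth)
qed

lemma p_fps: assumes g: "g \<in> Vb"
  shows "(1 - fps_X) * Abs_fps survival * Abs_fps (p_seq g) = Abs_fps (\<lambda>n. nu ((Q ^^ n) g))"
proof -
  have 1: "Abs_fps (p_seq g) = Abs_fps (\<lambda>n. nu ((Q ^^ n) g)) + fps_X * (Abs_fps (\<lambda>n. nu ((Q ^^ n) s)) * Abs_fps (p_seq g))"
  proof (rule fps_ext)
    fix n
    have "(\<Sum>i<n. nu ((Q ^^ i) s) * p_seq g (n - 1 - i)) = fps_nth (fps_X * (Abs_fps (\<lambda>n. nu ((Q ^^ n) s)) * Abs_fps (p_seq g))) n"
    proof (cases n)
      case (Suc m)
      thus ?thesis unfolding fps_X_mult_nth by (simp add: fps_mult_nth atLeast0AtMost lessThan_Suc_atMost)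
    qed simp
    thus "fps_nth (Abs_fps (p_seq g)) n = fps_nth (Abs_fps (\<lambda>n. nu ((Q ^^ n) g)) + fps_X * (Abs_fps (\<lambda>n. nu ((Q ^^ n) s)) * Abs_fps (p_seq g))) n"
      using p_decomp[OF g, of n] by simp
  qed
  have 2: "fps_X * Abs_fps (\<lambda>n. nu ((Q ^^ n) s)) = 1 - (1 - fps_X) * Abs_fps survival"
  proof (rule fps_ext)
    fix n
    show "fps_nth (fps_X * Abs_fps (\<lambda>n. nu ((Q ^^ n) s))) n = fps_nth (1 - (1 - fps_X) * Abs_fps survival) n"
      by (cases n) (simp_all add: fps_one_minus_X_nth fps_X_mult_nth nu_Qn_s survival_0)
  qed
  have "Abs_fps (p_seq g) = Abs_fps (\<lambda>n. nu ((Q ^^ n) g)) + (1 - (1 - fps_X) * Abs_fps survival) * Abs_fps (p_seq g)"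
    using 1 unfolding mult.assoc[symmetric] 2 .
  thus ?thesis by (simp add: algebra_simps)
qed

lemma deviation_fps_eq:
  assumes u: "(\<Sum>n. survival n) \<noteq> 0"
  shows "deviation_fps * Abs_fps survival * fps_const (\<Sum>n. survival n) = Abs_fps (\<lambda>k. \<Sum>n. survival (n + Suc k))"
proof -
  have c0: "fps_nth (Abs_fps survival) 0 \<noteq> 0" by (simp add: survival_0)
  have "deviation_fps * Abs_fps survival * fps_const (\<Sum>n. survival n) = Abs_fps (\<lambda>k. \<Sum>n. survival (n + Suc k)) * (inverse (Abs_fps survival) * Abs_fps survival) * (fps_const (1 / (\<Sum>n. survival n)) * fps_const (\<Sum>n. survival n))"
  proof -
    have "E * I * k * F * U = E * (I * F) * (k * U)" for E I k F U :: "real fps" by (simp only: mult_ac)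
    thus ?thesis unfolding deviation_fps_def .
  qed
  also have "inverse (Abs_fps survival) * Abs_fps survival = 1" by (rule inverse_mult_eq_1[OF c0])
  also have "fps_const (1 / (\<Sum>n. survival n)) * fps_const (\<Sum>n. survival n) = 1" using u by (simp flip: fps_const_1_eq_1)
  finally show ?thesis by simp
qed

lemma geometric_decomposition:
  assumes g: "g \<in> Vb" and x: "x \<in> space S"
    and sc: "summable survival" and sv: "summable (\<lambda>n. nu ((Q ^^ n) g))" and u: "(\<Sum>n. survival n) \<noteq> 0"
  defines "v \<equiv> Abs_fps (\<lambda>n. nu ((Q ^^ n) g))"
  shows "Pn (Suc m) g x - ell g = (Q ^^ Suc m) g x
     + fps_nth (Abs_fps (\<lambda>n. (Q ^^ n) s x) * (v * deviation_fps)) m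
     - (1 / (\<Sum>n. survival n)) * (fps_nth (Abs_fps (\<lambda>n. (Q ^^ Suc n) (\<lambda>_. 1) x) * v) m + (\<Sum>n. nu ((Q ^^ (n + Suc m)) g)))"
proof -
  have J: "Abs_fps (\<lambda>_. 1) * (1 - fps_X) = (1 :: real fps)"
    by (rule fps_ext) (simp add: mult.commute[of "Abs_fps (\<lambda>_. 1)"] fps_one_minus_X_nth)
  have c0: "fps_nth (Abs_fps survival) 0 \<noteq> 0" by (simp add: survival_0)
  note d = deviation_fps_eq[OF u]
  have cn: "Abs_fps survival \<noteq> 0" using c0 by (metis fps_zero_nth)
  note main = fps_decomposition[OF S_fps[OF x] Pn_fps[OF g x] p_fps[OF g] fps_tail[OF sv] fps_tail[OF sc] u d J cn]
  from arg_cong[OF main, of "\<lambda>f. fps_nth f (Suc m)"]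
  show ?thesis by (simp add: fps_X_mult_nth ell_def v_def)
qed

lemma nu_abs_le:
  assumes g: "g \<in> Vb" "\<And>y. y \<in> space S \<Longrightarrow> \<bar>g y\<bar> \<le> V y"
  shows "\<bar>nu ((Q ^^ n) g)\<bar> \<le> nu ((Q ^^ n) V)"
proof -
  have ab: "\<And>y. y \<in> space S \<Longrightarrow> \<bar>(Q ^^ n) g y\<bar> \<le> (Q ^^ n) V y" using Qn_abs[OF g(1) Vb_V g(2)] .
  have "nu ((Q ^^ n) g) \<le> nu ((Q ^^ n) V)"
    using ab by (intro nu_mono Vb_Qn g Vb_V) (auto simp: abs_le_iff)
  moreover have "nu (\<lambda>x. (-1) * (Q ^^ n) g x) \<le> nu ((Q ^^ n) V)"
    using ab by (intro nu_mono Vb_cmult Vb_Qn g Vb_V) (auto simp: abs_le_iff)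
  ultimately show ?thesis unfolding nu_cmult by simp
qed

end

context excursion1
begin

lemma geom_sum_ge: "r ^ n \<le> geom_sum (Suc n)"
proof (induction n)
  case 0 thus ?case using r1 by (simp add: geom_sum_def)
next
  case (Suc n)
  have "r * r ^ n \<le> r * geom_sum (Suc n)" using Suc r1 by (intro mult_left_mono) auto
  thus ?case using geom_sum_Suc[of "Suc n"] by simp
qed

lemma V_sum_nu: "(\<Sum>n<N. r ^ n * nu ((Q ^^ n) V)) \<le> V_bound / r"
proof -
  have "(\<Sum>n<N. r ^ n * nu ((Q ^^ n) V)) \<le> nu V_majorant" by (intro nu_sum_le V_sum Vb_V Vb_V_majorant)
  also have "\<dots> \<le> V_bound / r" using nu_V_majorant r1 by (simp add: field_simps)
  finally show ?thesis .
qed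

lemma nu_QnV_nonneg: "0 \<le> nu ((Q ^^ n) V)"
  using nu_abs_le[OF Vb_V, of n] V_ge by (force intro: order_trans[OF abs_ge_zero])

lemma summable_nu_V: "summable (\<lambda>n. nu ((Q ^^ n) V))"
proof (rule bounded_imp_summable[where B = "V_bound / r"])
  fix n
  have "(\<Sum>k\<le>n. nu ((Q ^^ k) V)) \<le> (\<Sum>k<Suc n. r ^ k * nu ((Q ^^ k) V))"
    unfolding lessThan_Suc_atMost
  proof (rule sum_mono)
    fix k
    have "1 * nu ((Q ^^ k) V) \<le> r ^ k * nu ((Q ^^ k) V)"
      using r1 nu_QnV_nonneg by (intro mult_right_mono) auto
    thus "nu ((Q ^^ k) V) \<le> r ^ k * nu ((Q ^^ k) V)" by simp
  qed
  also have "\<dots> \<le> V_bound / r" by (rule V_sum_nu)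
  finally show "(\<Sum>k\<le>n. nu ((Q ^^ k) V)) \<le> V_bound / r" .
qed (rule nu_QnV_nonneg)

text \<open>
  In a product of power series the \<open>m\<close>-th coefficient, multiplied by \<open>r\<^sup>m\<close>, is at most the absolute sum of one factor
  times the largest coefficient of the other, both at radius \<open>r\<close>. Hence the renewal deviations enter only through the bound on their
  coefficients, and all other factors through the sums of nonnegative terms bounded before. The last
  term is \<open>r\<^sup>m\<close> times the tail \<open>\<Sum>n>m. \<nu> Q\<^sup>n g\<close>; it is at most the weighted sum bounded by \<open>kV_bound\<close>, because
  \<open>r\<^sup>m \<le> (r\<^sup>n - 1) / (r - 1)\<close> for \<open>n > m\<close>.
\<close>
lemma coefficient_bound:
  assumes g: "g \<in> borel_measurable S" "\<And>y. y \<in> space S \<Longrightarrow> \<bar>g y\<bar> \<le> V y" and x: "x \<in> space S"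
    and sc: "summable survival" and \<kappa>: "\<And>m. \<bar>fps_nth deviation_fps m\<bar> * r ^ m \<le> \<kappa>"
  shows "\<bar>Pn (Suc m) g x - ell g\<bar> * r ^ Suc m \<le>
    (V_majorant x - V x) + (\<beta>' / D * W t x) * V_bound * \<kappa> + ((\<beta>' / D * W t x - 1) / (r - 1) * V_bound + kV_bound)"
proof -
  have gV: "g \<in> Vb" by (rule Vb_dom[OF g Vb_V])
  note va = nu_abs_le[OF gV g(2)]
  have sv: "summable (\<lambda>n. nu ((Q ^^ n) g))"
    by (rule summable_comparison_test'[OF summable_nu_V, of 0]) (use va in auto)
  define u where "u = (\<Sum>n. survival n)"
  have u: "1 \<le> u"
  proof -
    have "(\<Sum>n<1. survival n) \<le> u" unfolding u_def using sc survival_nonneg by (intro sum_le_suminf) auto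
    thus ?thesis by (simp add: survival_0)
  qed
  define v where "v = Abs_fps (\<lambda>n. nu ((Q ^^ n) g))"
  define SS where "SS = Abs_fps (\<lambda>n. (Q ^^ n) s x)"
  define S' where "S' = Abs_fps (\<lambda>n. (Q ^^ Suc n) (\<lambda>_. 1) x)"
  have dec: "Pn (Suc m) g x - ell g = (Q ^^ Suc m) g x + fps_nth (SS * (v * deviation_fps)) m
     - (1 / u) * (fps_nth (S' * v) m + (\<Sum>n. nu ((Q ^^ (n + Suc m)) g)))"
    using geometric_decomposition[OF gV x sc sv, of m] u unfolding u_def v_def SS_def S'_def by simp
  have r0: "0 \<le> r" "0 < r" using r1 by auto
  have G0: "0 \<le> V_bound / r" using V_sum_nu[of 0] by simp
  have T1: "\<bar>(Q ^^ Suc m) g x\<bar> * r ^ Suc m \<le> V_majorant x - V x"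
  proof -
    have "\<bar>(Q ^^ Suc m) g x\<bar> * r ^ Suc m \<le> (Q ^^ Suc m) V x * r ^ Suc m"
      using Qn_abs[OF gV Vb_V g(2) x, of "Suc m"] r0 by (intro mult_right_mono) auto
    also have "\<dots> = (\<Sum>n\<in>{0, Suc m}. r ^ n * (Q ^^ n) V x) - V x" by (simp add: mult.commute)
    also have "(\<Sum>n\<in>{0, Suc m}. r ^ n * (Q ^^ n) V x) \<le> (\<Sum>n<Suc (Suc m). r ^ n * (Q ^^ n) V x)"
    proof (rule sum_mono2)
      show "0 \<le> r ^ b * (Q ^^ b) V x" for b
        using r0 Qn_nonneg[OF Vb_V _ x] V_ge by (intro mult_nonneg_nonneg) (auto intro: order_trans[OF zero_le_one])
    qed auto
    also have "\<dots> \<le> V_majorant x" by (rule V_sum[OF x])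
    finally show ?thesis by simp
  qed
  have vs: "(\<Sum>i<N. \<bar>fps_nth v i\<bar> * r ^ i) \<le> V_bound / r" for N
  proof -
    have "(\<Sum>i<N. \<bar>fps_nth v i\<bar> * r ^ i) \<le> (\<Sum>i<N. r ^ i * nu ((Q ^^ i) V))"
      using va r0 by (intro sum_mono) (simp add: v_def mult.commute mult_left_mono)
    thus ?thesis using V_sum_nu[of N] by linarith
  qed
  have v1: "\<bar>fps_nth v i\<bar> * r ^ i \<le> V_bound / r" for i
  proof -
    have "(\<Sum>i\<in>{i}. \<bar>fps_nth v i\<bar> * r ^ i) \<le> (\<Sum>i<Suc i. \<bar>fps_nth v i\<bar> * r ^ i)"
      using r0 by (intro sum_mono2) auto
    thus ?thesis using vs[of "Suc i"] by simp
  qed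
  have Ss: "(\<Sum>i<N. \<bar>fps_nth SS i\<bar> * r ^ i) \<le> \<beta>' / D * W t x" for N
  proof -
    have "(Q ^^ i) s x \<ge> 0" for i by (rule Qn_nonneg[OF Vb_s s_nonneg x])
    thus ?thesis using s_sum[OF x, of N] by (simp add: SS_def mult.commute)
  qed
  have S's: "(\<Sum>i<N. \<bar>fps_nth S' i\<bar> * r ^ i) \<le> (\<beta>' / D * W t x - 1) / (r - 1)" for N
  proof -
    have nn: "0 \<le> (Q ^^ i) (\<lambda>_. 1) x" for i by (rule Qn_nonneg[OF Vb_const _ x]) auto
    have "1 + r * (\<Sum>i<N. \<bar>fps_nth S' i\<bar> * r ^ i) = (\<Sum>n<Suc N. r ^ n * (Q ^^ n) (\<lambda>_. 1) x)"
      unfolding sum.lessThan_Suc_shift S'_def using nn[of "Suc _"] by (simp add: sum_distrib_left mult_ac)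
    also have "\<dots> \<le> one_majorant x" by (rule one_sum[OF r1 x])
    finally have "r * (\<Sum>i<N. \<bar>fps_nth S' i\<bar> * r ^ i) \<le> one_majorant x - 1" by simp
    also have "one_majorant x - 1 = r * ((\<beta>' / D * W t x - 1) / (r - 1))"
    proof -
      have "(r * y - 1) / (r - 1) - 1 = r * ((y - 1) / (r - 1))" for y
        using r1 by (simp add: divide_simps) (simp add: algebra_simps)
      from this[of "\<beta>' / D * W t x"] show ?thesis by (simp add: one_majorant_def mult.assoc)
    qed
    finally show ?thesis using r0(2) by (rule mult_left_le_imp_le)
  qed
  have T2: "\<bar>fps_nth (SS * (v * deviation_fps)) m\<bar> * r ^ m \<le> \<beta>' / D * W t x * (V_bound / r * \<kappa>)"
    by (intro fps_mult_bound Ss vs \<kappa> r0)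
  have T3: "\<bar>fps_nth (S' * v) m\<bar> * r ^ m \<le> (\<beta>' / D * W t x - 1) / (r - 1) * (V_bound / r)"
    by (intro fps_mult_bound S's v1 r0)
  have T4: "\<bar>\<Sum>n. nu ((Q ^^ (n + Suc m)) g)\<bar> * r ^ m \<le> kV_bound / r"
  proof -
    have sV: "summable (\<lambda>n. nu ((Q ^^ (n + Suc m)) V))" by (rule summable_ignore_initial_segment[OF summable_nu_V])
    have "\<bar>\<Sum>n. nu ((Q ^^ (n + Suc m)) g)\<bar> \<le> (\<Sum>n. nu ((Q ^^ (n + Suc m)) V))"
      unfolding real_norm_def[symmetric] by (rule norm_suminf_le[OF _ sV]) (simp only: real_norm_def va)
    hence "\<bar>\<Sum>n. nu ((Q ^^ (n + Suc m)) g)\<bar> * r ^ m \<le> (\<Sum>n. nu ((Q ^^ (n + Suc m)) V)) * r ^ m"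
      using r0 by (intro mult_right_mono) auto
    also have "\<dots> = (\<Sum>n. nu ((Q ^^ (n + Suc m)) V) * r ^ m)" by (rule suminf_mult2[OF sV])
    also have "\<dots> \<le> kV_bound / r"
    proof (rule suminf_le_const[OF summable_mult2[OF sV]])
      fix N
      have "(\<Sum>n<N. nu ((Q ^^ (n + Suc m)) V) * r ^ m) \<le> (\<Sum>n<N. geom_sum (n + Suc m) * nu ((Q ^^ (n + Suc m)) V))"
      proof (rule sum_mono)
        fix n
        have "r ^ m \<le> r ^ (n + m)" using r1 by (intro power_increasing) auto
        also have "\<dots> \<le> geom_sum (n + Suc m)" using geom_sum_ge[of "n + m"] by simp
        finally show "nu ((Q ^^ (n + Suc m)) V) * r ^ m \<le> geom_sum (n + Suc m) * nu ((Q ^^ (n + Suc m)) V)"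
          unfolding mult.commute[of _ "r ^ m"] by (rule mult_right_mono[OF _ nu_QnV_nonneg])
      qed
      also have "\<dots> = (\<Sum>j\<in>{Suc m..<N + Suc m}. geom_sum j * nu ((Q ^^ j) V))"
        using sum.shift_bounds_nat_ivl[of "\<lambda>j. geom_sum j * nu ((Q ^^ j) V)" 0 "Suc m" N] by (simp add: atLeast0LessThan)
      also have "\<dots> \<le> (\<Sum>j<N + Suc m. geom_sum j * nu ((Q ^^ j) V))"
        using geom_sum_nonneg nu_QnV_nonneg by (intro sum_mono2 mult_nonneg_nonneg) auto
      also have "\<dots> \<le> nu kV_majorant" by (intro nu_sum_le kV_sum Vb_V Vb_kV_majorant)
      also have "\<dots> \<le> kV_bound / r" using nu_kV_majorant r0 by (simp add: field_simps)
      finally show "(\<Sum>n<N. nu ((Q ^^ (n + Suc m)) V) * r ^ m) \<le> kV_bound / r" .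
    qed
    finally show ?thesis .
  qed
  have iu: "0 \<le> 1 / u" "1 / u \<le> 1" using u by auto
  define a1 where "a1 = \<bar>(Q ^^ Suc m) g x\<bar>"
  define a2 where "a2 = \<bar>fps_nth (SS * (v * deviation_fps)) m\<bar>"
  define a3 where "a3 = \<bar>fps_nth (S' * v) m\<bar>"
  define a4 where "a4 = \<bar>\<Sum>n. nu ((Q ^^ (n + Suc m)) g)\<bar>"
  have "\<bar>(1 / u) * (fps_nth (S' * v) m + (\<Sum>n. nu ((Q ^^ (n + Suc m)) g)))\<bar> \<le> 1 * (a3 + a4)"
    unfolding abs_mult a3_def a4_def using iu by (intro mult_mono abs_triangle_ineq) auto
  hence "\<bar>Pn (Suc m) g x - ell g\<bar> \<le> a1 + a2 + (a3 + a4)"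
    unfolding dec a1_def a2_def
  proof -
    have "\<bar>p + q - w\<bar> \<le> \<bar>p\<bar> + \<bar>q\<bar> + y" if "\<bar>w\<bar> \<le> 1 * y" for p q w y :: real using that by linarith
    thus "\<bar>(1 / u) * (fps_nth (S' * v) m + (\<Sum>n. nu ((Q ^^ (n + Suc m)) g)))\<bar> \<le> 1 * (a3 + a4) \<Longrightarrow>
      \<bar>(Q ^^ Suc m) g x + fps_nth (SS * (v * deviation_fps)) m - (1 / u) * (fps_nth (S' * v) m + (\<Sum>n. nu ((Q ^^ (n + Suc m)) g)))\<bar>
       \<le> \<bar>(Q ^^ Suc m) g x\<bar> + \<bar>fps_nth (SS * (v * deviation_fps)) m\<bar> + (a3 + a4)" .
  qed
  hence "\<bar>Pn (Suc m) g x - ell g\<bar> * r ^ Suc m \<le> (a1 + a2 + (a3 + a4)) * r ^ Suc m"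
    using r0 by (intro mult_right_mono) auto
  also have "\<dots> = a1 * r ^ Suc m + r * (a2 * r ^ m) + r * (a3 * r ^ m) + r * (a4 * r ^ m)"
    by (simp add: algebra_simps)
  also have "\<dots> \<le> (V_majorant x - V x) + r * (\<beta>' / D * W t x * (V_bound / r * \<kappa>)) + r * ((\<beta>' / D * W t x - 1) / (r - 1) * (V_bound / r)) + r * (kV_bound / r)"
    unfolding a1_def a2_def a3_def a4_def by (intro add_mono mult_left_mono T1 T2 T3 T4 r0)
  also have "\<dots> = (V_majorant x - V x) + (\<beta>' / D * W t x) * V_bound * \<kappa> + ((\<beta>' / D * W t x - 1) / (r - 1) * V_bound + kV_bound)"
    using r0 by simp
  finally show ?thesis .
qed

end

section \<open>The stationary measure\<close>

context drift_chain
begin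

lemma Pn_linear:
  assumes f: "f \<in> Vb" and g: "g \<in> Vb" and x: "x \<in> space S"
  shows "Pn n (\<lambda>x. a * f x + b * g x) x = a * Pn n f x + b * Pn n g x"
  using x
proof (induction n arbitrary: x)
  case (Suc n)
  have "Pn (Suc n) (\<lambda>x. a * f x + b * g x) x = markov_op P (\<lambda>x. a * Pn n f x + b * Pn n g x) x"
    using Suc by (simp add: P_cong[OF Suc.prems Suc.IH])
  also have "\<dots> = markov_op P (\<lambda>x. a * Pn n f x) x + markov_op P (\<lambda>x. b * Pn n g x) x"
    by (intro P_add Suc.prems Vb_cmult Vb_Pn f g)
  finally show ?case by (simp add: P_cmult)
qed simp

lemma Pn_mono:
  assumes f: "f \<in> Vb" and g: "g \<in> Vb" "\<And>x. x \<in> space S \<Longrightarrow> f x \<le> g x" and x: "x \<in> space S"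
  shows "Pn n f x \<le> Pn n g x"
  using x by (induction n arbitrary: x) (auto intro!: P_mono Vb_Pn f g)

lemma Pn_const: "x \<in> space S \<Longrightarrow> Pn n (\<lambda>_. a) x = a"
proof (induction n arbitrary: x)
  case (Suc n)
  thus ?case using P_cong[OF Suc.prems Suc.IH] by (simp add: P_const)
qed simp

lemma Pn_tendsto_0:
  assumes f: "\<And>i. f i \<in> borel_measurable S" "\<And>i x. x \<in> space S \<Longrightarrow> \<bar>f i x\<bar> \<le> V x"
    and lim: "\<And>x. x \<in> space S \<Longrightarrow> (\<lambda>i. f i x) \<longlonglongrightarrow> 0" and x: "x \<in> space S"
  shows "(\<lambda>i. Pn n (f i) x) \<longlonglongrightarrow> 0"
  using x
proof (induction n arbitrary: x)
  case 0 thus ?case using lim by simp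
next
  case (Suc n)
  note x = Suc.prems
  have fV: "f i \<in> Vb" for i by (rule Vb_dom[OF f Vb_V])
  have b: "\<bar>Pn n (f i) y\<bar> \<le> Pn n V y" if "y \<in> space S" for i y
  proof -
    have "Pn n (f i) y \<le> Pn n V y"
      using f(2) by (intro Pn_mono fV Vb_V that) (auto simp: abs_le_iff)
    moreover have "Pn n (\<lambda>x. (-1) * f i x + 0 * f i x) y \<le> Pn n V y"
      using f(2) by (intro Pn_mono fV Vb_V Vb_add Vb_cmult that) (force simp: abs_le_iff)
    ultimately show ?thesis unfolding Pn_linear[OF fV fV that] by simp
  qed
  have "(\<lambda>i. \<integral>y. Pn n (f i) y \<partial>P x) \<longlonglongrightarrow> (\<integral>y. 0 \<partial>P x)"
  proof (rule integral_dominated_convergence[where w = "Pn n V"])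
    show "integrable (P x) (Pn n V)" by (intro int_P Vb_Pn Vb_V x)
    show "(\<lambda>y. 0) \<in> borel_measurable (P x)" by simp
    show "Pn n (f i) \<in> borel_measurable (P x)" for i
      using Vb_meas[OF Vb_Pn[OF fV[of i], of n]] by (simp only: meas_P[OF x])
    show "AE y in P x. (\<lambda>i. Pn n (f i) y) \<longlonglongrightarrow> 0"
      using Suc.IH by (intro AE_I2) (simp add: space_P[OF x])
    show "AE y in P x. norm (Pn n (f i) y) \<le> Pn n V y" for i
      using b by (intro AE_I2) (simp add: space_P[OF x])
  qed
  moreover have "Pn (Suc n) (f i) x = (\<integral>y. Pn n (f i) y \<partial>P x)" for i
    unfolding funpow.simps comp_def by (rule markov_op_def)
  ultimately show ?case by simp
qed

end

text \<open>
  What a single geometric rate implies about stationary measures.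
\<close>
locale geometric_chain = drift_chain +
  fixes M \<gamma> :: real
  assumes summ_V: "summable (\<lambda>n. nu ((Q ^^ n) V))"
    and M: "0 \<le> M" and \<gamma>: "0 < \<gamma>" "\<gamma> < 1"
    and geo_bd: "geo_bound M \<gamma>"
begin

lemma geo_boundD:
  assumes "g \<in> borel_measurable S" "\<And>y. y \<in> space S \<Longrightarrow> \<bar>g y\<bar> \<le> V y" "x \<in> space S"
  shows "\<bar>Pn n g x - ell g\<bar> \<le> M * V x * \<gamma> ^ n"
  using geo_bd assms unfolding geo_bound_def by blast

lemma geo_lim:
  assumes g: "g \<in> Vb" and x: "x \<in> space S"
  shows "(\<lambda>n. Pn n g x) \<longlonglongrightarrow> ell g"
proof -
  obtain c where c: "0 \<le> c" "\<And>x. x \<in> space S \<Longrightarrow> \<bar>g x\<bar> \<le> c * V x" using Vb_ex[OF g] by blast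
  define k where "k = c + 1"
  have k: "0 < k" using c by (simp add: k_def)
  define h where "h = (\<lambda>x. (1 / k) * g x)"
  have hb: "\<bar>h x\<bar> \<le> V x" if "x \<in> space S" for x
  proof -
    have "\<bar>g x\<bar> \<le> k * V x" using c(2)[OF that] V_ge[OF that] by (simp add: k_def distrib_right)
    thus ?thesis using k by (simp add: h_def abs_mult field_simps)
  qed
  have hV: "h \<in> Vb" unfolding h_def by (intro Vb_cmult g)
  have "(\<lambda>n. Pn n h x) \<longlonglongrightarrow> ell h"
  proof (rule LIM_zero_cancel, rule Lim_null_comparison)
    show "\<forall>\<^sub>F n in sequentially. norm (Pn n h x - ell h) \<le> M * V x * \<gamma> ^ n"
      using geo_boundD[OF Vb_meas[OF hV] hb x] by simp
    show "(\<lambda>n. M * V x * \<gamma> ^ n) \<longlonglongrightarrow> 0"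
      using \<gamma> by (intro tendsto_mult_right_zero LIMSEQ_realpow_zero) auto
  qed
  hence "(\<lambda>n. k * Pn n h x) \<longlonglongrightarrow> k * ell h" by (intro tendsto_mult_left)
  moreover have "k * Pn n h x = Pn n g x" for n
  proof -
    have "Pn n (\<lambda>x. (1 / k) * g x + 0 * g x) x = (1 / k) * Pn n g x + 0 * Pn n g x"
      by (rule Pn_linear[OF g g x])
    thus ?thesis using k by (simp add: h_def)
  qed
  moreover have "k * ell h = ell g"
  proof -
    have Qh: "nu ((Q ^^ n) h) = (1 / k) * nu ((Q ^^ n) g)" for n
    proof -
      have "(Q ^^ n) h y = (1 / k) * (Q ^^ n) g y" if "y \<in> space S" for y
        using that
      proof (induction n arbitrary: y)
        case (Suc n)
        have "(Q ^^ Suc n) h y = Q (\<lambda>y. (1 / k) * (Q ^^ n) g y) y" using Q_cong[OF Suc.prems Suc.IH] by simp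
        thus ?case unfolding Q_cmult by simp
      qed (simp add: h_def)
      hence "nu ((Q ^^ n) h) = nu (\<lambda>y. (1 / k) * (Q ^^ n) g y)" by (rule nu_cong)
      thus ?thesis unfolding nu_cmult .
    qed
    have "summable (\<lambda>n. nu ((Q ^^ n) h))"
      by (rule summable_comparison_test'[OF summ_V, of 0]) (use nu_abs_le[OF hV hb] in simp)
    from suminf_mult[OF this, of k] have "(\<Sum>n. nu ((Q ^^ n) g)) = k * (\<Sum>n. nu ((Q ^^ n) h))"
      unfolding Qh using k by simp
    thus ?thesis by (simp add: ell_def)
  qed
  ultimately show ?thesis by simp
qed

lemma space_nonempty: obtains a where "a \<in> space S"
  using C_nonempty C_sub by blast

lemma ell_linear: assumes "f \<in> Vb" "g \<in> Vb" shows "ell (\<lambda>x. a * f x + b * g x) = a * ell f + b * ell g"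
proof -
  obtain x where x: "x \<in> space S" by (rule space_nonempty)
  have "(\<lambda>n. Pn n (\<lambda>x. a * f x + b * g x) x) \<longlonglongrightarrow> ell (\<lambda>x. a * f x + b * g x)"
    by (intro geo_lim x Vb_add Vb_cmult assms)
  moreover have "(\<lambda>n. a * Pn n f x + b * Pn n g x) \<longlonglongrightarrow> a * ell f + b * ell g"
    by (intro tendsto_intros geo_lim x assms)
  ultimately show ?thesis using Pn_linear[OF assms x] by (simp add: LIMSEQ_unique)
qed

lemma ell_const: "ell (\<lambda>_. a) = a"
proof -
  obtain x where x: "x \<in> space S" by (rule space_nonempty)
  have "(\<lambda>n. a) \<longlonglongrightarrow> ell (\<lambda>_. a)" using geo_lim[OF Vb_const x, of a] Pn_const[OF x] by simp
  thus ?thesis by (simp add: LIMSEQ_const_iff)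
qed

lemma ell_mono: assumes "f \<in> Vb" "g \<in> Vb" "\<And>x. x \<in> space S \<Longrightarrow> f x \<le> g x" shows "ell f \<le> ell g"
proof -
  obtain x where x: "x \<in> space S" by (rule space_nonempty)
  show ?thesis using geo_lim[OF assms(1) x] geo_lim[OF assms(2) x]
    by (rule LIMSEQ_le) (use Pn_mono[OF assms x] in auto)
qed

lemma ell_cong: assumes "f \<in> Vb" "g \<in> Vb" "\<And>x. x \<in> space S \<Longrightarrow> f x = g x" shows "ell f = ell g"
  using ell_mono[OF assms(1,2)] ell_mono[OF assms(2,1)] assms(3) by (metis eq_iff)

lemma ell_P: assumes "f \<in> Vb" shows "ell (markov_op P f) = ell f"
proof -
  obtain x where x: "x \<in> space S" by (rule space_nonempty)
  have "(\<lambda>n. Pn n (markov_op P f) x) \<longlonglongrightarrow> ell (markov_op P f)" by (intro geo_lim x Vb_P assms)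
  moreover have "(\<lambda>n. Pn n (markov_op P f) x) = (\<lambda>n. Pn (Suc n) f x)"
    by (simp only: funpow_Suc_right comp_def)
  moreover have "(\<lambda>n. Pn (Suc n) f x) \<longlonglongrightarrow> ell f" by (rule LIMSEQ_Suc[OF geo_lim[OF assms x]])
  ultimately show ?thesis by (metis LIMSEQ_unique)
qed

text \<open>
  The limit functional is continuous along dominated sequences, because each \<open>P\<^sup>n\<close> is and
  the convergence \<open>P\<^sup>n f \<rightarrow> ell f\<close> is uniform over all \<open>f\<close> dominated by \<open>V\<close>.
\<close>
lemma ell_tendsto_0:
  assumes f: "\<And>i. f i \<in> borel_measurable S" "\<And>i x. x \<in> space S \<Longrightarrow> \<bar>f i x\<bar> \<le> c * V x"
    and lim: "\<And>x. x \<in> space S \<Longrightarrow> (\<lambda>i. f i x) \<longlonglongrightarrow> 0"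
  shows "(\<lambda>i. ell (f i)) \<longlonglongrightarrow> 0"
proof -
  obtain x where x: "x \<in> space S" by (rule space_nonempty)
  have "0 \<le> c * V x" using f(2)[OF x, of 0] by linarith
  hence c0: "0 \<le> c" using V_ge[OF x] by (simp add: zero_le_mult_iff)
  define k where "k = c + 1"
  have k: "1 \<le> k" using c0 by (simp add: k_def)
  have fV: "f i \<in> Vb" for i by (rule VbI[OF f])
  define h where "h = (\<lambda>i x. (1 / k) * f i x)"
  have hm: "h i \<in> borel_measurable S" for i unfolding h_def using f(1)[of i] by simp
  have hb: "\<bar>h i y\<bar> \<le> V y" if "y \<in> space S" for i y
  proof -
    have "\<bar>f i y\<bar> \<le> k * V y" using f(2)[OF that, of i] V_ge[OF that] by (simp add: k_def distrib_right)
    thus ?thesis using k by (simp add: h_def abs_mult field_simps)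
  qed
  have hl: "(\<lambda>i. h i y) \<longlonglongrightarrow> 0" if "y \<in> space S" for y
    unfolding h_def by (rule tendsto_mult_right_zero[OF lim[OF that]])
  have "(\<lambda>i. ell (h i)) \<longlonglongrightarrow> 0"
  proof (rule LIMSEQ_I)
    fix e :: real assume e: "0 < e"
    have "(\<lambda>n. M * V x * \<gamma> ^ n) \<longlonglongrightarrow> 0"
      using \<gamma> by (intro tendsto_mult_right_zero LIMSEQ_realpow_zero) auto
    from LIMSEQ_D[OF this, of "e / 2"] e obtain n where n: "\<bar>M * V x * \<gamma> ^ n\<bar> < e / 2" by auto
    have "(\<lambda>i. Pn n (h i) x) \<longlonglongrightarrow> 0" by (rule Pn_tendsto_0[OF hm hb hl x])
    from LIMSEQ_D[OF this, of "e / 2"] e obtain N where N: "\<And>i. N \<le> i \<Longrightarrow> \<bar>Pn n (h i) x\<bar> < e / 2" by auto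
    have "\<bar>ell (h i)\<bar> < e" if "N \<le> i" for i
    proof -
      have "\<bar>Pn n (h i) x - ell (h i)\<bar> \<le> M * V x * \<gamma> ^ n" by (rule geo_boundD[OF hm hb x])
      thus ?thesis using N[OF that] n by linarith
    qed
    thus "\<exists>no. \<forall>n\<ge>no. norm (ell (h n) - 0) < e" by auto
  qed
  hence "(\<lambda>i. k * ell (h i)) \<longlonglongrightarrow> 0" by (rule tendsto_mult_right_zero)
  moreover have "k * ell (h i) = ell (f i)" for i
    using ell_linear[OF fV fV, of "1 / k" i 0 i] k by (simp add: h_def)
  ultimately show ?thesis by simp
qed

definition inv_measure :: "'a measure" where "inv_measure = measure_of (space S) (sets S) (\<lambda>A. ennreal (ell (indicator A)))"

lemma ell_ind_nonneg: "A \<in> sets S \<Longrightarrow> 0 \<le> ell (indicator A)"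
  using ell_mono[OF Vb_const Vb_ind, of A 0] by (simp add: ell_const)

lemma ell_ind_add:
  assumes "A \<in> sets S" "B \<in> sets S" "A \<inter> B = {}"
  shows "ell (indicator (A \<union> B)) = ell (indicator A) + ell (indicator B)"
proof -
  have "(indicator (A \<union> B) :: 'a \<Rightarrow> real) = (\<lambda>x. 1 * indicator A x + 1 * indicator B x)"
    using assms by (auto simp: indicator_def fun_eq_iff)
  thus ?thesis using ell_linear[OF Vb_ind[OF assms(1)] Vb_ind[OF assms(2)], of 1 1] by simp
qed

lemma sets_inv_measure: "sets inv_measure = sets S" and space_inv_measure: "space inv_measure = space S"
  by (simp_all add: inv_measure_def)

text \<open>
  Continuity of \<open>ell\<close> at the empty set makes \<open>ell\<close> countably additive on indicators.
\<close>
lemma emeasure_inv_measure: "A \<in> sets S \<Longrightarrow> emeasure inv_measure A = ennreal (ell (indicator A))"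
proof -
  assume A: "A \<in> sets S"
  have pos: "positive (sets S) (\<lambda>A. ennreal (ell (indicator A)))"
    using ell_const[of 0] by (simp add: positive_def indicator_def[abs_def])
  have add: "additive (sets S) (\<lambda>A. ennreal (ell (indicator A)))"
    by (simp add: additive_def ell_ind_add ell_ind_nonneg)
  have "countably_additive (sets S) (\<lambda>A. ennreal (ell (indicator A)))"
  proof (rule sets.empty_continuous_imp_countably_additive[OF pos add])
    show "\<forall>A\<in>sets S. ennreal (ell (indicator A)) \<noteq> \<infinity>" by simp
    fix A :: "nat \<Rightarrow> 'a set" assume A: "range A \<subseteq> sets S" "decseq A" "(\<Inter>i. A i) = {}"
    have "(\<lambda>i. ell (indicator (A i))) \<longlonglongrightarrow> 0"
    proof (rule ell_tendsto_0[where c = 1])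
      show "(indicator (A i) :: 'a \<Rightarrow> real) \<in> borel_measurable S" for i using A(1) by auto
      show "\<bar>indicator (A i) x\<bar> \<le> 1 * V x" if "x \<in> space S" for i x
        using V_ge[OF that] by (simp add: indicator_def)
      show "(\<lambda>i. indicator (A i) x :: real) \<longlonglongrightarrow> 0" for x
        using LIMSEQ_indicator_decseq[OF A(2), of x] A(3) by simp
    qed
    thus "(\<lambda>i. ennreal (ell (indicator (A i)))) \<longlonglongrightarrow> 0"
      using tendsto_ennrealI by fastforce
  qed
  thus ?thesis unfolding inv_measure_def
    by (rule emeasure_measure_of_sigma[OF sets.sigma_algebra_axioms pos _ A])
qed

lemma prob_inv_measure: "prob_space inv_measure"
proof
  have "ell (indicator (space S)) = ell (\<lambda>_. 1)"
    by (rule ell_cong) (auto intro: Vb_ind Vb_const)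
  thus "emeasure inv_measure (space inv_measure) = 1" by (simp add: space_inv_measure emeasure_inv_measure ell_const)
qed

text \<open>
  Bounded functions first; unbounded ones (\<open>integral_inv_measure_ell\<close>) require the integrability of \<open>V\<close>, whose proof uses the bounded case.
\<close>
lemma integral_inv_measure:
  assumes u: "u \<in> borel_measurable S" "\<And>x. 0 \<le> u x" "\<And>x. x \<in> space S \<Longrightarrow> u x \<le> c"
  shows "(\<integral>x. u x \<partial>inv_measure) = ell u"
proof -
  interpret prob_space inv_measure by (rule prob_inv_measure)
  have mm: "f \<in> borel_measurable inv_measure \<longleftrightarrow> f \<in> borel_measurable S" for f :: "'a \<Rightarrow> real"
    by (simp only: measurable_cong_sets[OF sets_inv_measure refl])
  have bint: "integrable inv_measure f" if "f \<in> borel_measurable S" "\<And>x. 0 \<le> f x" "\<And>x. x \<in> space S \<Longrightarrow> f x \<le> d" for f :: "'a \<Rightarrow> real" and d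
    by (rule integrable_const_bound[where B = d]) (use that in \<open>auto simp: mm space_inv_measure intro!: AE_I2\<close>)
  have bV: "f \<in> Vb" if "f \<in> borel_measurable S" "\<And>x. 0 \<le> f x" "\<And>x. x \<in> space S \<Longrightarrow> f x \<le> d" for f :: "'a \<Rightarrow> real" and d
    by (rule Vb_bounded[where c = d]) (use that in auto)
  have "(\<forall>d. (\<forall>x\<in>space S. u x \<le> d) \<longrightarrow> (\<integral>x. u x \<partial>inv_measure) = ell u)"
    using u(1,2)
  proof (induction rule: borel_measurable_induct_real)
    case (set A)
    have "measure inv_measure A = ell (indicator A)"
      using emeasure_inv_measure[OF set] ell_ind_nonneg[OF set] by (simp add: measure_def)
    moreover have "A \<inter> space inv_measure = A" using sets.sets_into_space[OF set] by (auto simp: space_inv_measure)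
    ultimately show ?case using set by (simp add: sets_inv_measure)
  next
    case (mult f k)
    show ?case
    proof (intro allI impI)
      fix d assume d: "\<forall>x\<in>space S. k * f x \<le> d"
      show "(\<integral>x. k * f x \<partial>inv_measure) = ell (\<lambda>x. k * f x)"
      proof (cases "k = 0")
        case True thus ?thesis using ell_const[of 0] by simp
      next
        case False
        hence fd: "\<forall>x\<in>space S. f x \<le> d / k" using d mult(1) by (auto simp: field_simps)
        hence "(\<integral>x. f x \<partial>inv_measure) = ell f" using mult(4) by blast
        moreover have "f \<in> Vb" using bV[OF mult(2,3)] fd by blast
        ultimately show ?thesis using ell_linear[of f f k 0] by simp
      qed
    qed
  next
    case (add f g)
    show ?case
    proof (intro allI impI)
      fix d assume d: "\<forall>x\<in>space S. g x + f x \<le> d"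
      have fd: "f x \<le> d" "g x \<le> d" if "x \<in> space S" for x
      proof -
        have "g x + f x \<le> d" using d that by blast
        thus "f x \<le> d" "g x \<le> d" using add(2)[of x] add(4)[of x] by linarith+
      qed
      have "f \<in> Vb" "g \<in> Vb" using bV[OF add(1,2) fd(1)] bV[OF add(3,4) fd(2)] by auto
      moreover have "(\<integral>x. f x \<partial>inv_measure) = ell f" "(\<integral>x. g x \<partial>inv_measure) = ell g" using add(6,7) fd by blast+
      moreover have "integrable inv_measure f" "integrable inv_measure g" using bint[OF add(1,2) fd(1)] bint[OF add(3,4) fd(2)] by auto
      ultimately show "(\<integral>x. g x + f x \<partial>inv_measure) = ell (\<lambda>x. g x + f x)"
        using ell_linear[of g f 1 1] by simp
    qed
  next
    case (seq U)
    show ?case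
    proof (intro allI impI)
      fix d assume d: "\<forall>x\<in>space S. u x \<le> d"
      have Uu: "U i x \<le> u x" if "x \<in> space S" for i x
        using seq(3,4) that by (intro incseq_le) (auto simp: incseq_def le_fun_def)
      have Ud: "U i x \<le> d" if "x \<in> space S" for i x using Uu[OF that, of i] d that by force
      have UV: "U i \<in> Vb" for i using bV[OF seq(1,2) Ud] .
      have uV: "u \<in> Vb" using bV[OF u(1,2)] d by blast
      have e1: "(\<integral>x. U i x \<partial>inv_measure) = ell (U i)" for i using seq(5) Ud by blast
      have "(\<lambda>i. \<integral>x. U i x \<partial>inv_measure) \<longlonglongrightarrow> (\<integral>x. u x \<partial>inv_measure)"
      proof (rule integral_dominated_convergence[where w = "\<lambda>_. d"])
        show "AE x in inv_measure. (\<lambda>i. U i x) \<longlonglongrightarrow> u x" using seq(4) by (intro AE_I2) (simp add: space_inv_measure)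
        show "AE x in inv_measure. norm (U i x) \<le> d" for i using seq(2) Ud by (intro AE_I2) (simp add: space_inv_measure)
      qed (use u seq(1) in \<open>auto simp: mm\<close>)
      moreover have "(\<lambda>i. ell (\<lambda>x. 1 * u x + (-1) * U i x)) \<longlonglongrightarrow> 0"
      proof (rule ell_tendsto_0[where c = d])
        show "(\<lambda>x. 1 * u x + (-1) * U i x) \<in> borel_measurable S" for i using u(1) seq(1) by simp
        show "\<bar>1 * u x + (-1) * U i x\<bar> \<le> d * V x" if "x \<in> space S" for i x
        proof -
          have "\<bar>1 * u x + (-1) * U i x\<bar> \<le> d" "0 \<le> d" using Uu[OF that, of i] seq(2)[of i x] d that by force+
          moreover have "d * 1 \<le> d * V x" using calculation(2) V_ge[OF that] by (intro mult_left_mono)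
          ultimately show ?thesis by simp
        qed
        show "(\<lambda>i. 1 * u x + (-1) * U i x) \<longlonglongrightarrow> 0" if "x \<in> space S" for x
          using tendsto_diff[OF tendsto_const seq(4)[OF that], of "u x"] by simp
      qed
      hence "(\<lambda>i. ell u - ell (U i)) \<longlonglongrightarrow> 0" unfolding ell_linear[OF uV UV] by simp
      hence "(\<lambda>i. ell u - (ell u - ell (U i))) \<longlonglongrightarrow> ell u - 0" by (intro tendsto_diff tendsto_const)
      hence "(\<lambda>i. ell (U i)) \<longlonglongrightarrow> ell u" by simp
      ultimately show "(\<integral>x. u x \<partial>inv_measure) = ell u" unfolding e1 by (rule LIMSEQ_unique)
    qed
  qed
  thus ?thesis using u(3) by blast
qed

lemma emeasure_P_eq: "x \<in> space S \<Longrightarrow> A \<in> sets S \<Longrightarrow> emeasure (P x) A = ennreal (markov_op P (indicator A) x)"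
proof -
  assume x: "x \<in> space S" and A: "A \<in> sets S"
  interpret Px: prob_space "P x" by (rule P_prob[OF x])
  have "A \<inter> space (P x) = A" using sets.sets_into_space[OF A] by (auto simp: space_P[OF x])
  thus ?thesis using A by (simp add: markov_op_def sets_P[OF x] Px.emeasure_eq_measure)
qed

lemma stationary_inv_measure: "stationary_prob S P inv_measure"
  unfolding stationary_prob_def
proof (intro conjI ballI prob_inv_measure sets_inv_measure)
  fix A assume A: "A \<in> sets S"
  interpret prob_space inv_measure by (rule prob_inv_measure)
  \<comment> \<open>\<open>P x\<close> is arbitrary outside \<open>space S\<close>, where a nonnegative function is still required\<close>
  define f where "f = (\<lambda>x. if x \<in> space S then markov_op P (indicator A) x else 0)"
  have PV: "markov_op P (indicator A) \<in> Vb" by (intro Vb_P Vb_ind A)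
  have fm: "f \<in> borel_measurable S"
    using Vb_meas[OF PV] unfolding f_def by (subst measurable_cong[where g = "markov_op P (indicator A)"]) auto
  have f0: "0 \<le> f x" for x
    using P_mono[of x "\<lambda>_. 0" "indicator A"] A by (auto simp: f_def P_const Vb_const Vb_ind)
  have f1: "f x \<le> 1" if "x \<in> space S" for x
  proof -
    have "markov_op P (indicator A) x \<le> markov_op P (\<lambda>_. 1) x"
      by (intro P_mono that Vb_ind A Vb_const) (simp add: indicator_def)
    thus ?thesis using that by (simp add: f_def P_const)
  qed
  have fV: "f \<in> Vb" by (rule Vb_bounded[where c = 1]) (use fm f0 f1 in auto)
  have "(\<integral>\<^sup>+x. emeasure (P x) A \<partial>inv_measure) = (\<integral>\<^sup>+x. ennreal (f x) \<partial>inv_measure)"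
    by (rule nn_integral_cong) (simp add: space_inv_measure emeasure_P_eq[OF _ A] f_def)
  also have "\<dots> = ennreal (\<integral>x. f x \<partial>inv_measure)"
  proof (rule nn_integral_eq_integral)
    show "integrable inv_measure f"
      by (rule integrable_const_bound[where B = 1])
         (use fm f0 f1 in \<open>auto simp: measurable_cong_sets[OF sets_inv_measure refl] space_inv_measure intro!: AE_I2\<close>)
  qed (use f0 in auto)
  also have "(\<integral>x. f x \<partial>inv_measure) = ell f" by (rule integral_inv_measure[OF fm f0 f1])
  also have "ell f = ell (markov_op P (indicator A))" by (rule ell_cong[OF fV PV]) (simp add: f_def)
  also have "\<dots> = ell (indicator A)" by (intro ell_P Vb_ind A)
  finally show "emeasure inv_measure A = (\<integral>\<^sup>+x. emeasure (P x) A \<partial>inv_measure)" by (simp add: emeasure_inv_measure[OF A])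
qed

context
  fixes \<pi> assumes st: "stationary_prob S P \<pi>"
begin

lemma sets_\<pi>: "sets \<pi> = sets S" and prob_\<pi>: "prob_space \<pi>" and space_\<pi>: "space \<pi> = space S"
  and meas_\<pi>: "f \<in> borel_measurable \<pi> \<longleftrightarrow> f \<in> borel_measurable S"
proof -
  show 1: "sets \<pi> = sets S" and "prob_space \<pi>" using st by (auto simp: stationary_prob_def)
  show "space \<pi> = space S" using 1 by (rule sets_eq_imp_space_eq)
  show "f \<in> borel_measurable \<pi> \<longleftrightarrow> f \<in> borel_measurable S" by (simp only: measurable_cong_sets[OF 1 refl])
qed

lemma integral_P_\<pi>:
  assumes h: "h \<in> borel_measurable S" "\<And>x. x \<in> space S \<Longrightarrow> 0 \<le> h x" "\<And>x. x \<in> space S \<Longrightarrow> h x \<le> 1"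
  shows "(\<integral>x. markov_op P h x \<partial>\<pi>) = (\<integral>x. h x \<partial>\<pi>)"
proof -
  interpret \<pi>: prob_space \<pi> by (rule prob_\<pi>)
  have hV: "h \<in> Vb" by (rule Vb_bounded[where c = 1]) (use h in auto)
  have ks: "P \<in> measurable \<pi> (subprob_algebra S)"
    using measurable_prob_algebraD[OF kernel] by (simp only: measurable_cong_sets[OF sets_\<pi> refl])
  have ne: "space \<pi> \<noteq> {}" using space_nonempty space_\<pi> by auto
  have bind: "\<pi> \<bind> P = \<pi>"
  proof (rule measure_eqI)
    show s: "sets (\<pi> \<bind> P) = sets \<pi>" using sets_bind[of \<pi> P S] ne sets_P space_\<pi> sets_\<pi> by simp
    fix A assume "A \<in> sets (\<pi> \<bind> P)"
    hence A: "A \<in> sets S" using s sets_\<pi> by simp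
    show "emeasure (\<pi> \<bind> P) A = emeasure \<pi> A"
      using emeasure_bind[OF ne ks A] st A by (simp add: stationary_prob_def)
  qed
  have P0: "0 \<le> markov_op P h x" "markov_op P h x \<le> 1" if "x \<in> space S" for x
    using P_mono[OF that Vb_const hV, of 0] P_mono[OF that hV Vb_const, of 1] h by (simp_all add: P_const[OF that])
  have int: "integrable \<pi> f" if "f \<in> borel_measurable S" "\<And>x. x \<in> space S \<Longrightarrow> 0 \<le> f x" "\<And>x. x \<in> space S \<Longrightarrow> f x \<le> 1" for f :: "'a \<Rightarrow> real"
    by (rule \<pi>.integrable_const_bound[where B = 1]) (use that in \<open>auto simp: meas_\<pi> space_\<pi> intro!: AE_I2\<close>)
  have "ennreal (\<integral>x. markov_op P h x \<partial>\<pi>) = (\<integral>\<^sup>+x. ennreal (markov_op P h x) \<partial>\<pi>)"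
    using P0 by (intro nn_integral_eq_integral[symmetric] int Vb_meas[OF Vb_P[OF hV]] AE_I2) (auto simp: space_\<pi>)
  also have "\<dots> = (\<integral>\<^sup>+x. (\<integral>\<^sup>+y. ennreal (h y) \<partial>P x) \<partial>\<pi>)"
    unfolding markov_op_def using h int_P[OF hV]
    by (intro nn_integral_cong nn_integral_eq_integral[symmetric] AE_I2) (auto simp: space_\<pi> space_P)
  also have "\<dots> = (\<integral>\<^sup>+y. ennreal (h y) \<partial>\<pi>)"
    using nn_integral_bind[of "\<lambda>y. ennreal (h y)" S P \<pi>] ks h(1) bind by simp
  also have "\<dots> = ennreal (\<integral>y. h y \<partial>\<pi>)"
    using h by (intro nn_integral_eq_integral int AE_I2) (auto simp: space_\<pi>)
  finally show ?thesis using P0 h(2)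
    by (subst (asm) ennreal_inj) (auto intro!: Bochner_Integration.integral_nonneg simp: space_\<pi>)
qed

text \<open>
  Under a stationary measure the integral of \<open>P\<^sup>n 1\<^sub>A\<close> is independent of \<open>n\<close>, while the integrand tends to the constant
  \<open>ell 1\<^sub>A\<close> and stays between \<open>0\<close> and \<open>1\<close>.
\<close>
lemma stationary_unique: "\<pi> = inv_measure"
proof (rule measure_eqI)
  show "sets \<pi> = sets inv_measure" by (simp add: sets_\<pi> sets_inv_measure)
  fix A assume "A \<in> sets \<pi>"
  hence A: "A \<in> sets S" by (simp add: sets_\<pi>)
  interpret \<pi>: prob_space \<pi> by (rule prob_\<pi>)
  define h where "h = (\<lambda>n. Pn n (indicator A))"
  have hV: "h n \<in> Vb" for n unfolding h_def by (intro Vb_Pn Vb_ind A)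
  have h01: "0 \<le> h n x" "h n x \<le> 1" if "x \<in> space S" for n x
    using Pn_mono[OF Vb_const Vb_ind[OF A] _ that, of 0 n] Pn_mono[OF Vb_ind[OF A] Vb_const _ that, of 1 n]
    by (simp_all add: h_def Pn_const[OF that] indicator_def)
  have inv: "(\<integral>x. h n x \<partial>\<pi>) = measure \<pi> A" for n
  proof (induction n)
    case 0
    have "A \<inter> space \<pi> = A" using sets.sets_into_space[OF A] by (auto simp: space_\<pi>)
    thus ?case by (simp add: h_def)
  next
    case (Suc n)
    have "h (Suc n) = markov_op P (h n)" by (simp add: h_def)
    thus ?case using integral_P_\<pi>[OF Vb_meas[OF hV] h01] Suc by simp
  qed
  have "(\<lambda>n. \<integral>x. h n x \<partial>\<pi>) \<longlonglongrightarrow> (\<integral>x. ell (indicator A) \<partial>\<pi>)"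
  proof (rule integral_dominated_convergence[where w = "\<lambda>_. 1"])
    show "h n \<in> borel_measurable \<pi>" for n using Vb_meas[OF hV] by (simp only: meas_\<pi>)
    show "AE x in \<pi>. (\<lambda>n. h n x) \<longlonglongrightarrow> ell (indicator A)"
      unfolding h_def by (intro AE_I2 geo_lim Vb_ind A) (simp add: space_\<pi>)
    show "AE x in \<pi>. norm (h n x) \<le> 1" for n using h01 by (intro AE_I2) (simp add: space_\<pi>)
  qed auto
  hence "measure \<pi> A = ell (indicator A)" unfolding inv by (simp add: LIMSEQ_const_iff \<pi>.prob_space)
  thus "emeasure \<pi> A = emeasure inv_measure A" using emeasure_inv_measure[OF A] by (simp add: \<pi>.emeasure_eq_measure)
qed

end

lemma meas_inv_measure: "f \<in> borel_measurable inv_measure \<longleftrightarrow> f \<in> borel_measurable S"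
  by (simp only: measurable_cong_sets[OF sets_inv_measure refl])

text \<open>
  The integrals of the truncations of \<open>V\<close> are at most \<open>ell V\<close>.
\<close>
lemma V_inv_measure: "(\<integral>\<^sup>+x. ennreal (V x) \<partial>inv_measure) < \<infinity>"
proof -
  interpret prob_space inv_measure by (rule prob_inv_measure)
  \<comment> \<open>\<open>max 0\<close> makes the truncation nonnegative outside \<open>space S\<close> as well\<close>
  define U' where "U' = (\<lambda>m x. max 0 (min (V x) (real m)))"
  have Um: "U' m \<in> borel_measurable S" for m unfolding U'_def using V_meas by simp
  have "(\<integral>\<^sup>+x. ennreal (U' m x) \<partial>inv_measure) \<le> ennreal (ell V)" for m
  proof -
    have "(\<integral>\<^sup>+x. ennreal (U' m x) \<partial>inv_measure) = ennreal (\<integral>x. U' m x \<partial>inv_measure)"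
      by (intro nn_integral_eq_integral integrable_const_bound[where B = "real m"] AE_I2)
         (use Um in \<open>auto simp: meas_inv_measure U'_def\<close>)
    also have "(\<integral>x. U' m x \<partial>inv_measure) = ell (U' m)"
      by (rule integral_inv_measure[OF Um, where c = "real m"]) (auto simp: U'_def)
    also have "ell (U' m) \<le> ell V"
    proof (rule ell_mono[OF _ Vb_V])
      show "U' m \<in> Vb" by (rule Vb_bounded[OF Um, where c = "real m"]) (auto simp: U'_def)
      show "U' m x \<le> V x" if "x \<in> space S" for x using V_ge[OF that] by (simp add: U'_def)
    qed
    finally show ?thesis by (simp add: ennreal_leI)
  qed
  moreover have "(\<integral>\<^sup>+x. ennreal (V x) \<partial>inv_measure) = (SUP m. \<integral>\<^sup>+x. ennreal (U' m x) \<partial>inv_measure)"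
  proof -
    have "(\<integral>\<^sup>+x. ennreal (V x) \<partial>inv_measure) = (\<integral>\<^sup>+x. (SUP m. ennreal (U' m x)) \<partial>inv_measure)"
    proof (rule nn_integral_cong)
      fix x assume "x \<in> space inv_measure"
      hence x: "0 \<le> V x" using V_ge[of x] by (simp add: space_inv_measure)
      obtain m where m: "V x \<le> real m" using real_arch_simple by blast
      show "ennreal (V x) = (SUP m. ennreal (U' m x))"
      proof (rule antisym)
        have "U' m x = V x" using m x by (simp add: U'_def)
        thus "ennreal (V x) \<le> (SUP m. ennreal (U' m x))" by (metis SUP_upper UNIV_I)
        show "(SUP m. ennreal (U' m x)) \<le> ennreal (V x)"
          using x by (intro SUP_least ennreal_leI) (simp add: U'_def)
      qed
    qed
    also have "\<dots> = (SUP m. \<integral>\<^sup>+x. ennreal (U' m x) \<partial>inv_measure)"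
    proof (rule nn_integral_monotone_convergence_SUP)
      show "incseq (\<lambda>m x. ennreal (U' m x))"
        by (auto simp: incseq_def le_fun_def U'_def intro!: ennreal_leI)
      show "(\<lambda>x. ennreal (U' m x)) \<in> borel_measurable inv_measure" for m
        using Um[of m] meas_inv_measure[of "U' m"] by simp
    qed
    finally show ?thesis .
  qed
  ultimately have "(\<integral>\<^sup>+x. ennreal (V x) \<partial>inv_measure) \<le> ennreal (ell V)" by (simp add: SUP_least)
  thus ?thesis by (simp add: le_less_trans)
qed

lemma int_inv_measure_V: "integrable inv_measure V"
  by (rule integrableI_nonneg) (use V_inv_measure V_meas V_ge in \<open>auto simp: meas_inv_measure space_inv_measure intro!: AE_I2 order_trans[OF zero_le_one]\<close>)

lemma int_inv_measure: "g \<in> Vb \<Longrightarrow> integrable inv_measure g"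
  by (rule Vb_int[OF _ sets_inv_measure int_inv_measure_V])

lemma integral_inv_measure_ell:
  assumes g: "g \<in> Vb"
  shows "(\<integral>x. g x \<partial>inv_measure) = ell g"
proof -
  have pos: "(\<integral>x. h x \<partial>inv_measure) = ell h" if h: "h \<in> Vb" "\<And>x. 0 \<le> h x" for h
  proof -
    obtain c where c: "0 \<le> c" "\<And>x. x \<in> space S \<Longrightarrow> \<bar>h x\<bar> \<le> c * V x" using Vb_ex[OF h(1)] by blast
    define U where "U = (\<lambda>m x. min (h x) (real m))"
    have Um: "U m \<in> borel_measurable S" for m unfolding U_def using Vb_meas[OF h(1)] by simp
    have UV: "U m \<in> Vb" for m by (rule Vb_bounded[OF Um, where c = "real m"]) (use h(2) in \<open>auto simp: U_def abs_le_iff intro: order_trans[OF _ h(2)]\<close>)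
    have Ul: "(\<lambda>m. U m x) \<longlonglongrightarrow> h x" for x
    proof (rule tendsto_eventually)
      obtain m where m: "h x \<le> real m" using real_arch_simple by blast
      show "\<forall>\<^sub>F n in sequentially. U n x = h x"
        using eventually_ge_at_top[of m] by eventually_elim (use m in \<open>auto simp: U_def\<close>)
    qed
    have e1: "(\<integral>x. U m x \<partial>inv_measure) = ell (U m)" for m
      by (rule integral_inv_measure[OF Um, where c = "real m"]) (use h(2) in \<open>auto simp: U_def\<close>)
    have "(\<lambda>m. \<integral>x. U m x \<partial>inv_measure) \<longlonglongrightarrow> (\<integral>x. h x \<partial>inv_measure)"
    proof (rule integral_dominated_convergence[where w = h])
      show "AE x in inv_measure. norm (U m x) \<le> h x" for m using h(2) by (intro AE_I2) (auto simp: U_def)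
    qed (use Ul Um h(1) in \<open>auto simp: meas_inv_measure Vb_meas int_inv_measure\<close>)
    moreover have "(\<lambda>m. ell (\<lambda>x. 1 * h x + (-1) * U m x)) \<longlonglongrightarrow> 0"
    proof (rule ell_tendsto_0[where c = c])
      show "(\<lambda>x. 1 * h x + (-1) * U i x) \<in> borel_measurable S" for i using Vb_meas[OF h(1)] Um by simp
      show "\<bar>1 * h x + (-1) * U i x\<bar> \<le> c * V x" if "x \<in> space S" for i x
        using c(2)[OF that] h(2)[of x] by (auto simp: U_def min_def)
      show "(\<lambda>i. 1 * h x + (-1) * U i x) \<longlonglongrightarrow> 0" for x
        using tendsto_diff[OF tendsto_const[of "h x"] Ul[of x]] by simp
    qed
    hence "(\<lambda>i. ell h - ell (U i)) \<longlonglongrightarrow> 0" unfolding ell_linear[OF h(1) UV] by simp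
    hence "(\<lambda>i. ell h - (ell h - ell (U i))) \<longlonglongrightarrow> ell h - 0" by (intro tendsto_diff tendsto_const)
    hence "(\<lambda>i. ell (U i)) \<longlonglongrightarrow> ell h" by simp
    ultimately show ?thesis unfolding e1 by (rule LIMSEQ_unique)
  qed
  define fp where "fp = (\<lambda>x. max 0 (g x))"
  define fm where "fm = (\<lambda>x. max 0 (- g x))"
  have fpV: "fp \<in> Vb" "fm \<in> Vb"
  proof -
    obtain c where c: "0 \<le> c" "\<And>x. x \<in> space S \<Longrightarrow> \<bar>g x\<bar> \<le> c * V x" using Vb_ex[OF g] by blast
    have "\<bar>fp x\<bar> \<le> \<bar>g x\<bar>" "\<bar>fm x\<bar> \<le> \<bar>g x\<bar>" for x by (auto simp: fp_def fm_def)
    hence "\<And>x. x \<in> space S \<Longrightarrow> \<bar>fp x\<bar> \<le> c * V x" "\<And>x. x \<in> space S \<Longrightarrow> \<bar>fm x\<bar> \<le> c * V x"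
      using c(2) order_trans by blast+
    moreover have "fp \<in> borel_measurable S" "fm \<in> borel_measurable S"
      using Vb_meas[OF g] by (simp_all add: fp_def fm_def)
    ultimately show "fp \<in> Vb" "fm \<in> Vb" by (auto intro: VbI)
  qed
  have fe: "g = (\<lambda>x. 1 * fp x + (-1) * fm x)" by (auto simp: fp_def fm_def fun_eq_iff)
  have "(\<integral>x. g x \<partial>inv_measure) = (\<integral>x. fp x - fm x \<partial>inv_measure)" by (subst fe) simp
  also have "\<dots> = (\<integral>x. fp x \<partial>inv_measure) - (\<integral>x. fm x \<partial>inv_measure)" by (intro Bochner_Integration.integral_diff int_inv_measure fpV)
  also have "\<dots> = ell fp - ell fm" using pos fpV by (simp add: fp_def fm_def)
  also have "\<dots> = ell (\<lambda>x. 1 * fp x + (-1) * fm x)" by (subst ell_linear[OF fpV]) simp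
  also have "\<dots> = ell g" using fe by simp
  finally show ?thesis .
qed

end

section \<open>The explicit constants\<close>

lemma K1_eq:
  assumes r: "1 < r" "r < R" and L: "1 < L" and N: "N = (L - 1) / (R - 1)" and E: "renewal_err N R r < \<beta>"
  shows "K1 r \<beta> R (ereal L) = ereal ((2 * \<beta> + 2 * (ln N / ln (R / r)) - renewal_err N R r) / ((r - 1) * (\<beta> - renewal_err N R r)))"
proof -
  have "0 < N" using r L by (simp add: N)
  moreover have "0 < ln (R / r)" using r by (simp add: field_simps)
  moreover have "0 < R / r" using r by simp
  ultimately show ?thesis
    using r E unfolding K1_def renewal_err_def by (auto simp: Let_def N[symmetric] divide_le_0_iff)
qed

lemma K1_ge:
  fixes \<beta> E A r :: real
  assumes "1 < r" "0 \<le> E" "E < \<beta>" "0 \<le> A"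
  shows "2 / (r - 1) \<le> (2 * \<beta> + 2 * A - E) / ((r - 1) * (\<beta> - E))"
proof -
  have "2 / (r - 1) = (2 * d) / ((r - 1) * d)" if "0 < d" for d :: real using that by simp
  from this[of "\<beta> - E"] have "2 / (r - 1) = (2 * (\<beta> - E)) / ((r - 1) * (\<beta> - E))" using assms by linarith
  also have "\<dots> \<le> (2 * \<beta> + 2 * A - E) / ((r - 1) * (\<beta> - E))"
    using assms by (intro divide_right_mono) auto
  finally show ?thesis .
qed

text \<open>
  \<open>L = \<beta>' \<zeta> / D\<close> bounds the generating function of the waiting time at \<open>r\<close>, hence \<open>(L - 1) / (r - 1)\<close> bounds that of its
  tails: this is the number \<open>N\<close> in \<open>K1\<close>.
\<close>
lemma (in weight) renewal_tail_weight:
  assumes "1 < r" shows "renewal_tail survival r ((\<beta>' * \<zeta> / D - 1) / (r - 1)) \<beta>"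
proof (rule renewal_tail_survival[OF assms])
  fix N
  have "(\<Sum>n<N. survival n * r ^ n) \<le> nu one_majorant"
    using nu_sum_le[OF one_sum[OF assms] Vb_const Vb_one_majorant, of N] by (simp add: survival_def mult.commute)
  also have "\<dots> \<le> (\<beta>' * \<zeta> / D - 1) / (r - 1)" by (rule nu_one_majorant[OF assms])
  finally show "(\<Sum>n<N. survival n * r ^ n) \<le> (\<beta>' * \<zeta> / D - 1) / (r - 1)" .
qed

context drift_chain
begin

lemma deviation_fps_bound:
  assumes rt: "renewal_tail survival R N \<beta>" and r: "1 < r" "r < R" and E: "renewal_err N R r < \<beta>"
  shows "\<bar>fps_nth deviation_fps m\<bar> * r ^ m \<le> (2 * \<beta> + 2 * (ln N / ln (R / r)) - renewal_err N R r) / ((r - 1) * (\<beta> - renewal_err N R r))"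
    and "2 / (r - 1) \<le> (2 * \<beta> + 2 * (ln N / ln (R / r)) - renewal_err N R r) / ((r - 1) * (\<beta> - renewal_err N R r))"
    and "summable survival" and "1 \<le> (\<Sum>n. survival n)"
proof -
  interpret T: renewal_tail survival R N \<beta> by (rule rt)
  show "summable survival" by (rule T.summ1)
  show u: "1 \<le> (\<Sum>n. survival n)" using T.sum_ge_1[of 1] r by simp
  have "Abs_fps (fps_nth deviation_fps) * Abs_fps survival * fps_const (\<Sum>n. survival n) = Abs_fps T.e"
    using deviation_fps_eq u by (simp add: T.e_def[abs_def] fps_nth_inverse)
  from T.renewal_rate[OF r E this]
  show "\<bar>fps_nth deviation_fps m\<bar> * r ^ m \<le> (2 * \<beta> + 2 * (ln N / ln (R / r)) - renewal_err N R r) / ((r - 1) * (\<beta> - renewal_err N R r))" .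
  show "2 / (r - 1) \<le> (2 * \<beta> + 2 * (ln N / ln (R / r)) - renewal_err N R r) / ((r - 1) * (\<beta> - renewal_err N R r))"
    using r E T.N_ge_1 by (intro K1_ge) (auto simp: renewal_err_def field_simps intro!: divide_nonneg_nonneg)
qed

text \<open>
  The exponent \<open>t\<close> with \<open>r = lam powr (- t)\<close> converts a power \<open>M powr t\<close>, as produced by Jensen's inequality, into a power of \<open>r\<close>; with
  \<open>M\<close> a bound for the mean of \<open>V\<close> after a step from \<open>C\<close> or under \<open>\<nu>\<close>, the exponents are \<open>\<alpha>1\<close> and \<open>\<alpha>2\<close>.
\<close>
lemma weight_exponent:
  assumes r: "1 < r" "r \<le> 1 / lam"
  obtains t where "0 < t" "t \<le> 1" "r = lam powr (- t)"
    "\<And>M. 0 < M \<Longrightarrow> r powr (1 + ln M / ln (1 / lam)) = r * M powr t"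
proof -
  define t where "t = ln r / ln (1 / lam)"
  have l: "0 < ln (1 / lam)" using lam by simp
  have t: "0 < t" "t \<le> 1" using l r lam by (auto simp: t_def simp del: ln_div)
  have rt: "r = lam powr (- t)"
  proof -
    have "- t * ln lam = t * ln (1 / lam)" using lam by (simp add: ln_div)
    also have "\<dots> = ln r" using l by (simp add: t_def)
    finally have "exp (- t * ln lam) = r" using r by simp
    thus ?thesis using lam by (simp add: powr_def)
  qed
  have "r powr (1 + ln M / ln (1 / lam)) = r * M powr t" if "0 < M" for M
  proof -
    have "r powr (ln M / ln (1 / lam)) = exp (ln M / ln (1 / lam) * ln r)" using r by (simp add: powr_def)
    also have "\<dots> = M powr t" using that by (simp add: powr_def t_def)
    finally show ?thesis using r by (simp add: powr_add)
  qed
  thus ?thesis using that t rt by blast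
qed

lemma nu_V_ge: "1 \<le> nu V"
  using nu_mono[OF Vb_const Vb_V, of 1] V_ge by (simp add: nu_const)

end

context excursion1
begin

lemma V_sum_nu1: "(\<Sum>n<N. nu ((Q ^^ n) V)) \<le> one.V_bound"
proof -
  have "(\<Sum>n<N. 1 ^ n * nu ((Q ^^ n) V)) \<le> nu one.V_majorant" by (intro nu_sum_le one.V_sum Vb_V one.Vb_V_majorant)
  thus ?thesis using one.nu_V_majorant by simp
qed

lemma initial_bound:
  assumes g: "g \<in> borel_measurable S" "\<And>y. y \<in> space S \<Longrightarrow> \<bar>g y\<bar> \<le> V y" and x: "x \<in> space S"
    and u: "1 \<le> (\<Sum>n. survival n)"
  shows "\<bar>g x - ell g\<bar> \<le> V x + one.V_bound"
proof -
  have gV: "g \<in> Vb" by (rule Vb_dom[OF g Vb_V])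
  have "\<bar>\<Sum>n. nu ((Q ^^ n) g)\<bar> \<le> (\<Sum>n. nu ((Q ^^ n) V))"
    unfolding real_norm_def[symmetric]
    by (rule norm_suminf_le[OF _ summable_nu_V]) (simp only: real_norm_def nu_abs_le[OF gV g(2)])
  also have "\<dots> \<le> one.V_bound" by (rule suminf_le_const[OF summable_nu_V V_sum_nu1])
  finally have a: "\<bar>\<Sum>n. nu ((Q ^^ n) g)\<bar> \<le> one.V_bound" .
  have "\<bar>ell g\<bar> = \<bar>\<Sum>n. nu ((Q ^^ n) g)\<bar> / (\<Sum>n. survival n)" using u by (simp add: ell_def)
  also have "\<dots> \<le> \<bar>\<Sum>n. nu ((Q ^^ n) g)\<bar> / 1" using u by (intro divide_left_mono) auto
  finally have "\<bar>ell g\<bar> \<le> one.V_bound" using a by simp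
  thus ?thesis using g(2)[OF x] by linarith
qed

text \<open>
  The time \<open>n = 0\<close>, at which no coefficient bound is available, is absorbed by \<open>m2\<close> and \<open>m3\<close>.
\<close>
lemma geo_bound_from_parts:
  assumes sc: "summable survival" and u: "1 \<le> (\<Sum>n. survival n)"
    and \<kappa>: "\<And>m. \<bar>fps_nth deviation_fps m\<bar> * r ^ m \<le> \<kappa>"
    and m1: "\<And>x. x \<in> space S \<Longrightarrow> V_majorant x - V x \<le> m1 * V x"
    and m2: "\<And>x. x \<in> space S \<Longrightarrow> \<beta>' / D * W t x * V_bound * \<kappa> \<le> m2 * V x"
    and m3: "\<And>x. x \<in> space S \<Longrightarrow> (\<beta>' / D * W t x - 1) / (r - 1) * V_bound \<le> m3 * V x"
    and m4: "kV_bound \<le> m4" and ge: "0 \<le> m1" "1 \<le> m2" "one.V_bound \<le> m3" "0 \<le> m3" "0 \<le> m4"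
  shows "geo_bound (m1 + m2 + m3 + m4) (1 / r)"
  unfolding geo_bound_def
proof (intro allI impI)
  fix g x n
  assume g: "g \<in> borel_measurable S" "\<forall>y\<in>space S. \<bar>g y\<bar> \<le> V y" and x: "x \<in> space S"
  have gV: "\<And>y. y \<in> space S \<Longrightarrow> \<bar>g y\<bar> \<le> V y" using g(2) by blast
  have V1: "1 \<le> V x" by (rule V_ge[OF x])
  have mV: "y \<le> y * V x" if "0 \<le> y" for y using mult_left_mono[OF V1 that] by simp
  show "\<bar>Pn n g x - ell g\<bar> \<le> (m1 + m2 + m3 + m4) * V x * (1 / r) ^ n"
  proof (cases n)
    case 0
    have "V x \<le> m2 * V x" using mult_right_mono[OF ge(2), of "V x"] V1 by simp
    moreover have "one.V_bound \<le> m3 * V x" using ge(3) mV[OF ge(4)] by linarith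
    moreover have "0 \<le> m1 * V x" "0 \<le> m4 * V x" using ge V1 by simp_all
    ultimately have "\<bar>g x - ell g\<bar> \<le> m1 * V x + m2 * V x + m3 * V x + m4 * V x"
      using initial_bound[OF g(1) gV x u] by linarith
    thus ?thesis using 0 by (simp add: distrib_right)
  next
    case (Suc k)
    have "\<bar>Pn (Suc k) g x - ell g\<bar> * r ^ Suc k \<le>
      (V_majorant x - V x) + (\<beta>' / D * W t x) * V_bound * \<kappa> + ((\<beta>' / D * W t x - 1) / (r - 1) * V_bound + kV_bound)"
      by (rule coefficient_bound[OF g(1) gV x sc \<kappa>])
    also have "\<dots> \<le> m1 * V x + m2 * V x + (m3 * V x + m4 * V x)"
      by (intro add_mono m1 m2 m3 x order_trans[OF m4 mV] ge)
    also have "\<dots> = (m1 + m2 + m3 + m4) * V x" by (simp only: distrib_right add.assoc)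
    finally have "\<bar>Pn (Suc k) g x - ell g\<bar> \<le> (m1 + m2 + m3 + m4) * V x / r ^ Suc k"
      using r1 by (simp add: pos_le_divide_eq)
    thus ?thesis using Suc by (simp add: power_divide)
  qed
qed

end

text \<open>
  For an atom \<open>Q\<close> vanishes on \<open>C\<close>, so that \<open>\<eta> = 0\<close>, \<open>D = 1\<close> and there are no contributions from returns to \<open>C\<close>. The four terms of \<open>M_at\<close>
  bound the four parts in this order; the rate \<open>R = 1 / lam\<close> corresponds to \<open>t = 1\<close>, where \<open>\<zeta> = K / lam\<close>.
\<close>
lemma (in drift_chain) atom_bound:
  assumes atom: "\<beta>' = 1" "\<forall>x\<in>C. \<nu> = P x"
  defines "R \<equiv> 1 / lam"
  assumes \<gamma>: "1 / R1 \<beta> R (ereal (K / lam)) < \<gamma>" "\<gamma> < 1"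
  shows "\<exists>m\<ge>0. M_at lam K \<gamma> (K1 (1 / \<gamma>) \<beta> R (ereal (K / lam))) = ereal m \<and>
     geo_bound m \<gamma>"
    and "summable (\<lambda>n. nu ((Q ^^ n) V))" and "0 < \<gamma>"
proof -
  have at: "\<beta>' = 1" "\<And>x. x \<in> C \<Longrightarrow> \<nu> = P x" using atom by auto
  have R1: "1 < R" using lam by (simp add: R_def)
  have L: "1 < K / lam" using lam K_ge_1 by simp
  note W = R1_works[OF R1 L \<beta>_pos]
  have gp: "0 < \<gamma>" using W(1) \<gamma>(1) by (meson less_trans zero_less_divide_1_iff zero_less_one)
  show "0 < \<gamma>" by (rule gp)
  define r where "r = 1 / \<gamma>"
  have r1: "1 < r" using \<gamma> gp by (simp add: r_def)
  have rR1: "r < R1 \<beta> R (ereal (K / lam))" using \<gamma> gp W(1) by (simp add: r_def field_simps)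
  have rR: "r < R" using rR1 W by simp
  have gr: "\<gamma> = 1 / r" using gp by (simp add: r_def)
  obtain a where a: "a \<in> C" by (rule C_nonempty)
  have "nu V = (\<integral>y. V y \<partial>P a)" unfolding nu_def by (simp flip: at(2)[OF a])
  hence nu_le: "nu V \<le> K" using PV_in[OF a] by simp
  have Q0: "Q f x = 0" if "x \<in> C" for f x using that at(1) unfolding Q_in[OF that] nu_def markov_op_def by (simp flip: at(2)[OF that])
  have rl: "r * lam < 1" using rR lam by (simp add: R_def field_simps)
  obtain t where t: "0 < t" "t \<le> 1" "r = lam powr (- t)" using weight_exponent[of r] r1 rR R_def by (metis less_imp_le)
  interpret X: excursion1 S P C \<nu> V \<beta> \<beta>' lam K t r 0 "r * nu (W t)" 0
    by unfold_locales (use t Q0 rl r1 in auto)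
  have nuV0: "nu V0 \<le> K" using nu_mono[OF Vb_V0 Vb_V V0_bounds(2)] nu_le by simp
  have "nu (W 1) \<le> K powr 1" using K_ge_1 nuV0 by (intro nu_W) auto
  hence nW: "R * nu (W 1) \<le> K / lam" using K_ge_1 lam by (simp add: R_def field_simps)
  interpret Y: weight S P C \<nu> V \<beta> \<beta>' lam K 1 R 0 "K / lam"
    by unfold_locales (use Q0 nW lam in \<open>auto simp: R_def powr_minus_divide\<close>)
  have YD: "Y.D = 1" "X.D = 1" by (simp_all add: Y.D_def X.D_def)
  define N where "N = (K / lam - 1) / (R - 1)"
  have rt: "renewal_tail survival R N \<beta>" using Y.renewal_tail_weight[OF R1] by (simp add: YD at(1) N_def)
  have E: "renewal_err N R r < \<beta>" unfolding N_def by (rule renewal_err_less[OF R1 L \<beta>_pos r1 rR1])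
  define \<kappa> where "\<kappa> = (2 * \<beta> + 2 * (ln N / ln (R / r)) - renewal_err N R r) / ((r - 1) * (\<beta> - renewal_err N R r))"
  note db = deviation_fps_bound[OF rt r1 rR E, folded \<kappa>_def]
  have K1: "K1 (1 / \<gamma>) \<beta> R (ereal (K / lam)) = ereal \<kappa>"
    unfolding \<kappa>_def r_def[symmetric] by (rule K1_eq[OF r1 rR L N_def E])
  show "summable (\<lambda>n. nu ((Q ^^ n) V))" by (rule X.summable_nu_V)
  define v where "v = nu V"
  have v: "1 \<le> v" "v \<le> K" using nu_V_ge nu_le by (auto simp: v_def)
  define G where "G = (K - lam / \<gamma>) / (\<gamma> - lam)"
  have gl: "lam < \<gamma>" using rl gp by (simp add: r_def field_simps)
  have th: "r * X.th = 1 / (\<gamma> - lam)" unfolding X.th_def using gp gl by (simp add: r_def field_simps)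
  have cc: "X.cc = 0" "X.one.cc = 0" "X.cc' = 0" unfolding X.cc_def X.one.cc_def X.cc'_def by (simp_all add: at(1))
  have th1: "X.one.th = 1 / (1 - lam)" by (simp add: X.one.th_def)
  have V_bound: "X.V_bound \<le> G"
  proof -
    have "X.V_bound = 1 / (\<gamma> - lam) * (v - r * lam)" unfolding X.V_bound_def cc v_def th[symmetric] by simp
    also have "\<dots> = (v - lam / \<gamma>) / (\<gamma> - lam)" by (simp add: r_def)
    also have "\<dots> \<le> G" unfolding G_def using v gl by (intro divide_right_mono) auto
    finally show ?thesis .
  qed
  have G0: "1 \<le> G"
  proof -
    have "1 - lam / \<gamma> = (\<gamma> - lam) / \<gamma>" using gp by (simp add: field_simps)
    hence "1 / \<gamma> = (1 - lam / \<gamma>) / (\<gamma> - lam)" using gl by simp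
    also have "\<dots> \<le> G" unfolding G_def using K_ge_1 gl by (intro divide_right_mono) auto
    finally show ?thesis using r1 by (simp add: r_def)
  qed
  have \<kappa>2: "2 / (r - 1) \<le> \<kappa>" by (rule db(2))
  hence \<kappa>0: "0 \<le> \<kappa>" using r1 by (meson divide_nonneg_pos diff_gt_0_iff_gt order_trans zero_le_numeral)
  define Z where "Z = lam * (K - 1) / ((\<gamma> - lam) * (1 - lam))"
  have kV_bound: "X.kV_bound \<le> Z"
  proof -
    have "r * X.aa = lam / ((\<gamma> - lam) * (1 - lam))"
    proof -
      have "X.one.th - 1 = lam / (1 - lam)" using lam by (simp add: th1 field_simps)
      hence "r * X.aa = (lam / (1 - lam)) * (r * X.th)" by (simp add: X.aa_def)
      thus ?thesis unfolding th by simp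
    qed
    hence "X.kV_bound = lam * (v - 1) / ((\<gamma> - lam) * (1 - lam))" by (simp add: X.kV_bound_def cc v_def)
    also have "\<dots> \<le> Z" unfolding Z_def using v gl lam by (intro divide_right_mono mult_left_mono) auto
    finally show ?thesis .
  qed
  have Z0: "0 \<le> Z" unfolding Z_def using K_ge_1 gl lam by simp
  define mx where "mx = max lam (K - lam)"
  define T1 where "T1 = max lam (K - lam / \<gamma>) / (\<gamma> - lam)"
  have T1: "lam / (\<gamma> - lam) \<le> T1" unfolding T1_def using gl by (intro divide_right_mono) auto
  hence T10: "0 \<le> T1" using gl lam by (meson divide_nonneg_pos diff_gt_0_iff_gt order_trans less_imp_le)
  define m where "m = T1 + K / \<gamma> * G * \<kappa> + G * (mx / (1 - lam)) + Z"
  have Mat: "M_at lam K \<gamma> (ereal \<kappa>) = ereal m"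
    using gp gl lam unfolding M_at_def m_def T1_def G_def mx_def Z_def by simp
  have mx0: "0 \<le> mx / (1 - lam)" using lam by (simp add: mx_def)
  have Kg: "1 \<le> K / \<gamma>" using K_ge_1 \<gamma> gp by (simp add: field_simps)
  have m0: "0 \<le> m" unfolding m_def using T10 G0 \<kappa>0 mx0 Z0 Kg by (intro add_nonneg_nonneg mult_nonneg_nonneg) auto
  have W0: "1 \<le> W t x" "W t x \<le> V x" if "x \<in> space S" for x using W_bounds[OF that, of t] t by auto
  have bound: "geo_bound m (1 / r)"
    unfolding m_def
  proof (rule X.geo_bound_from_parts[OF db(3,4,1)])
    fix x assume x: "x \<in> space S"
    have V1: "1 \<le> V x" by (rule V_ge[OF x])
    note W0 = W0[OF x]
    show "X.V_majorant x - V x \<le> T1 * V x"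
    proof (cases "x \<in> C")
      case True thus ?thesis using T10 V1 by (simp add: X.V_majorant_in cc)
    next
      case False
      have "X.th - 1 = lam / (\<gamma> - lam)" using X.th_eq2 th by (simp add: mult_ac)
      moreover have "X.V_majorant x - V x = (X.th - 1) * (V x - 1)" using False by (simp add: X.V_majorant_out cc algebra_simps)
      ultimately have "X.V_majorant x - V x = lam / (\<gamma> - lam) * (V x - 1)" by simp
      also have "\<dots> \<le> lam / (\<gamma> - lam) * V x" using gl lam by (intro mult_left_mono) auto
      also have "\<dots> \<le> T1 * V x" using T1 V1 by (intro mult_right_mono) auto
      finally show ?thesis .
    qed
    have "W t x * X.V_bound \<le> W t x * G" using W0 V_bound by (intro mult_left_mono) auto
    also have "\<dots> \<le> V x * G" using W0 G0 by (intro mult_right_mono) auto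
    also have "\<dots> \<le> V x * (K / \<gamma> * G)" using mult_right_mono[OF Kg, of G] G0 V1 by (intro mult_left_mono) auto
    finally have "W t x * X.V_bound * \<kappa> \<le> V x * (K / \<gamma> * G) * \<kappa>" using \<kappa>0 by (intro mult_right_mono)
    thus "\<beta>' / X.D * W t x * X.V_bound * \<kappa> \<le> K / \<gamma> * G * \<kappa> * V x" by (simp add: mult_ac YD at(1))
    have "(W t x - 1) / (r - 1) * X.V_bound \<le> (W t x - 1) / (r - 1) * G"
      using W0 r1 V_bound by (intro mult_left_mono) auto
    also have "\<dots> \<le> lam * V x / (1 - lam) * G"
      using W_minus_1_le[OF x t(1,2)] G0 t(3) by (intro mult_right_mono) auto
    also have "\<dots> \<le> mx * V x / (1 - lam) * G"
      using V1 lam G0 by (intro mult_right_mono divide_right_mono) (auto simp: mx_def)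
    finally show "(\<beta>' / X.D * W t x - 1) / (r - 1) * X.V_bound \<le> G * (mx / (1 - lam)) * V x"
      by (simp add: mult_ac YD at(1))
  next
    have p: "0 \<le> G * (mx / (1 - lam))" using G0 mx0 by (intro mult_nonneg_nonneg) auto
    have "X.one.V_bound = (v - lam) / (1 - lam)" by (simp add: X.one.V_bound_def cc th1 v_def)
    also have "\<dots> \<le> mx / (1 - lam)" using v lam by (intro divide_right_mono) (auto simp: mx_def)
    also have "\<dots> \<le> G * (mx / (1 - lam))" using mult_right_mono[OF G0 mx0] by simp
    finally show "X.one.V_bound \<le> G * (mx / (1 - lam))" .
    have "1 \<le> r * (2 / (r - 1))" using r1 by (simp add: field_simps)
    also have "\<dots> \<le> r * \<kappa>" using \<kappa>2 r1 by (intro mult_left_mono) auto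
    finally have "1 \<le> r * \<kappa>" .
    moreover have "r * 1 \<le> (K * r) * G" using K_ge_1 r1 G0 by (intro mult_mono) auto
    hence "r \<le> K / \<gamma> * G" by (simp add: r_def)
    ultimately show "1 \<le> K / \<gamma> * G * \<kappa>" using \<kappa>0 by (meson mult_right_mono order_trans)
    show "0 \<le> G * (mx / (1 - lam))" by (rule p)
  qed (rule kV_bound T10 Z0)+
  show "\<exists>m\<ge>0. M_at lam K \<gamma> (K1 (1 / \<gamma>) \<beta> R (ereal (K / lam))) = ereal m \<and>
     geo_bound m \<gamma>"
    unfolding K1 using m0 Mat bound unfolding gr by blast
qed

context drift_chain
begin

lemma nu_V_le: "\<beta>' * nu V \<le> K"
proof -
  obtain a where a: "a \<in> C" by (rule C_nonempty)
  have "0 \<le> Q V a" 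

  proof (rule Q_nonneg[OF C_sub[OF a] Vb_V])
    show "0 \<le> V y" if "y \<in> space S" for y using V_ge[OF that] by linarith
  qed
  thus ?thesis using PV_in[OF a] by (simp add: Q_in[OF a] markov_op_def)
qed

lemma nu_V0_ge: "1 \<le> nu V0"
  using nu_mono[OF Vb_const Vb_V0, of 1] V0_bounds(1) by (simp add: nu_const)

text \<open>
  The three admissible choices of \<open>\<alpha>2\<close> differ only in the bound \<open>Kt\<close> for \<open>\<integral> V0 d\<nu>\<close>.
\<close>
lemma admissible_exponent:
  assumes "admissible_alpha2 S C \<nu> V \<beta>' lam K \<alpha>2"
  obtains Kt where "nu V0 \<le> Kt" "\<alpha>2 = 1 + ln Kt / ln (1 / lam)"
proof -
  interpret N: prob_space \<nu> by (rule \<nu>_prob)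
  consider "\<alpha>2 = 1 + ln (K / \<beta>') / ln (1 / lam)" | "measure \<nu> C = 1" "\<alpha>2 = 1" |
    K' where "emeasure \<nu> C + (\<integral>\<^sup>+x\<in>space S - C. ennreal (V x) \<partial>\<nu>) \<le> ennreal K'" "\<alpha>2 = 1 + ln K' / ln (1 / lam)"
    using assms unfolding admissible_alpha2_def by blast
  thus ?thesis
  proof cases
    case 1
    have "nu V0 \<le> nu V" by (intro nu_mono Vb_V0 Vb_V V0_bounds)
    also have "\<dots> \<le> K / \<beta>'" using nu_V_le \<beta>'_pos by (simp add: field_simps)
    finally show ?thesis using that 1 by blast
  next
    case 2
    have "nu V0 = (\<integral>y. 1 \<partial>\<nu>)"
      unfolding nu_def
    proof (rule integral_cong_AE)
      show "AE x in \<nu>. V0 x = 1" using N.AE_prob_1[OF 2(1)] by eventually_elim (simp add: V0_def)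
    qed (use V0_meas meas_\<nu> in auto)
    hence "nu V0 \<le> 1" using nu_const[of 1] by (simp add: nu_def)
    thus ?thesis using that[of 1] 2 by simp
  next
    case 3
    have "ennreal (nu V0) = (\<integral>\<^sup>+x. ennreal (V0 x) \<partial>\<nu>)"
      unfolding nu_def using V0_bounds(1)
      by (intro nn_integral_eq_integral[symmetric] int_\<nu> Vb_V0 AE_I2) (auto simp: space_\<nu> intro: order_trans[OF zero_le_one])
    also have "\<dots> = (\<integral>\<^sup>+x. indicator C x + ennreal (V x) * indicator (space S - C) x \<partial>\<nu>)"
      by (rule nn_integral_cong) (auto simp: V0_def space_\<nu> indicator_def)
    also have "\<dots> = emeasure \<nu> C + (\<integral>\<^sup>+x\<in>space S - C. ennreal (V x) \<partial>\<nu>)"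
      using C_sets V_meas by (subst nn_integral_add) (auto simp: sets_\<nu> meas_\<nu> measurable_cong_sets[OF sets_\<nu> refl])
    also have "\<dots> \<le> ennreal K'" by (rule 3(1))
    finally have "nu V0 \<le> K'" using nu_V0_ge by (auto simp: ennreal_le_iff2)
    thus ?thesis using that 3(2) by blast
  qed
qed

lemma alpha1_ge: assumes "\<beta>' < 1" shows "1 \<le> alpha1 \<beta>' lam K" and "1 \<le> (K - \<beta>') / (1 - \<beta>')"
proof -
  show "1 \<le> (K - \<beta>') / (1 - \<beta>')" using assms K_ge_1 by simp
  hence "0 \<le> ln ((K - \<beta>') / (1 - \<beta>'))" by simp
  moreover have "0 \<le> ln (1 / lam)" using lam by simp
  ultimately show "1 \<le> alpha1 \<beta>' lam K" unfolding alpha1_def by simp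
qed

text \<open>
  Jensen's inequality with the mean \<open>(K - \<beta>') / (1 - \<beta>')\<close> of \<open>V\<close> after a step from \<open>C\<close> without regeneration yields \<open>\<eta>\<close>, and
  with the mean \<open>Kt\<close> of \<open>V0\<close> under \<open>\<nu>\<close> it yields \<open>\<zeta>\<close> (both are upper bounds for the means).
\<close>
lemma nonatom_weight:
  assumes b1: "\<beta>' < 1" and Kt: "nu V0 \<le> Kt" and a2: "\<alpha>2 = 1 + ln Kt / ln (1 / lam)"
    and R: "1 < R" "R \<le> 1 / lam" and den: "(1 - \<beta>') * R powr alpha1 \<beta>' lam K < 1"
  obtains t where "0 < t" "t \<le> 1" "R = lam powr (- t)"
    "weight S P C \<nu> V \<beta> \<beta>' lam K t R ((1 - \<beta>') * R powr alpha1 \<beta>' lam K) (R powr \<alpha>2)"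
proof -
  obtain t where t: "0 < t" "t \<le> 1" "R = lam powr (- t)"
    "\<And>M. 0 < M \<Longrightarrow> R powr (1 + ln M / ln (1 / lam)) = R * M powr t"
    by (rule weight_exponent[OF R]) blast
  define M where "M = (K - \<beta>') / (1 - \<beta>')"
  have M: "1 \<le> M" using alpha1_ge(2)[OF b1] by (simp add: M_def)
  have Kt1: "1 \<le> Kt" using Kt nu_V0_ge by simp
  have "weight S P C \<nu> V \<beta> \<beta>' lam K t R ((1 - \<beta>') * R powr alpha1 \<beta>' lam K) (R powr \<alpha>2)"
  proof unfold_locales
    show "0 \<le> t" "t \<le> 1" "R = lam powr (- t)" using t by auto
    show "(1 - \<beta>') * R powr alpha1 \<beta>' lam K < 1" by (rule den)
    have "nu (W t) \<le> Kt powr t" using Kt Kt1 t by (intro nu_W) auto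
    hence "R * nu (W t) \<le> R * Kt powr t" using R by (intro mult_left_mono) auto
    also have "\<dots> = R powr \<alpha>2" using t(4)[of Kt] Kt1 a2 by simp
    finally show "R * nu (W t) \<le> R powr \<alpha>2" .
    fix x assume x: "x \<in> C"
    have "Q V0 x \<le> Q V x" by (intro Q_mono[OF C_sub[OF x]] Vb_V0 Vb_V V0_bounds)
    also have "\<dots> \<le> K - \<beta>' * nu V" using PV_in[OF x] by (simp add: Q_in[OF x] markov_op_def)
    also have "\<dots> \<le> K - \<beta>' * 1" using nu_V_ge \<beta>'_pos by (intro diff_left_mono mult_left_mono) auto
    also have "\<dots> = (1 - \<beta>') * M" using b1 by (simp add: M_def)
    finally have "Q (W t) x \<le> (1 - \<beta>') * M powr t" using M t by (intro Q_W x) auto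
    hence "R * Q (W t) x \<le> R * ((1 - \<beta>') * M powr t)" using R by (intro mult_left_mono) auto
    also have "\<dots> = (1 - \<beta>') * (R * M powr t)" by simp
    also have "R * M powr t = R powr alpha1 \<beta>' lam K" using t(4)[of M] M by (simp add: alpha1_def M_def)
    finally show "R * Q (W t) x \<le> (1 - \<beta>') * R powr alpha1 \<beta>' lam K" .
  qed
  thus ?thesis using that t by blast
qed

text \<open>
  The bounds hold with \<open>v = \<integral> V d\<nu>\<close>, which does not occur in \<open>M_non\<close>. A large \<open>v\<close> increases the sums started by a
  regeneration and leaves only \<open>K - \<beta>' v\<close> for the mean of \<open>V\<close> after a step from \<open>C\<close> without regeneration. As
  \<open>D \<le> \<beta>' \<zeta>\<close>, the combination \<open>x + \<zeta> y / D\<close> of the two contributions is at most \<open>\<zeta> (\<beta>' x + y) / D\<close>, in which \<open>v\<close> cancels.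
\<close>
lemma nonatom_bound:
  assumes b1: "\<beta>' < 1" and adm: "admissible_alpha2 S C \<nu> V \<beta>' lam K \<alpha>2"
    and R1: "1 < R" and RL: "R \<le> 1 / lam" and den: "(1 - \<beta>') * R powr alpha1 \<beta>' lam K < 1"
    and \<gamma>: "1 / R1 \<beta> R (L_non \<beta>' lam K \<alpha>2 R) < \<gamma>" "\<gamma> < 1" and L: "1 < \<beta>' * R powr \<alpha>2 / (1 - (1 - \<beta>') * R powr alpha1 \<beta>' lam K)"
  shows "\<exists>m\<ge>0. M_non \<beta>' lam K \<alpha>2 \<gamma> (K1 (1 / \<gamma>) \<beta> R (L_non \<beta>' lam K \<alpha>2 R)) = ereal m \<and>
     geo_bound m \<gamma>"
    and "summable (\<lambda>n. nu ((Q ^^ n) V))" and "0 < \<gamma>"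
proof -
  define \<alpha>1 where "\<alpha>1 = alpha1 \<beta>' lam K"
  define l where "l = \<beta>' * R powr \<alpha>2 / (1 - (1 - \<beta>') * R powr \<alpha>1)"
  have Leq: "L_non \<beta>' lam K \<alpha>2 R = ereal l" using den by (simp add: L_non_def Let_def l_def \<alpha>1_def)
  have l1: "1 < l" using L by (simp add: l_def \<alpha>1_def)
  note W = R1_works[OF R1 l1 \<beta>_pos]
  have gp: "0 < \<gamma>" using W(1) \<gamma>(1) unfolding Leq by (meson less_trans zero_less_divide_1_iff zero_less_one)
  show "0 < \<gamma>" by (rule gp)
  define r where "r = 1 / \<gamma>"
  have r1: "1 < r" using \<gamma> gp by (simp add: r_def)
  have rR1: "r < R1 \<beta> R (ereal l)" using \<gamma> gp W(1) by (simp add: r_def Leq field_simps)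
  have rR: "r < R" using rR1 W by simp
  have gr: "\<gamma> = 1 / r" using gp by (simp add: r_def)
  have a1: "1 \<le> \<alpha>1" using alpha1_ge[OF b1] by (simp add: \<alpha>1_def)
  obtain Kt where Kt: "nu V0 \<le> Kt" "\<alpha>2 = 1 + ln Kt / ln (1 / lam)" by (rule admissible_exponent[OF adm])
  have rl: "r * lam < 1"
  proof -
    have "r * lam < R * lam" using rR lam by simp
    also have "\<dots> \<le> 1" using RL lam by (simp add: field_simps)
    finally show ?thesis .
  qed
  have rL: "r \<le> 1 / lam" using rR RL by simp
  define A where "A = r powr \<alpha>1"
  have A1: "1 \<le> A" using r1 a1 by (simp add: A_def ge_one_powr_ge_zero)
  have "r powr \<alpha>1 < R powr \<alpha>1" using rR r1 a1 by (intro powr_less_mono2) auto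
  hence "(1 - \<beta>') * A < (1 - \<beta>') * R powr \<alpha>1" using b1 by (simp add: A_def)
  hence denr: "(1 - \<beta>') * r powr alpha1 \<beta>' lam K < 1" using den by (simp add: A_def \<alpha>1_def)
  obtain t where t: "0 < t" "t \<le> 1" "r = lam powr (- t)"
    and Xw: "weight S P C \<nu> V \<beta> \<beta>' lam K t r ((1 - \<beta>') * r powr alpha1 \<beta>' lam K) (r powr \<alpha>2)"
    using nonatom_weight[OF b1 Kt r1 rL denr] by blast
  obtain tR where Yw: "weight S P C \<nu> V \<beta> \<beta>' lam K tR R ((1 - \<beta>') * R powr alpha1 \<beta>' lam K) (R powr \<alpha>2)"
    using nonatom_weight[OF b1 Kt R1 RL den] by blast
  define v where "v = nu V"
  have v1: "1 \<le> v" using nu_V_ge by (simp add: v_def)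
  interpret X: excursion1 S P C \<nu> V \<beta> \<beta>' lam K t r "(1 - \<beta>') * r powr alpha1 \<beta>' lam K" "r powr \<alpha>2" "K - \<beta>' * nu V"
  proof -
    interpret weight S P C \<nu> V \<beta> \<beta>' lam K t r "(1 - \<beta>') * r powr alpha1 \<beta>' lam K" "r powr \<alpha>2" by (rule Xw)
    show "excursion1 S P C \<nu> V \<beta> \<beta>' lam K t r ((1 - \<beta>') * r powr alpha1 \<beta>' lam K) (r powr \<alpha>2) (K - \<beta>' * nu V)"
      by unfold_locales (use rl r1 PV_in in \<open>auto simp: Q_in markov_op_def\<close>)
  qed
  interpret Y: weight S P C \<nu> V \<beta> \<beta>' lam K tR R "(1 - \<beta>') * R powr alpha1 \<beta>' lam K" "R powr \<alpha>2" by (rule Yw)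
  define N where "N = (l - 1) / (R - 1)"
  have rt: "renewal_tail survival R N \<beta>"
    using Y.renewal_tail_weight[OF R1] by (simp add: Y.D_def N_def l_def \<alpha>1_def)
  have E: "renewal_err N R r < \<beta>" unfolding N_def by (rule renewal_err_less[OF R1 l1 \<beta>_pos r1 rR1])
  define \<kappa> where "\<kappa> = (2 * \<beta> + 2 * (ln N / ln (R / r)) - renewal_err N R r) / ((r - 1) * (\<beta> - renewal_err N R r))"
  note db = deviation_fps_bound[OF rt r1 rR E, folded \<kappa>_def]
  have K1: "K1 (1 / \<gamma>) \<beta> R (ereal l) = ereal \<kappa>"
    unfolding \<kappa>_def r_def[symmetric] by (rule K1_eq[OF r1 rR l1 N_def E])
  show "summable (\<lambda>n. nu ((Q ^^ n) V))" by (rule X.summable_nu_V)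
  define \<zeta> where "\<zeta> = r powr \<alpha>2"
  define D where "D = 1 - (1 - \<beta>') * A"
  have XD: "X.D = D" unfolding X.D_def D_def A_def \<alpha>1_def ..
  have D: "0 < D" "D \<le> \<beta>'" using X.D_pos X.D_le by (simp_all add: XD)
  have z1: "1 \<le> \<zeta>" using X.\<zeta>_ge by (simp add: \<zeta>_def)
  have gl: "lam < \<gamma>" using rl gp by (simp add: r_def field_simps)
  define q where "q = 1 / (\<gamma> - lam)"
  have q0: "0 < q" using gl by (simp add: q_def)
  have th: "r * X.th = q" unfolding X.th_def q_def using gp gl by (simp add: r_def field_simps)
  have qr: "q * (1 - r * lam) = r"
  proof -
    have "q * (1 - r * lam) = r * (X.th * (1 - r * lam))" using th by simp
    thus ?thesis using X.th_eq by simp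
  qed
  have th1: "X.one.th = 1 / (1 - lam)" unfolding X.one.th_def by simp
  have bD: "1 \<le> \<beta>' / D" using D by simp
  have cc: "X.cc = q * (K - \<beta>' * v - r * lam * (1 - \<beta>')) / D"
    unfolding X.cc_def XD th v_def ..
  \<comment> \<open>the value of \<open>cc\<close> for the least possible \<open>v\<close>, which is \<open>1\<close>\<close>
  define Y2 where "Y2 = q * (K - \<beta>' - r * lam * (1 - \<beta>')) / D"
  have cc_le: "X.cc \<le> Y2"
    unfolding cc Y2_def using q0 D \<beta>'_pos v1 by (intro divide_right_mono mult_left_mono) auto
  have Y20: "0 \<le> Y2" using cc_le X.cc_nonneg by simp
  define G where "G = \<zeta> * (q * (K - r * lam)) / D"
  have comb: "x + \<zeta> * y / D \<le> \<zeta> * (\<beta>' * x + y) / D" if "0 \<le> x" for x y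
  proof -
    have "1 * 1 \<le> \<zeta> * (\<beta>' / D)" using z1 bD by (intro mult_mono) linarith+
    from mult_right_mono[OF this that] have "x \<le> \<zeta> * (\<beta>' / D) * x" by simp
    thus ?thesis by (simp add: add_divide_distrib distrib_left mult_ac)
  qed
  have vr: "r * lam \<le> v" using rl v1 by simp
  have V_bound: "X.V_bound \<le> G"
  proof -
    have "X.V_bound = q * (v - r * lam) + \<zeta> * (q * (K - \<beta>' * v - r * lam * (1 - \<beta>'))) / D"
      unfolding X.V_bound_def cc th v_def \<zeta>_def by simp
    also have "\<dots> \<le> \<zeta> * (\<beta>' * (q * (v - r * lam)) + q * (K - \<beta>' * v - r * lam * (1 - \<beta>'))) / D"
      using q0 vr by (intro comb) auto
    also have "\<beta>' * (q * (v - r * lam)) + q * (K - \<beta>' * v - r * lam * (1 - \<beta>')) = q * (K - r * lam)"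
      by (simp add: algebra_simps)
    finally show ?thesis by (simp add: G_def)
  qed
  have G1: "1 / D \<le> G"
  proof -
    have "q * (1 - r * lam) \<le> q * (K - r * lam)" using q0 K_ge_1 by (intro mult_left_mono) auto
    hence "r \<le> q * (K - r * lam)" unfolding qr .
    hence "1 * 1 \<le> \<zeta> * (q * (K - r * lam))" using z1 r1 by (intro mult_mono) auto
    thus ?thesis unfolding G_def using D by (intro divide_right_mono) auto
  qed
  have Dinv: "1 \<le> 1 / \<beta>'" "1 / \<beta>' \<le> 1 / D" using D \<beta>'_pos b1 by (auto simp: field_simps)
  hence G1': "1 \<le> G" using G1 by linarith
  have \<kappa>2: "2 / (r - 1) \<le> \<kappa>" by (rule db(2))
  hence \<kappa>0: "0 \<le> \<kappa>" using r1 by (meson divide_nonneg_pos diff_gt_0_iff_gt order_trans zero_le_numeral)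
  define mx where "mx = max lam (K - lam)"
  define U where "U = \<beta>' * mx / (1 - lam) + (1 - \<beta>') * (A - 1) / (r - 1)"
  define Z1 where "Z1 = \<zeta> * (lam * (K - 1) / ((1 - lam) * (\<gamma> - lam))) / D"
  define c1 where "c1 = (K - \<beta>' - lam * (1 - \<beta>')) / (1 - lam)"
  define Z2 where "Z2 = c1 * (r / (r - 1)) * (((\<zeta> - 1) + (1 - \<beta>') * (A - 1) / \<beta>') / D)"
  have occ: "X.one.cc = (K - \<beta>' * v - lam * (1 - \<beta>')) / (1 - lam) / \<beta>'"
    unfolding X.one.cc_def X.one_D th1 v_def by simp
  have occ_le: "X.one.cc \<le> c1 / \<beta>'"
    unfolding occ c1_def using \<beta>'_pos lam v1 by (intro divide_right_mono) auto
  have kV_bound: "X.kV_bound \<le> Z1 + Z2"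
  proof -
    define a where "a = lam * (1 / ((1 - lam) * (\<gamma> - lam)))"
    have a0: "0 \<le> a" using lam gl by (simp add: a_def)
    have ra: "r * X.aa = a"
    proof -
      have "X.one.th - 1 = lam / (1 - lam)" using lam by (simp add: th1 field_simps)
      hence "r * X.aa = (lam / (1 - lam)) * (r * X.th)" by (simp add: X.aa_def)
      thus ?thesis unfolding th q_def a_def by simp
    qed
    have "X.cc' = a * (K - \<beta>' * v - (1 - \<beta>')) / D" unfolding X.cc'_def XD v_def ra by simp
    hence "a * (v - 1) + X.cc' * \<zeta> = a * (v - 1) + \<zeta> * (a * (K - \<beta>' * v - (1 - \<beta>'))) / D" by simp
    also have "\<dots> \<le> \<zeta> * (\<beta>' * (a * (v - 1)) + a * (K - \<beta>' * v - (1 - \<beta>'))) / D"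
      using a0 v1 by (intro comb) auto
    also have "\<beta>' * (a * (v - 1)) + a * (K - \<beta>' * v - (1 - \<beta>')) = a * (K - 1)" by (simp add: algebra_simps)
    also have "\<zeta> * (a * (K - 1)) / D = Z1" by (simp add: Z1_def a_def)
    finally have 1: "a * (v - 1) + X.cc' * \<zeta> \<le> Z1" .
    have bz: "1 \<le> \<beta>' * \<zeta> / D" using mult_mono[OF bD z1] bD by simp
    have "X.one.cc * (r * (\<beta>' * \<zeta> / D - 1) / (r - 1)) \<le> c1 / \<beta>' * (r * (\<beta>' * \<zeta> / D - 1) / (r - 1))"
      using occ_le bz r1 by (intro mult_right_mono) auto
    also have "\<dots> = c1 * (r / (r - 1)) * ((\<beta>' * \<zeta> / D - 1) / \<beta>')" by (simp add: mult_ac)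
    also have "(\<beta>' * \<zeta> / D - 1) / \<beta>' = ((\<zeta> - 1) + (1 - \<beta>') * (A - 1) / \<beta>') / D"
    proof -
      have "(1 - \<beta>') * (A - 1) / \<beta>' = (\<beta>' - D) / \<beta>'" by (simp add: D_def algebra_simps)
      also have "\<dots> = 1 - D / \<beta>'" using \<beta>'_pos by (simp add: diff_divide_distrib)
      finally have "((\<zeta> - 1) + (1 - \<beta>') * (A - 1) / \<beta>') / D = (\<zeta> - D / \<beta>') / D" by simp
      also have "\<dots> = (\<beta>' * \<zeta> / D - 1) / \<beta>'" using D \<beta>'_pos by (simp add: diff_divide_distrib)
      finally show ?thesis ..
    qed
    finally have 2: "X.one.cc * (r * (\<beta>' * \<zeta> / D - 1) / (r - 1)) \<le> Z2" by (simp add: Z2_def)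
    have "X.kV_bound = a * (v - 1) + X.cc' * \<zeta> + X.one.cc * (r * (\<beta>' * \<zeta> / D - 1) / (r - 1))"
      unfolding X.kV_bound_def XD ra v_def \<zeta>_def ..
    thus ?thesis using 1 2 by linarith
  qed
  have c10: "0 \<le> c1"
  proof -
    have "lam * (1 - \<beta>') \<le> 1 * (1 - \<beta>')" using lam b1 by (intro mult_right_mono) auto
    thus ?thesis unfolding c1_def using K_ge_1 lam by (intro divide_nonneg_pos) auto
  qed
  have Z0: "0 \<le> Z1 + Z2"
    unfolding Z1_def Z2_def using K_ge_1 lam gl z1 D c10 r1 A1 b1 \<beta>'_pos
    by (intro add_nonneg_nonneg mult_nonneg_nonneg divide_nonneg_pos) auto
  define T1 where "T1 = max lam (K - lam / \<gamma>) / (\<gamma> - lam)"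
  have T1: "lam / (\<gamma> - lam) \<le> T1" unfolding T1_def using gl by (intro divide_right_mono) auto
  hence T10: "0 \<le> T1" using gl lam by (meson divide_nonneg_pos diff_gt_0_iff_gt order_trans less_imp_le)
  define m where "m = T1 + K / \<gamma> * Y2 + \<beta>' / D * (K / \<gamma>) * G * \<kappa> + G / D * U + Z1 + Z2"
  have Mnon: "M_non \<beta>' lam K \<alpha>2 \<gamma> (ereal \<kappa>) = ereal m"
  proof -
    have p1: "\<gamma> powr (- \<alpha>1) = A" unfolding A_def r_def using gp by (simp add: powr_divide powr_minus_divide)
    have p2: "\<gamma> powr (- \<alpha>2) = \<zeta>" unfolding \<zeta>_def r_def using gp by (simp add: powr_divide powr_minus_divide)
    have p3: "\<gamma> powr (- \<alpha>2 - 1) = \<zeta> / \<gamma>" using gp p2 by (simp add: powr_diff)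
    have p4: "\<gamma> powr (- \<alpha>2 - 2) = \<zeta> / \<gamma>\<^sup>2" using gp p2 by (simp add: powr_diff)
    have nz: "\<gamma> \<noteq> 0" "\<gamma> - lam \<noteq> 0" "1 - lam \<noteq> 0" "1 - \<gamma> \<noteq> 0" "\<beta>' \<noteq> 0" "D \<noteq> 0"
      using gp gl lam \<gamma> \<beta>'_pos D by auto
    have e2: "K * (K * \<gamma> - lam - \<beta>' * (\<gamma> - lam)) / (\<gamma>\<^sup>2 * (\<gamma> - lam) * D) = K / \<gamma> * Y2"
    proof -
      have "K - \<beta>' - r * lam * (1 - \<beta>') = (K * \<gamma> - lam - \<beta>' * (\<gamma> - lam)) / \<gamma>"
        using gp by (simp add: r_def field_simps)
      thus ?thesis unfolding Y2_def q_def by (simp add: power2_eq_square mult_ac)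
    qed
    have Kr: "K - r * lam = (K * \<gamma> - lam) / \<gamma>" using gp by (simp add: r_def field_simps)
    have e3: "\<beta>' * (\<zeta> / \<gamma>\<^sup>2) * K * (K * \<gamma> - lam) / ((\<gamma> - lam) * D\<^sup>2) * \<kappa> = \<beta>' / D * (K / \<gamma>) * G * \<kappa>"
      unfolding G_def q_def Kr by (simp add: power2_eq_square mult_ac)
    have e4: "\<zeta> / \<gamma> * (K * \<gamma> - lam) / ((\<gamma> - lam) * D\<^sup>2)
               * (\<beta>' * mx / (1 - lam) + (1 - \<beta>') * (A - 1) / (1 / \<gamma> - 1)) = G / D * U"
      unfolding G_def q_def Kr U_def unfolding r_def by (simp add: power2_eq_square mult_ac)
    have e5: "\<zeta> * lam * (K - 1) / ((1 - lam) * (\<gamma> - lam) * D) = Z1" by (simp add: Z1_def mult_ac)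
    have e6: "(K - lam - \<beta>' * (1 - lam)) / ((1 - lam) * (1 - \<gamma>) * D)
               * ((\<zeta> - 1) + (1 - \<beta>') * (A - 1) / \<beta>') = Z2"
    proof -
      have "r / (r - 1) = 1 / (1 - \<gamma>)" using gp \<gamma> by (simp add: r_def field_simps)
      moreover have "K - lam - \<beta>' * (1 - lam) = K - \<beta>' - lam * (1 - \<beta>')" by (simp add: algebra_simps)
      ultimately show ?thesis unfolding Z2_def c1_def by (simp add: mult_ac)
    qed
    show ?thesis
      unfolding M_non_def Let_def \<alpha>1_def[symmetric] p1 p2 p3 p4 D_def[symmetric] mx_def[symmetric] T1_def[symmetric]
      unfolding real_of_ereal.simps e2 e3 e4 e5 e6
      using nz by (simp add: m_def)
  qed
  have mx0: "0 \<le> mx" using lam by (simp add: mx_def)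
  have U0: "0 \<le> U" unfolding U_def using mx0 lam \<beta>'_pos b1 A1 r1 by (intro add_nonneg_nonneg divide_nonneg_pos mult_nonneg_nonneg) auto
  have Kg: "1 \<le> K / \<gamma>" using K_ge_1 \<gamma> gp by (simp add: field_simps)
  have t30: "0 \<le> \<beta>' / D * (K / \<gamma>) * G * \<kappa>" using bD Kg G1' \<kappa>0 by (intro mult_nonneg_nonneg) linarith+
  have t40: "0 \<le> G / D * U" using G1' D U0 by (intro mult_nonneg_nonneg divide_nonneg_pos) auto
  have t20: "0 \<le> K / \<gamma> * Y2" using Kg Y20 by (intro mult_nonneg_nonneg) auto
  have m0: "0 \<le> m" unfolding m_def using T10 t20 t30 t40 Z0 by linarith
  have bound: "geo_bound ((T1 + K / \<gamma> * Y2) + \<beta>' / D * (K / \<gamma>) * G * \<kappa> + G / D * U + (Z1 + Z2)) (1 / r)"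
  proof (rule X.geo_bound_from_parts[OF db(3,4,1)], unfold XD)
    fix x assume x: "x \<in> space S"
    have V1: "1 \<le> V x" by (rule V_ge[OF x])
    have mV: "y \<le> y * V x" if "0 \<le> y" for y using mult_left_mono[OF V1 that] by simp
    have W0: "1 \<le> W t x" "W t x \<le> V x" using W_bounds[OF x, of t] t by auto
    have ccV: "X.cc * W t x \<le> K / \<gamma> * Y2 * V x"
    proof (intro mult_mono W0(2))
      show "X.cc \<le> K / \<gamma> * Y2" using cc_le mult_right_mono[OF Kg Y20] by linarith
    qed (use W0 t20 in auto)
    have "X.V_majorant x - V x \<le> T1 * V x + K / \<gamma> * Y2 * V x"
    proof (cases "x \<in> C")
      case True
      have "X.V_majorant x - V x = X.cc * W t x" using True by (simp add: X.V_majorant_in W_in)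
      moreover have "0 \<le> T1 * V x" using T10 V1 by simp
      ultimately show ?thesis using ccV by linarith
    next
      case False
      have "X.th - 1 = lam * (r * X.th)" using X.th_eq2 by simp
      hence th': "X.th - 1 = lam / (\<gamma> - lam)" unfolding th q_def by simp
      have "X.V_majorant x - V x = (X.th - 1) * (V x - 1) + X.cc * W t x" unfolding X.V_majorant_out[OF False] by (simp add: algebra_simps)
      also have "(X.th - 1) * (V x - 1) \<le> (X.th - 1) * V x" using X.th_ge by (intro mult_left_mono) auto
      also have "(X.th - 1) * V x \<le> T1 * V x" unfolding th' using T1 V1 by (intro mult_right_mono) auto
      finally show ?thesis using ccV by linarith
    qed
    thus "X.V_majorant x - V x \<le> (T1 + K / \<gamma> * Y2) * V x" by (simp only: distrib_right)
    show "\<beta>' / D * W t x * X.V_bound * \<kappa> \<le> \<beta>' / D * (K / \<gamma>) * G * \<kappa> * V x"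
    proof -
      have s1: "\<beta>' / D * W t x * X.V_bound \<le> \<beta>' / D * W t x * G" using W0 V_bound bD by (intro mult_left_mono mult_nonneg_nonneg) linarith+
      have s2: "\<beta>' / D * G * W t x \<le> \<beta>' / D * G * V x" using W0 G1' bD by (intro mult_left_mono mult_nonneg_nonneg) linarith+
      have s3: "\<beta>' / D * G * V x * 1 \<le> \<beta>' / D * G * V x * (K / \<gamma>)"
        using Kg G1' bD V1 by (intro mult_left_mono mult_nonneg_nonneg) linarith+
      have "\<beta>' / D * W t x * X.V_bound \<le> \<beta>' / D * G * V x * (K / \<gamma>)" using s1 s2 s3 by (simp add: mult_ac)
      from mult_right_mono[OF this \<kappa>0] show ?thesis by (simp add: mult_ac)
    qed
    show "(\<beta>' / D * W t x - 1) / (r - 1) * X.V_bound \<le> G / D * U * V x"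
    proof -
      have bW: "1 \<le> \<beta>' / D * W t x" using mult_mono[OF bD W0(1)] bD by simp
      have e: "(\<beta>' / D * W t x - 1) / (r - 1) = (\<beta>' * ((W t x - 1) / (r - 1)) + (1 - \<beta>') * (A - 1) / (r - 1)) / D"
      proof -
        have "\<beta>' / D * W t x - 1 = (\<beta>' * (W t x - 1) + (1 - \<beta>') * (A - 1)) / D"
        proof -
          have "\<beta>' / D * W t x - 1 = (\<beta>' * W t x - D) / D" using D by (simp add: diff_divide_distrib)
          also have "\<beta>' * W t x - D = \<beta>' * (W t x - 1) + (1 - \<beta>') * (A - 1)" by (simp add: D_def algebra_simps)
          finally show ?thesis .
        qed
        thus ?thesis by (simp add: add_divide_distrib mult_ac)
      qed
      have "(W t x - 1) / (r - 1) \<le> lam * V x / (1 - lam)" using W_minus_1_le[OF x t(1,2)] t(3) by simp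
      also have "\<dots> \<le> mx * V x / (1 - lam)" using V1 lam by (intro divide_right_mono mult_right_mono) (auto simp: mx_def)
      finally have "\<beta>' * ((W t x - 1) / (r - 1)) \<le> \<beta>' * (mx * V x / (1 - lam))" using \<beta>'_pos by (intro mult_left_mono) auto
      moreover have "(1 - \<beta>') * (A - 1) / (r - 1) \<le> (1 - \<beta>') * (A - 1) / (r - 1) * V x"
        using b1 A1 r1 by (intro mV) auto
      ultimately have "\<beta>' * ((W t x - 1) / (r - 1)) + (1 - \<beta>') * (A - 1) / (r - 1) \<le> U * V x"
      proof -
        have "U * V x = \<beta>' * (mx * V x / (1 - lam)) + (1 - \<beta>') * (A - 1) / (r - 1) * V x"
          unfolding U_def by (simp add: distrib_right)
        thus "\<beta>' * ((W t x - 1) / (r - 1)) \<le> \<beta>' * (mx * V x / (1 - lam)) \<Longrightarrow>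
          (1 - \<beta>') * (A - 1) / (r - 1) \<le> (1 - \<beta>') * (A - 1) / (r - 1) * V x \<Longrightarrow>
          \<beta>' * ((W t x - 1) / (r - 1)) + (1 - \<beta>') * (A - 1) / (r - 1) \<le> U * V x" by linarith
      qed
      hence le: "(\<beta>' / D * W t x - 1) / (r - 1) \<le> U * V x / D" unfolding e using D by (intro divide_right_mono) auto
      have "(\<beta>' / D * W t x - 1) / (r - 1) * X.V_bound \<le> (\<beta>' / D * W t x - 1) / (r - 1) * G"
        using bW r1 V_bound by (intro mult_left_mono) auto
      also have "\<dots> \<le> U * V x / D * G" using le G1' by (intro mult_right_mono) auto
      finally show ?thesis by (simp add: mult_ac)
    qed
  next
    have "X.one.V_bound = 1 / (1 - lam) * (v - lam) + X.one.cc" unfolding X.one.V_bound_def th1 v_def by simp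
    also have "\<dots> = (K - lam) / (1 - lam) / \<beta>'"
      unfolding occ using \<beta>'_pos lam by (simp add: divide_simps) (simp add: algebra_simps)
    also have "\<dots> \<le> mx / (1 - lam) / \<beta>'" unfolding mx_def using \<beta>'_pos lam by (intro divide_right_mono) auto
    also have "\<dots> = (1 / \<beta>') * (1 / \<beta>') * (\<beta>' * mx / (1 - lam))" using \<beta>'_pos by simp
    also have "\<dots> \<le> G * (1 / D) * U"
    proof (intro mult_mono)
      show "1 / \<beta>' \<le> G" "1 / \<beta>' \<le> 1 / D" using Dinv G1 by auto
      show "\<beta>' * mx / (1 - lam) \<le> U" unfolding U_def using b1 A1 r1 by simp
    qed (use Dinv G1' mx0 lam \<beta>'_pos D in auto)
    also have "\<dots> = G / D * U" by simp
    finally show "X.one.V_bound \<le> G / D * U" .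
    have "1 \<le> r * (2 / (r - 1))" using r1 by (simp add: field_simps)
    also have "\<dots> \<le> r * \<kappa>" using \<kappa>2 r1 by (intro mult_left_mono) auto
    finally have "1 \<le> r * \<kappa>" .
    moreover have "1 * r * 1 \<le> \<beta>' / D * (K / \<gamma>) * G"
    proof (intro mult_mono bD G1')
      have "r * 1 \<le> r * K" using r1 K_ge_1 by (intro mult_left_mono) auto
      thus "r \<le> K / \<gamma>" by (simp add: r_def)
      show "0 \<le> \<beta>' / D * (K / \<gamma>)" by (rule mult_nonneg_nonneg) (use bD Kg in linarith)+
    qed (use r1 bD Kg in linarith)+
    ultimately show "1 \<le> \<beta>' / D * (K / \<gamma>) * G * \<kappa>" using mult_right_mono[OF _ \<kappa>0] by (metis mult_1 mult.right_neutral order_trans)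
  qed (use T10 t20 t40 Z0 kV_bound in linarith)+
  show "\<exists>m\<ge>0. M_non \<beta>' lam K \<alpha>2 \<gamma> (K1 (1 / \<gamma>) \<beta> R (L_non \<beta>' lam K \<alpha>2 R)) = ereal m \<and>
     geo_bound m \<gamma>"
    unfolding Leq K1 using m0 Mnon bound unfolding gr m_def by (auto simp: add.assoc)
qed

end

section \<open>The convergence theorem\<close>

lemma (in drift_chain) V_norm_finite_Vb:
  assumes g: "g \<in> borel_measurable S" and fin: "V_norm S V g < \<infinity>"
  shows "g \<in> Vb"
proof -
  obtain n where n: "V_norm S V g < ereal (real n)" using fin less_PInf_Ex_of_nat by auto
  show ?thesis
  proof (rule VbI[OF g, where c = "real n"])
    fix x assume x: "x \<in> space S"
    have "ereal (\<bar>g x\<bar> / V x) \<le> V_norm S V g" unfolding V_norm_def by (rule SUP_upper[OF x])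
    hence "\<bar>g x\<bar> / V x \<le> real n" using n by (metis ereal_less_eq(3) le_less_trans less_imp_le)
    thus "\<bar>g x\<bar> \<le> real n * V x" using V_ge[OF x] by (simp add: field_simps)
  qed
qed

lemma (in geometric_chain) stationary_iff: "stationary_prob S P \<pi> \<longleftrightarrow> \<pi> = inv_measure"
  using stationary_unique stationary_inv_measure by blast

lemma (in geometric_chain) sup_bound:
  assumes gb: "geo_bound m \<delta>" and x: "x \<in> space S"
  shows "(SUP g\<in>{g \<in> borel_measurable S. \<forall>y\<in>space S. \<bar>g y\<bar> \<le> V y}.
            ereal \<bar>Pn n g x - (\<integral>y. g y \<partial>inv_measure)\<bar>) \<le> ereal m * ereal (V x * \<delta> ^ n)"
proof (rule SUP_least)
  fix g assume "g \<in> {g \<in> borel_measurable S. \<forall>y\<in>space S. \<bar>g y\<bar> \<le> V y}"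
  hence g: "g \<in> borel_measurable S" "\<And>y. y \<in> space S \<Longrightarrow> \<bar>g y\<bar> \<le> V y" by auto
  have "(\<integral>y. g y \<partial>inv_measure) = ell g" by (rule integral_inv_measure_ell[OF Vb_dom[OF g Vb_V]])
  thus "ereal \<bar>Pn n g x - (\<integral>y. g y \<partial>inv_measure)\<bar> \<le> ereal m * ereal (V x * \<delta> ^ n)"
    using gb g x unfolding geo_bound_def by (simp add: mult.assoc)
qed

text \<open>
  One rate \<open>\<gamma>0\<close> suffices for everything that concerns the stationary measure; every other rate then only needs its own bound.
\<close>
lemma (in drift_chain) ergodic_conclusion:
  assumes \<rho>: "\<rho> < 1"
    and sv: "summable (\<lambda>n. nu ((Q ^^ n) V))"
    and rate: "\<And>\<gamma>. \<rho> < \<gamma> \<Longrightarrow> \<gamma> < 1 \<Longrightarrow> 0 < \<gamma> \<and> (\<exists>m\<ge>0. Mf \<gamma> = ereal m \<and>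
     geo_bound m \<gamma>)"
  shows "\<exists>!\<pi>. stationary_prob S P \<pi>"
    and "stationary_prob S P \<pi> \<Longrightarrow> (\<integral>\<^sup>+x. ennreal (V x) \<partial>\<pi>) < \<infinity>"
    and "stationary_prob S P \<pi> \<Longrightarrow> g \<in> borel_measurable S \<Longrightarrow> V_norm S V g < \<infinity> \<Longrightarrow> integrable \<pi> g"
    and "stationary_prob S P \<pi> \<Longrightarrow> \<rho> < \<gamma> \<Longrightarrow> \<gamma> < 1 \<Longrightarrow> Mf \<gamma> < \<infinity> \<and>
       (\<forall>x\<in>space S. \<forall>n. (SUP g\<in>{g \<in> borel_measurable S. \<forall>y\<in>space S. \<bar>g y\<bar> \<le> V y}.
            ereal \<bar>Pn n g x - (\<integral>y. g y \<partial>\<pi>)\<bar>) \<le> Mf \<gamma> * ereal (V x * \<gamma> ^ n))"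
proof -
  define \<gamma>0 where "\<gamma>0 = (\<rho> + 1) / 2"
  have g0: "\<rho> < \<gamma>0" "\<gamma>0 < 1" using \<rho> by (auto simp: \<gamma>0_def)
  obtain m0 where m0: "0 < \<gamma>0" "0 \<le> m0" "geo_bound m0 \<gamma>0"
    using rate[OF g0] by blast
  interpret G: geometric_chain S P C \<nu> V \<beta> \<beta>' lam K m0 \<gamma>0
    by unfold_locales (use m0 g0 sv in auto)
  show "\<exists>!\<pi>. stationary_prob S P \<pi>" by (simp add: G.stationary_iff)
  show "(\<integral>\<^sup>+x. ennreal (V x) \<partial>\<pi>) < \<infinity>" if "stationary_prob S P \<pi>"
    using G.V_inv_measure that by (simp add: G.stationary_iff)
  show "integrable \<pi> g" if "stationary_prob S P \<pi>" "g \<in> borel_measurable S" "V_norm S V g < \<infinity>"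
    using G.int_inv_measure[OF V_norm_finite_Vb[OF that(2,3)]] that(1) by (simp add: G.stationary_iff)
  assume st: "stationary_prob S P \<pi>" and \<gamma>: "\<rho> < \<gamma>" "\<gamma> < 1"
  obtain m where m: "Mf \<gamma> = ereal m" "geo_bound m \<gamma>"
    using rate[OF \<gamma>] by blast
  have "\<pi> = G.inv_measure" using st by (simp add: G.stationary_iff)
  thus "Mf \<gamma> < \<infinity> \<and>
       (\<forall>x\<in>space S. \<forall>n. (SUP g\<in>{g \<in> borel_measurable S. \<forall>y\<in>space S. \<bar>g y\<bar> \<le> V y}.
            ereal \<bar>Pn n g x - (\<integral>y. g y \<partial>\<pi>)\<bar>) \<le> Mf \<gamma> * ereal (V x * \<gamma> ^ n))"
    using G.sup_bound[OF m(2)] by (simp only: m(1)) simp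
qed

theorem theorem1p1:
  fixes S :: "'a measure" and P :: "'a \<Rightarrow> 'a measure" and C :: "'a set"
    and \<nu> :: "'a measure" and V :: "'a \<Rightarrow> real"
    and \<beta> \<beta>' lam K \<alpha>2 :: real
  assumes kernel: "P \<in> measurable S (prob_algebra S)"
    and A1: "minorization S P C \<beta>' \<nu>"
    and A2: "drift S P C V lam K"
    and A3: "strong_aperiodicity C \<beta>' \<nu> \<beta>"
    and atom: "is_atom P C \<Longrightarrow> \<beta>' = 1 \<and> (\<forall>x\<in>C. \<nu> = P x)"
    and nonatom: "\<not> is_atom P C \<Longrightarrow> \<beta>' < 1"
    and alpha2: "\<not> is_atom P C \<Longrightarrow> admissible_alpha2 S C \<nu> V \<beta>' lam K \<alpha>2"
  shows
    "(\<exists>!\<pi>. stationary_prob S P \<pi>) \<and>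
     (\<not> is_atom P C \<longrightarrow> (\<exists>Rt. is_R_tilde \<beta> \<beta>' lam K \<alpha>2 Rt)) \<and>
     (\<forall>\<pi>. stationary_prob S P \<pi> \<longrightarrow>
        (\<integral>\<^sup>+x. ennreal (V x) \<partial>\<pi>) < \<infinity> \<and>
        (\<forall>g\<in>borel_measurable S. V_norm S V g < \<infinity> \<longrightarrow>
           integrable \<pi> g \<and> (\<forall>n. \<forall>x\<in>space S. integrable (P x) ((markov_op P ^^ n) g))) \<and>
        (\<forall>Rt. (\<not> is_atom P C \<longrightarrow> is_R_tilde \<beta> \<beta>' lam K \<alpha>2 Rt) \<longrightarrow>
           (let \<rho> = (if is_atom P C then 1 / R1 \<beta> (1 / lam) (ereal (K / lam))
                     else 1 / R1 \<beta> Rt (L_non \<beta>' lam K \<alpha>2 Rt))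
            in \<rho> < 1 \<and>
               (\<forall>\<gamma>. \<rho> < \<gamma> \<and> \<gamma> < 1 \<longrightarrow>
                  (let M = (if is_atom P C
                            then M_at lam K \<gamma> (K1 (1 / \<gamma>) \<beta> (1 / lam) (ereal (K / lam)))
                            else M_non \<beta>' lam K \<alpha>2 \<gamma>
                                   (K1 (1 / \<gamma>) \<beta> Rt (L_non \<beta>' lam K \<alpha>2 Rt)))
                   in M < \<infinity> \<and>
                      (\<forall>x\<in>space S. \<forall>n.
                         (SUP g\<in>{g \<in> borel_measurable S. \<forall>y\<in>space S. \<bar>g y\<bar> \<le> V y}.
                            ereal \<bar>(markov_op P ^^ n) g x - (\<integral>y. g y \<partial>\<pi>)\<bar>)
                         \<le> M * ereal (V x * \<gamma> ^ n)))))))"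
proof -
  interpret drift_chain S P C \<nu> V \<beta> \<beta>' lam K
    by (rule drift_chain.intro[OF kernel A1 A2 A3])
  have intP: "integrable (P x) ((markov_op P ^^ n) g)"
    if "g \<in> borel_measurable S" "V_norm S V g < \<infinity>" "x \<in> space S" for g n x
    by (intro int_P Vb_Pn V_norm_finite_Vb that)
  show ?thesis
  proof (cases "is_atom P C")
    case True
    have at: "\<beta>' = 1" "\<forall>x\<in>C. \<nu> = P x" using atom[OF True] by auto
    define \<rho> where "\<rho> = 1 / R1 \<beta> (1 / lam) (ereal (K / lam))"
    have "1 < R1 \<beta> (1 / lam) (ereal (K / lam))" using lam K_ge_1 \<beta>_pos by (intro R1_works) auto
    hence \<rho>: "\<rho> < 1" by (simp add: \<rho>_def)
    note B = atom_bound[OF at, folded \<rho>_def]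
    have "\<rho> < (\<rho> + 1) / 2" "(\<rho> + 1) / 2 < 1" using \<rho> by auto
    note sv = B(2)[OF this]
    note E = ergodic_conclusion[OF \<rho> sv, of "\<lambda>\<gamma>. M_at lam K \<gamma> (K1 (1 / \<gamma>) \<beta> (1 / lam) (ereal (K / lam)))"]
    have rate: "0 < \<gamma> \<and> (\<exists>m\<ge>0. M_at lam K \<gamma> (K1 (1 / \<gamma>) \<beta> (1 / lam) (ereal (K / lam))) = ereal m \<and>
     geo_bound m \<gamma>)" if "\<rho> < \<gamma>" "\<gamma> < 1" for \<gamma>
      using B(1)[OF that] B(3)[OF that] by blast
    note E = E[OF rate]
    show ?thesis
      using E(1) E(2) E(3) E(4) intP \<rho> True unfolding Let_def by (simp only: if_True \<rho>_def[symmetric] not_True_eq_False) blast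
  next
    case False
    note b1 = nonatom[OF False] and adm = alpha2[OF False]
    define a1 where "a1 = alpha1 \<beta>' lam K"
    have a1: "1 \<le> a1" using alpha1_ge(1)[OF b1] by (simp add: a1_def)
    obtain Kt where Kt: "nu V0 \<le> Kt" "\<alpha>2 = 1 + ln Kt / ln (1 / lam)" by (rule admissible_exponent[OF adm])
    have a2: "0 \<le> \<alpha>2" 
    proof -
      have "0 \<le> ln Kt" using Kt(1) nu_V0_ge by simp
      moreover have "0 \<le> ln (1 / lam)" using lam by simp
      ultimately show ?thesis unfolding Kt(2) by simp
    qed
    have R0: "1 < R0 \<beta>' lam K"
    proof -
      have "(1 - \<beta>') powr 0 < (1 - \<beta>') powr (- 1 / a1)"
        using b1 \<beta>'_pos a1 by (intro powr_less_mono') auto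
      thus ?thesis using b1 lam by (simp add: R0_def a1_def)
    qed
    have den: "(1 - \<beta>') * R powr a1 \<le> 1" if "1 \<le> R" "R \<le> R0 \<beta>' lam K" for R
    proof -
      have "R powr a1 \<le> ((1 - \<beta>') powr (- 1 / a1)) powr a1"
        using that a1 by (intro powr_mono2) (auto simp: R0_def a1_def)
      also have "\<dots> = 1 / (1 - \<beta>')" 
      proof -
        have e: "- 1 / a1 * a1 = - 1" using a1 by simp
        show ?thesis unfolding powr_powr e using b1 by (simp add: powr_minus_divide)
      qed
      finally show ?thesis using b1 by (simp add: field_simps)
    qed
    have den': "\<forall>R\<in>{1..R0 \<beta>' lam K}. (1 - \<beta>') * R powr a1 \<le> 1" using den by auto
    note AM = R1_argmax[OF \<beta>_pos \<beta>'_pos b1 _ a2 R0 den']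
    have is_R: "is_R_tilde \<beta> \<beta>' lam K \<alpha>2 = is_arg_max
       (\<lambda>R. R1 \<beta> R (let d = 1 - (1 - \<beta>') * R powr a1 in if d = 0 then \<infinity> else ereal (\<beta>' * R powr \<alpha>2 / d)))
       (\<lambda>R. 1 < R \<and> R \<le> R0 \<beta>' lam K)"
      unfolding is_R_tilde_def[abs_def] L_non_def a1_def ..
    have a1p: "0 < a1" using a1 by simp
    have ex: "\<exists>Rt. is_R_tilde \<beta> \<beta>' lam K \<alpha>2 Rt" unfolding is_R by (rule AM(1)[OF a1p])
    have props: "1 < Rt" "Rt \<le> 1 / lam" "(1 - \<beta>') * Rt powr alpha1 \<beta>' lam K < 1"
      "1 < \<beta>' * Rt powr \<alpha>2 / (1 - (1 - \<beta>') * Rt powr alpha1 \<beta>' lam K)"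
      "1 / R1 \<beta> Rt (L_non \<beta>' lam K \<alpha>2 Rt) < 1" if "is_R_tilde \<beta> \<beta>' lam K \<alpha>2 Rt" for Rt
    proof -
      show 1: "1 < Rt" and "Rt \<le> 1 / lam" using that unfolding is_R_tilde_def is_arg_max_def R0_def by auto
      show 2: "(1 - \<beta>') * Rt powr alpha1 \<beta>' lam K < 1" using AM(2)[OF a1p] that unfolding is_R a1_def .
      show 3: "1 < \<beta>' * Rt powr \<alpha>2 / (1 - (1 - \<beta>') * Rt powr alpha1 \<beta>' lam K)"
        using AM(3)[OF a1p] 1 2 unfolding a1_def by blast
      have "1 < R1 \<beta> Rt (L_non \<beta>' lam K \<alpha>2 Rt)"
        using R1_works(1)[OF 1 3 \<beta>_pos] 2 by (simp add: L_non_def)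
      thus "1 / R1 \<beta> Rt (L_non \<beta>' lam K \<alpha>2 Rt) < 1" by simp
    qed
    define Mf where "Mf = (\<lambda>Rt \<gamma>. M_non \<beta>' lam K \<alpha>2 \<gamma> (K1 (1 / \<gamma>) \<beta> Rt (L_non \<beta>' lam K \<alpha>2 Rt)))"
    define rho where "rho = (\<lambda>Rt. 1 / R1 \<beta> Rt (L_non \<beta>' lam K \<alpha>2 Rt))"
    have E: "(\<exists>!\<pi>. stationary_prob S P \<pi>) \<and>
      (\<forall>\<pi>. stationary_prob S P \<pi> \<longrightarrow> (\<integral>\<^sup>+x. ennreal (V x) \<partial>\<pi>) < \<infinity> \<and>
        (\<forall>g\<in>borel_measurable S. V_norm S V g < \<infinity> \<longrightarrow> integrable \<pi> g) \<and>
        (rho Rt < 1 \<and> (\<forall>\<gamma>. rho Rt < \<gamma> \<and> \<gamma> < 1 \<longrightarrow> Mf Rt \<gamma> < \<infinity> \<and>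
       (\<forall>x\<in>space S. \<forall>n. (SUP g\<in>{g \<in> borel_measurable S. \<forall>y\<in>space S. \<bar>g y\<bar> \<le> V y}.
            ereal \<bar>(markov_op P ^^ n) g x - (\<integral>y. g y \<partial>\<pi>)\<bar>) \<le> Mf Rt \<gamma> * ereal (V x * \<gamma> ^ n)))))"
      if "is_R_tilde \<beta> \<beta>' lam K \<alpha>2 Rt" for Rt
    proof -
      note p = props[OF that]
      note B = nonatom_bound[OF b1 adm p(1,2,3) _ _ p(4), folded rho_def]
      have \<rho>: "rho Rt < 1" using p(5) by (simp add: rho_def)
      have h: "rho Rt < (rho Rt + 1) / 2" "(rho Rt + 1) / 2 < 1" using \<rho> by auto
      have sv: "summable (\<lambda>n. nu ((Q ^^ n) V))" using B(2) h unfolding rho_def by blast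
      have rate: "0 < \<gamma> \<and> (\<exists>m\<ge>0. Mf Rt \<gamma> = ereal m \<and>
         geo_bound m \<gamma>)" if "rho Rt < \<gamma>" "\<gamma> < 1" for \<gamma>
        using B(1)[of \<gamma>] B(3)[of \<gamma>] that unfolding rho_def Mf_def by blast
      note E = ergodic_conclusion[OF \<rho> sv rate]
      show ?thesis using E(1) E(2) E(3) E(4) \<rho> by blast
    qed
    obtain Rt0 where Rt0: "is_R_tilde \<beta> \<beta>' lam K \<alpha>2 Rt0" using ex by blast
    note E0 = E[OF Rt0]
    show ?thesis
    proof (intro conjI allI impI ballI)
      show "\<exists>!\<pi>. stationary_prob S P \<pi>" using E0 by (rule conjunct1)
      show "\<exists>Rt. is_R_tilde \<beta> \<beta>' lam K \<alpha>2 Rt" by (rule ex)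
    next
      fix \<pi> assume st: "stationary_prob S P \<pi>"
      note E1 = E0[THEN conjunct2, rule_format, OF st]
      show "(\<integral>\<^sup>+x. ennreal (V x) \<partial>\<pi>) < \<infinity>" using E1 by (rule conjunct1)
      show "integrable \<pi> g" if "g \<in> borel_measurable S" "V_norm S V g < \<infinity>" for g
        using E1 that by blast
      show "integrable (P x) ((markov_op P ^^ n) g)"
        if "g \<in> borel_measurable S" "V_norm S V g < \<infinity>" "x \<in> space S" for g n x
        by (rule intP[OF that])
      fix Rt assume "\<not> is_atom P C \<longrightarrow> is_R_tilde \<beta> \<beta>' lam K \<alpha>2 Rt"
      hence "is_R_tilde \<beta> \<beta>' lam K \<alpha>2 Rt" using False by blast
      note E2 = E[OF this, THEN conjunct2, rule_format, OF st, THEN conjunct2, THEN conjunct2]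
      show "let \<rho> = if is_atom P C then 1 / R1 \<beta> (1 / lam) (ereal (K / lam))
                     else 1 / R1 \<beta> Rt (L_non \<beta>' lam K \<alpha>2 Rt)
            in \<rho> < 1 \<and>
               (\<forall>\<gamma>. \<rho> < \<gamma> \<and> \<gamma> < 1 \<longrightarrow>
                  (let M = if is_atom P C
                            then M_at lam K \<gamma> (K1 (1 / \<gamma>) \<beta> (1 / lam) (ereal (K / lam)))
                            else M_non \<beta>' lam K \<alpha>2 \<gamma>
                                   (K1 (1 / \<gamma>) \<beta> Rt (L_non \<beta>' lam K \<alpha>2 Rt))
                   in M < \<infinity> \<and>
                      (\<forall>x\<in>space S. \<forall>n.
                         (SUP g\<in>{g \<in> borel_measurable S. \<forall>y\<in>space S. \<bar>g y\<bar> \<le> V y}.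
                            ereal \<bar>(markov_op P ^^ n) g x - (\<integral>y. g y \<partial>\<pi>)\<bar>)
                         \<le> M * ereal (V x * \<gamma> ^ n))))"
        unfolding Let_def if_not_P[OF False] Mf_def[symmetric] rho_def[symmetric]
        using E2 unfolding Mf_def rho_def by blast
    qed
  qed
qed

end
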